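(* Let $\Omega\subset\mathbb{R}^N$ be a smooth bounded domain, $s\in(0,1)$, let $g$ and $G$ satisfy the standing assumptions listed in the context, and let $q\in C^1(\overline{\Omega})$ be non-negative. Suppose there exists $\delta>0$ such that $q(x)\le 1$ on $\Omega_\delta:=\{x\in\Omega : \mathrm{dist}(x,\partial\Omega)<\delta\}$, and suppose $f\in L^{\overline{G_*}}(\Omega)$. Then the problem $$(-\Delta_g)^su(x)=f(x)u(x)^{-q(x)}\ \text{in }\Omega,\qquad u>0\ \text{in }\Omega,\qquad u=0\ \text{in }\mathbb{R}^N\setminus\Omega$$ has a weak solution $u\in W^{s,G}_0(\Omega)$ with $\operatorname{ess\,inf}_K u>0$ for any $K\Subset\Omega$.
   Context: **Standing assumptions on $g$, $G$.** $g:[0,\infty)\to\mathbb{R}$ is right continuous and is extended to $\mathbb{R}$ as an odd function; $G(t)=\int_0^t g(\tau)\,d\tau$ for $t\ge 0$. It is assumed that: $g(0)=0$, $g(t)>0$ for $t>0$, $\lim_{t\to\infty}g(t)=\infty$; $g$ is convex on $(0,\infty)$; $g'$ is nondecreasing on $(0,\infty)$; $g=G'$ is absolutely continuous, so differentiable almost everywhere; $\int_0^1 G^{-1}(\tau)\tau^{-\frac{N+s}{N}}d\tau<\infty$ and $\int_1^\infty G^{-1}(\tau)\tau^{-\frac{N+s}{N}}d\tau=\infty$; and there are constants $p^-,p^+$ with $1<p^--1\le \frac{tg'(t)}{g(t)}\le p^+-1<\infty$ for $t>0$. **N-functions and conjugates.** An N-function (Young function) is a function $A(t)=\int_0^t a(\tau)\,d\tau$,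 $t\ge0$, with $a$ right continuous, nondecreasing, $a(0)=0$, $a(t)>0$ for $t>0$, $a(t)\to\infty$ as $t\to\infty$. Its conjugate is $\overline{A}(t)=\int_0^t\overline a(\tau)\,d\tau$ with $\overline a(t)=\sup\{\tau : a(\tau)\le t\}$. The Sobolev conjugate $G_*$ of $G$ is the N-function defined by $G_*^{-1}(t)=\int_0^t G^{-1}(\tau)\tau^{-\frac{N+s}{N}}d\tau$; $\overline{G_*}$ is the conjugate of $G_*$. **Spaces.** For an N-function $A$ and an open set $U\subseteq\mathbb{R}^N$, $L^A(U)$ is the set of measurable $h:U\to\mathbb{R}$ with $\int_U A(|h|/\lambda)\,dx<\infty$ for some $\lambda>0$, with norm $\|h\|_{L^A(U)}=\inf\{\lambda>0:\int_U A(|h|/\lambda)\,dx\le1\}$. Put $M_{W^{s,G}(U)}(h)=\int_U\int_U G\left(\frac{|h(x)-h(y)|}{|x-y|^s}\right)\frac{dx\,dy}{|x-y|^N}$; $W^{s,G}(U)$ is the set of $h\in L^G(U)$ with $M_{W^{s,G}(U)}(h/\lambda)<\infty$ for some $\lambda>0$, with seminorm $\|h\|_{W^{s,G}(U)}=\inf\{\lambda>0: M_{W^{s,G}(U)}(h/\lambda)\le1\}$. $W^{s,G}_0(\Omega)=\{h\in W^{s,G}(\mathbb{R}^N): h\equiv0\text{ on }\mathbb{R}^N\setminus\Omega\}$, normed by $\|\cdot\|_{W^{s,G}(\mathbb{R}^N)}$. $\hat W^{s,G}(\Omega)$ is the set of $u\in L^G_{loc}(\mathbb{R}^N)$ for which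 there is $U\Subset\Omega$ with $\|u\|_{s,G,U}+\int_{\mathbb{R}^N}g\left(\frac{|u(x)|}{1+|x|^s}\right)\frac{dx}{(1+|x|)^{N+s}}<\infty$, where $\|u\|_{s,G,U}$ denotes $\|u\|_{L^G(U)}+\|u\|_{W^{s,G}(U)}$. **Weak solution.** The operator is $(-\Delta_g)^su(x)=\int_{\mathbb{R}^N}g\left(\frac{u(x)-u(y)}{|x-y|^s}\right)\frac{dy}{|x-y|^{N+s}}$. A function $u\in\hat W^{s,G}(\Omega)$ is a weak solution of the problem if $u>0$ in $\Omega$, $f u^{-q(\cdot)}\in L^1_{loc}(\Omega)$, for every $\varphi\in C_c^\infty(\Omega)$ $$\int_{\mathbb{R}^N}\int_{\mathbb{R}^N}g\left(\frac{u(x)-u(y)}{|x-y|^s}\right)\frac{\varphi(x)-\varphi(y)}{|x-y|^{N+s}}\,dx\,dy=\int_\Omega f(x)u(x)^{-q(x)}\varphi(x)\,dx,$$ and the boundary condition holds in the following sense: if $q\le1$ on $\Omega_\delta$ (the case relevant here), then $u\in W^{s,G}_0(\Omega)$.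
   Formalization: The datum f is additionally assumed to be nonnegative almost everywhere in Ω and not almost everywhere zero; without this the claim fails (for example for f = 0 or f = −1 with q = 0). *)

theory Defs
  imports "HOL-Analysis.Analysis" "HOL-Probability.Essential_Supremum"
begin

section \<open>Smooth functions and smooth domains\<close>

primrec Ck_on :: "nat \<Rightarrow> ('a::euclidean_space \<Rightarrow> real) \<Rightarrow> 'a set \<Rightarrow> bool" where
  "Ck_on 0 f S \<longleftrightarrow> continuous_on S f"
| "Ck_on (Suc k) f S \<longleftrightarrow>
     (\<forall>x\<in>S. f differentiable (at x)) \<and>
     (\<forall>i\<in>Basis. Ck_on k (\<lambda>x. frechet_derivative f (at x) i) S)"

definition smooth_fun :: "('a::euclidean_space \<Rightarrow> real) \<Rightarrow> bool" where
  "smooth_fun f \<longleftrightarrow> (\<forall>k. Ck_on k f UNIV)"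

definition test_functions :: "'a::euclidean_space set \<Rightarrow> ('a \<Rightarrow> real) set" where
  "test_functions \<Omega> =
     {\<phi>. smooth_fun \<phi> \<and> compact (closure {x. \<phi> x \<noteq> 0}) \<and> closure {x. \<phi> x \<noteq> 0} \<subseteq> \<Omega>}"

text \<open>\<open>C\<^sup>1\<close> up to the boundary: the function and its first partial derivatives in \<open>\<Omega>\<close>
  have continuous extensions to the closure.\<close>

definition C1_closure :: "'a::euclidean_space set \<Rightarrow> ('a \<Rightarrow> real) \<Rightarrow> bool" where
  "C1_closure \<Omega> q \<longleftrightarrow>
     continuous_on (closure \<Omega>) q \<and>
     (\<forall>x\<in>\<Omega>. q differentiable (at x)) \<and>
     (\<forall>i\<in>Basis. \<exists>d. continuous_on (closure \<Omega>) d \<and>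
                    (\<forall>x\<in>\<Omega>. d x = frechet_derivative q (at x) i))"

text \<open>Near each boundary point the domain is, in suitably rotated coordinates, the region above
  the graph of a smooth function.  The unit vector \<open>e\<close> is the vertical direction, and
  \<open>x - (x \<bullet> e) *\<^sub>R e\<close> is the horizontal part of \<open>x\<close>.\<close>

definition smooth_bounded_domain :: "'a::euclidean_space set \<Rightarrow> bool" where
  "smooth_bounded_domain \<Omega> \<longleftrightarrow>
     open \<Omega> \<and> connected \<Omega> \<and> \<Omega> \<noteq> {} \<and> bounded \<Omega> \<and>
     (\<forall>x0\<in>frontier \<Omega>. \<exists>r>0. \<exists>e. norm e = 1 \<and> (\<exists>\<gamma>. smooth_fun \<gamma> \<and>
        \<Omega> \<inter> ball x0 r = {x \<in> ball x0 r. \<gamma> (x - (x \<bullet> e) *\<^sub>R e) < x \<bullet> e}))"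

definition compactly_contained :: "'a::euclidean_space set \<Rightarrow> 'a set \<Rightarrow> bool" where
  "compactly_contained K \<Omega> \<longleftrightarrow> compact (closure K) \<and> closure K \<subseteq> \<Omega>"

definition boundary_strip :: "'a::euclidean_space set \<Rightarrow> real \<Rightarrow> 'a set" where
  "boundary_strip \<Omega> \<delta> = {x\<in>\<Omega>. infdist x (frontier \<Omega>) < \<delta>}"


section \<open>N-functions\<close>

text \<open>All functions of a real variable below are relevant on \<open>[0,\<infinity>)\<close> only.\<close>

definition N_density :: "(real \<Rightarrow> real) \<Rightarrow> bool" where
  "N_density a \<longleftrightarrow>
     (\<forall>t\<ge>0. continuous (at_right t) a) \<and> mono_on {0..} a \<and> a 0 = 0 \<and>
     (\<forall>t>0. a t > 0) \<and> filterlim a at_top at_top"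

definition primitive :: "(real \<Rightarrow> real) \<Rightarrow> real \<Rightarrow> real" where
  "primitive a t = (LBINT \<tau>:{0..t}. a \<tau>)"

text \<open>The density of an N-function is uniquely determined on \<open>[0,\<infinity>)\<close> by right continuity.\<close>

definition density_of :: "(real \<Rightarrow> real) \<Rightarrow> real \<Rightarrow> real" where
  "density_of A = (SOME a. N_density a \<and> (\<forall>t\<ge>0. A t = primitive a t))"

definition conjugate_density :: "(real \<Rightarrow> real) \<Rightarrow> real \<Rightarrow> real" where
  "conjugate_density a t = Sup {\<tau>. 0 \<le> \<tau> \<and> a \<tau> \<le> t}"

definition N_conjugate :: "(real \<Rightarrow> real) \<Rightarrow> real \<Rightarrow> real" where
  "N_conjugate A = primitive (conjugate_density (density_of A))"

definition inv_half_line :: "(real \<Rightarrow> real) \<Rightarrow> real \<Rightarrow> real" where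
  "inv_half_line A = inv_into {0..} A"

definition sobolev_integrand :: "nat \<Rightarrow> real \<Rightarrow> (real \<Rightarrow> real) \<Rightarrow> real \<Rightarrow> real" where
  "sobolev_integrand N s G \<tau> = inv_half_line G \<tau> * \<tau> powr (- ((real N + s) / real N))"

definition sobolev_conjugate :: "nat \<Rightarrow> real \<Rightarrow> (real \<Rightarrow> real) \<Rightarrow> real \<Rightarrow> real" where
  "sobolev_conjugate N s G = inv_half_line (primitive (sobolev_integrand N s G))"


section \<open>Standing assumptions on \<open>g\<close>\<close>

definition absolutely_continuous_on_interval ::
    "real \<Rightarrow> real \<Rightarrow> (real \<Rightarrow> real) \<Rightarrow> bool" where
  "absolutely_continuous_on_interval a b h \<longleftrightarrow>
     (\<forall>\<epsilon>>0. \<exists>\<delta>>0. \<forall>(I::nat set) l r. finite I \<longrightarrow>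
        (\<forall>i\<in>I. a \<le> l i \<and> l i \<le> r i \<and> r i \<le> b) \<longrightarrow>
        disjoint_family_on (\<lambda>i. {l i<..<r i}) I \<longrightarrow>
        (\<Sum>i\<in>I. r i - l i) < \<delta> \<longrightarrow>
        (\<Sum>i\<in>I. \<bar>h (r i) - h (l i)\<bar>) < \<epsilon>)"

text \<open>\<open>g\<close> is only known to be differentiable almost everywhere, so conditions on its derivative
  are imposed at the points of differentiability.  Absolute continuity on \<open>[0,\<infinity>)\<close> is
  meant on compact subintervals: \<open>g\<close> grows superlinearly, hence is not uniformly continuous.\<close>

definition standing_assumptions :: "nat \<Rightarrow> real \<Rightarrow> (real \<Rightarrow> real) \<Rightarrow> bool" where
  "standing_assumptions N s g \<longleftrightarrow>
     (\<forall>t\<ge>0. continuous (at_right t) g) \<and>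
     (\<forall>t. g (- t) = - g t) \<and>
     g 0 = 0 \<and> (\<forall>t>0. g t > 0) \<and> filterlim g at_top at_top \<and>
     convex_on {0<..} g \<and>
     (\<forall>t1 t2. 0 < t1 \<and> t1 \<le> t2 \<and> g differentiable (at t1) \<and> g differentiable (at t2)
        \<longrightarrow> deriv g t1 \<le> deriv g t2) \<and>
     (\<forall>T>0. absolutely_continuous_on_interval 0 T g) \<and>
     (\<integral>\<^sup>+\<tau>\<in>{0..1}. ennreal (sobolev_integrand N s (primitive g) \<tau>) \<partial>lborel) < \<infinity> \<and>
     (\<integral>\<^sup>+\<tau>\<in>{1..}. ennreal (sobolev_integrand N s (primitive g) \<tau>) \<partial>lborel) = \<infinity> \<and>
     (\<exists>p_minus p_plus. 1 < p_minus - 1 \<and>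
        (\<forall>t>0. g differentiable (at t) \<longrightarrow>
           p_minus - 1 \<le> t * deriv g t / g t \<and> t * deriv g t / g t \<le> p_plus - 1))"


section \<open>Orlicz and fractional Orlicz--Sobolev spaces\<close>

definition orlicz_modular ::
    "(real \<Rightarrow> real) \<Rightarrow> 'a::euclidean_space set \<Rightarrow> ('a \<Rightarrow> real) \<Rightarrow> ennreal" where
  "orlicz_modular A U h = (\<integral>\<^sup>+x. ennreal (A \<bar>h x\<bar>) \<partial>lebesgue_on U)"

definition orlicz_space ::
    "(real \<Rightarrow> real) \<Rightarrow> 'a::euclidean_space set \<Rightarrow> ('a \<Rightarrow> real) set" where
  "orlicz_space A U =
     {h \<in> borel_measurable (lebesgue_on U). \<exists>\<kappa>>0. orlicz_modular A U (\<lambda>x. h x / \<kappa>) < \<infinity>}"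

text \<open>The norms take extended values; the infimum over the empty set is \<open>\<infinity>\<close>.\<close>

definition orlicz_norm ::
    "(real \<Rightarrow> real) \<Rightarrow> 'a::euclidean_space set \<Rightarrow> ('a \<Rightarrow> real) \<Rightarrow> ennreal" where
  "orlicz_norm A U h =
     (INF \<kappa>\<in>{\<kappa>::real. 0 < \<kappa> \<and> orlicz_modular A U (\<lambda>x. h x / \<kappa>) \<le> 1}. ennreal \<kappa>)"

definition orlicz_space_loc ::
    "(real \<Rightarrow> real) \<Rightarrow> 'a::euclidean_space set \<Rightarrow> ('a \<Rightarrow> real) set" where
  "orlicz_space_loc A U = {h. \<forall>K. compact K \<and> K \<subseteq> U \<longrightarrow> h \<in> orlicz_space A K}"

definition frac_modular ::
    "real \<Rightarrow> (real \<Rightarrow> real) \<Rightarrow> 'a::euclidean_space set \<Rightarrow> ('a \<Rightarrow> real) \<Rightarrow> ennreal" where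
  "frac_modular s G U h =
     (\<integral>\<^sup>+(x, y). ennreal (G (\<bar>h x - h y\<bar> / norm (x - y) powr s) / norm (x - y) ^ DIM('a))
        \<partial>lebesgue_on (U \<times> U))"

definition frac_space ::
    "real \<Rightarrow> (real \<Rightarrow> real) \<Rightarrow> 'a::euclidean_space set \<Rightarrow> ('a \<Rightarrow> real) set" where
  "frac_space s G U =
     {h \<in> orlicz_space G U. \<exists>\<kappa>>0. frac_modular s G U (\<lambda>x. h x / \<kappa>) < \<infinity>}"

definition frac_seminorm ::
    "real \<Rightarrow> (real \<Rightarrow> real) \<Rightarrow> 'a::euclidean_space set \<Rightarrow> ('a \<Rightarrow> real) \<Rightarrow> ennreal" where
  "frac_seminorm s G U h =
     (INF \<kappa>\<in>{\<kappa>::real. 0 < \<kappa> \<and> frac_modular s G U (\<lambda>x. h x / \<kappa>) \<le> 1}. ennreal \<kappa>)"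

definition frac_space_zero ::
    "real \<Rightarrow> (real \<Rightarrow> real) \<Rightarrow> 'a::euclidean_space set \<Rightarrow> ('a \<Rightarrow> real) set" where
  "frac_space_zero s G \<Omega> = {h \<in> frac_space s G UNIV. \<forall>x. x \<notin> \<Omega> \<longrightarrow> h x = 0}"

definition frac_space_hat ::
    "real \<Rightarrow> (real \<Rightarrow> real) \<Rightarrow> 'a::euclidean_space set \<Rightarrow> ('a \<Rightarrow> real) set" where
  "frac_space_hat s g \<Omega> =
     {u \<in> orlicz_space_loc (primitive g) UNIV.
        \<exists>U. open U \<and> U \<noteq> {} \<and> compactly_contained U \<Omega> \<and>
          orlicz_norm (primitive g) U u + frac_seminorm s (primitive g) U u
          + (\<integral>\<^sup>+x. ennreal (g (\<bar>u x\<bar> / (1 + norm x powr s))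
                          / (1 + norm x) powr (real DIM('a) + s)) \<partial>lebesgue) < \<infinity>}"


section \<open>Weak solutions\<close>

definition L1_loc :: "'a::euclidean_space set \<Rightarrow> ('a \<Rightarrow> real) set" where
  "L1_loc \<Omega> = {h. \<forall>K. compact K \<and> K \<subseteq> \<Omega> \<longrightarrow> set_integrable lebesgue K h}"

definition weak_form_integrand ::
    "real \<Rightarrow> (real \<Rightarrow> real) \<Rightarrow> ('a::euclidean_space \<Rightarrow> real) \<Rightarrow> ('a \<Rightarrow> real) \<Rightarrow> 'a \<times> 'a \<Rightarrow> real"
  where
  "weak_form_integrand s g u \<phi> = (\<lambda>(x, y).
     g ((u x - u y) / norm (x - y) powr s) * (\<phi> x - \<phi> y)
       / norm (x - y) powr (real DIM('a) + s))"

text \<open>The Bochner integral of a non-integrable function is \<open>0\<close>, so convergence of the double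
  integral is required explicitly; the right-hand side converges because of
  \<open>f u\<^sup>-\<^sup>q \<in> L\<^sup>1\<^sub>l\<^sub>o\<^sub>c\<close>.  The last conjunct is the boundary condition \<open>u = 0\<close> outside \<open>\<Omega>\<close> in the
  form appropriate to exponents with \<open>q \<le> 1\<close> near the boundary, the only case covered here.\<close>

definition weak_solution ::
    "real \<Rightarrow> (real \<Rightarrow> real) \<Rightarrow> 'a::euclidean_space set \<Rightarrow> ('a \<Rightarrow> real) \<Rightarrow> ('a \<Rightarrow> real)
       \<Rightarrow> ('a \<Rightarrow> real) \<Rightarrow> bool" where
  "weak_solution s g \<Omega> f q u \<longleftrightarrow>
     u \<in> frac_space_hat s g \<Omega> \<and>
     (\<forall>x\<in>\<Omega>. u x > 0) \<and>
     (\<lambda>x. f x * u x powr (- q x)) \<in> L1_loc \<Omega> \<and>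
     (\<forall>\<phi>\<in>test_functions \<Omega>.
        integrable lebesgue (weak_form_integrand s g u \<phi>) \<and>
        (LINT z|lebesgue. weak_form_integrand s g u \<phi> z)
          = (LINT x:\<Omega>|lebesgue. f x * u x powr (- q x) * \<phi> x)) \<and>
     u \<in> frac_space_zero s (primitive g) \<Omega>"

definition ess_inf_on :: "'a::euclidean_space set \<Rightarrow> ('a \<Rightarrow> real) \<Rightarrow> ereal" where
  "ess_inf_on K u = - esssup (lebesgue_on K) (\<lambda>x. - ereal (u x))"

end

theory Submission
  imports Defs
begin

text \<open>The right-hand side is regularised to \<open>f (u\<^sup>+ + \<epsilon>)\<^sup>-\<^sup>q\<close>.  Convexity of \<open>g\<close> makes \<open>t \<mapsto> G \<surd>t\<close> convex, so
  \<open>G\<close> satisfies Clarkson's inequality and minimising sequences of the regularised energy converge;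
  \<open>f\<close> is controlled by a Sobolev embedding, obtained by comparing \<open>u\<close> with its decreasing
  rearrangement at the dyadic measures \<open>2\<^sup>-\<^sup>j \<bar>\<Omega>\<bar>\<close>.  The minimisers \<open>u\<^sub>\<epsilon>\<close> increase as \<open>\<epsilon>\<close> decreases, by
  comparison.  Each of them is positive on compact sets: where \<open>u\<^sub>\<epsilon> > \<eta>\<close> on a set of positive
  measure, the jump part of the operator lifts a small multiple of a semiconvex bump to a
  subsolution on any compact set.  Together with \<open>q \<le> 1\<close> near the boundary, this lower bound for a single
  \<open>\<epsilon>\<close> bounds the energies of all \<open>u\<^sub>\<epsilon>\<close>, and the increasing limit solves the equation.\<close>

section \<open>Convex functions on the half-line\<close>

text \<open>The difficulty is an energy bound for u_\<epsilon> that is uniform in \<epsilon>.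
  Testing the equation with its own solution produces f u (u + \<epsilon>)^(-q). Where q \<le> 1
  this is at most f (1 + u + \<epsilon>), linear in u; where q > 1 it needs a lower bound on u
  independent of \<epsilon>. The points with q > 1 lie in a compact subset of \<Omega>, and
  comparison hands the lower bound found there for \<epsilon> = 1 to all smaller \<epsilon>.
  Convexity of t \<mapsto> G(\<surd>t) also gives G(c t) \<le> c^2 G(t) for 0 \<le> c \<le> 1. Hence
  the integral of f u grows at most like the square root of the energy, which makes the functional
  coercive and lets the linear term above be absorbed. In the embedding, the energies found at the
  dyadic levels are replaced by weighted running sums, so that their quotients by the dyadic
  measures grow geometrically; this is what lets the increments of the rearrangement telescope
  against the inverse of the Sobolev conjugate.\<close>

lemma convex_on_real_slopes:
  fixes g :: "real \<Rightarrow> real"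
  assumes "convex_on I g" "x \<in> I" "z \<in> I" "x < y" "y < z"
  shows "(g y - g x) / (y - x) \<le> (g z - g y) / (z - y)"
proof -
  have "(g x - g y) / (x - y) \<le> (g y - g z) / (y - z)"
    using convex_on_slope_le[OF assms] by linarith
  then show ?thesis
    by (metis minus_diff_eq minus_divide_divide)
qed

text \<open>The infimum \<open>m\<close> of the slopes to the right is the right derivative. It is
  nondecreasing, hence discontinuous at countably many points only, and at a continuity point t the
  difference quotients lie between \<open>m t\<close> and \<open>m y\<close>. The assumptions on the
  derivative of g speak only of points of differentiability; density makes them usable.\<close>

lemma convex_on_differentiable_dense:
  fixes g :: "real \<Rightarrow> real"
  assumes cvx: "convex_on {0<..} g" and ab: "0 \<le> a" "a < b"
  obtains y where "a < y" "y < b" "g differentiable (at y)"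
proof -
  define m where "m x = Inf ((\<lambda>y. (g y - g x) / (y - x)) ` {x<..})" for x
  have m_le: "m x \<le> (g y - g x) / (y - x)" if "0 < x" "x < y" for x y
    unfolding m_def
  proof (rule cInf_lower)
    show "bdd_below ((\<lambda>y. (g y - g x) / (y - x)) ` {x<..})"
      using that convex_on_real_slopes[OF cvx, of "x/2" _ x]
      by (intro bdd_belowI2[where m = "(g x - g (x/2)) / (x - x/2)"]) auto
  qed (use that in auto)
  have le_m: "(g y - g x) / (y - x) \<le> m y" if "0 < x" "x < y" for x y
    unfolding m_def
    using that convex_on_real_slopes[OF cvx, of x _ y]
    by (intro cInf_greatest) (auto intro: exI[of _ "y+1"])
  have "mono_on {0<..} m"
    by (rule mono_onI) (metis greaterThan_iff le_m m_le nle_le order.strict_iff_order order_trans)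
  then have "countable {a\<in>{0<..}. \<not> isCont m a}"
    by (intro mono_on_ctble_discont_open) auto
  moreover have "uncountable {a<..<b}"
    using ab uncountable_open_interval by blast
  ultimately have "\<not> {a<..<b} \<subseteq> {a\<in>{0<..}. \<not> isCont m a}"
    using countable_subset by blast
  then obtain t where t: "a < t" "t < b" "isCont m t"
    using ab by auto
  have "((\<lambda>y. (g y - g t) / (y - t)) \<longlongrightarrow> m t) (at t)"
  proof (rule tendsto_sandwich)
    have ev: "eventually (\<lambda>y. y \<in> {0<..} - {t}) (at t)"
      using t ab by (intro eventually_at_in_open) auto
    have *: "min (m t) (m y) \<le> (g y - g t) / (y - t) \<and> (g y - g t) / (y - t) \<le> max (m t) (m y)"
      if "y \<in> {0<..} - {t}" for y
    proof (cases "t < y")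
      case True
      with that t ab m_le[of t y] le_m[of t y] show ?thesis by auto
    next
      case False
      have "(g y - g t) / (y - t) = (g t - g y) / (t - y)"
        by (metis minus_diff_eq minus_divide_divide)
      with False that t ab m_le[of y t] le_m[of y t] show ?thesis by auto
    qed
    show "eventually (\<lambda>y. min (m t) (m y) \<le> (g y - g t) / (y - t)) (at t)"
      "eventually (\<lambda>y. (g y - g t) / (y - t) \<le> max (m t) (m y)) (at t)"
      using ev by (rule eventually_mono; use * in blast)+
    have mt: "m \<midarrow>t\<rightarrow> m t"
      using t(3) by (simp add: isCont_def)
    show "((\<lambda>y. min (m t) (m y)) \<longlongrightarrow> m t) (at t)" "((\<lambda>y. max (m t) (m y)) \<longlongrightarrow> m t) (at t)"
      using tendsto_min[OF tendsto_const mt, of "m t"] tendsto_max[OF tendsto_const mt, of "m t"]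
      by simp_all
  qed
  then have "(g has_real_derivative m t) (at t)"
    by (simp add: has_field_derivative_iff)
  with t that show thesis
    by (auto simp: real_differentiable_def)
qed

text \<open>The convexity inequality is shifted to x + e and y + e inside the open half-line, and e
  tends to 0 from the right.\<close>

lemma convex_on_right_cont_0:
  fixes g :: "real \<Rightarrow> real"
  assumes cvx: "convex_on {0<..} g" and cont: "(g \<longlongrightarrow> g 0) (at_right 0)"
  shows "convex_on {0..} g"
proof (rule convex_on_linorderI)
  show "convex {0::real..}" by simp
  fix t x y :: real
  assume t: "t > 0" "t < 1" and x: "x \<in> {0..}" and y: "y \<in> {0..}" and xy: "x < y"
  have "eventually (\<lambda>e. g ((1 - t) * (x + e) + t * (y + e)) \<le> (1 - t) * g (x + e) + t * g (y + e)) (at_right 0)"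
    using eventually_at_right_less
  proof eventually_elim
    case (elim e)
    then show ?case
      using x y t convex_onD[OF cvx, of t "x + e" "y + e"] by auto
  qed
  moreover have lim: "((\<lambda>e. g (z + e)) \<longlongrightarrow> g z) (at_right 0)" if "z \<ge> 0" for z
  proof (cases "z = 0")
    case False
    have "continuous_on {0<..} g"
      using convex_on_continuous[OF open_greaterThan cvx] .
    then have "isCont g z"
      using that False by (simp add: continuous_on_eq_continuous_at)
    then have "((\<lambda>e. g (z + e)) \<longlongrightarrow> g z) (at 0)"
      by (simp add: isCont_def LIM_offset_zero)
    then show ?thesis
      by (rule filterlim_mono) (auto simp: at_le)
  qed (use cont in simp)
  have "((\<lambda>e. (1 - t) * g (x + e) + t * g (y + e)) \<longlongrightarrow> (1 - t) * g x + t * g y) (at_right 0)"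
    using lim x y by (intro tendsto_intros) auto
  moreover have "((\<lambda>e. g ((1 - t) * (x + e) + t * (y + e))) \<longlongrightarrow> g ((1 - t) * x + t * y)) (at_right 0)"
  proof -
    have "(1 - t) * (x + e) + t * (y + e) = ((1-t) * x + t * y) + e" for e
      by (simp add: algebra_simps)
    moreover have "0 \<le> (1-t) * x + t * y"
      using x y t by simp
    ultimately show ?thesis
      using lim[of "(1-t) * x + t * y"] by simp
  qed
  ultimately show "g ((1 - t) *\<^sub>R x + t *\<^sub>R y) \<le> (1 - t) * g x + t * g y"
    by (simp add: tendsto_le[OF trivial_limit_at_right_real])
qed

text \<open>The tangent at a point y of differentiability slightly above x gives g(y) - g(x) \<le>
  g'(y) (y - x) \<le> \<bar>c\<bar> g(y) (y - x) / y. If y / x is close enough to 1, the right side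
  is at most g(y) / 2, so g at most doubles from x to y; finitely many such steps pass 2 x.\<close>

lemma convex_on_doubling:
  fixes g :: "real \<Rightarrow> real"
  assumes cvx: "convex_on {0<..} g" and pos: "\<And>t. 0 < t \<Longrightarrow> 0 < g t"
    and mono: "mono_on {0..} g"
    and bnd: "\<And>t. 0 < t \<Longrightarrow> g differentiable (at t) \<Longrightarrow> t * deriv g t / g t \<le> c"
  obtains C where "0 < C" "\<And>t. 0 < t \<Longrightarrow> g (2 * t) \<le> C * g t"
proof -
  \<comment> \<open>Small enough that \<bar>c\<bar> \<theta> \<le> 1/2; the ratio y / x will lie
    between 1 + \<theta>/2 and 1 + \<theta>.\<close>
  define \<theta> where "\<theta> = 1 / (2 * (\<bar>c\<bar> + 1))"
  have \<theta>: "0 < \<theta>" by (simp add: \<theta>_def)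
  have step: "g ((1 + \<theta>/2) * x) \<le> 2 * g x" if x: "0 < x" for x
  proof -
    have "(1 + \<theta>/2) * x < (1 + \<theta>) * x"
      using x \<theta> by simp
    then obtain y where y: "(1 + \<theta>/2) * x < y" "y < (1 + \<theta>) * x" "g differentiable (at y)"
      using convex_on_differentiable_dense[OF cvx, of "(1 + \<theta>/2) * x" "(1 + \<theta>) * x"] x \<theta> by auto
    have xy: "x < y" 
    proof -
      have "0 < \<theta>/2 * x" using x \<theta> by simp
      then show ?thesis using y(1) by (simp add: distrib_right)
    qed
    have der: "(g has_real_derivative deriv g y) (at y)"
      using y(3) by (metis DERIV_imp_deriv real_differentiable_def)
    have "g x - g y \<ge> deriv g y * (x - y)"
      using x xy der
      by (intro convex_on_imp_above_tangent[OF cvx, of y]) (auto simp: has_field_derivative_at_within interior_open)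
    then have 1: "g y - g x \<le> deriv g y * (y - x)"
      by (simp add: algebra_simps)
    have gy: "0 < g y" using pos x xy by simp
    have "y * deriv g y \<le> c * g y"
      using bnd[of y] y(3) x xy gy by (simp add: divide_le_eq)
    then have "deriv g y * (y - x) * y \<le> c * g y * (y - x)"
      using xy mult_right_mono[of "y * deriv g y" "c * g y" "y - x"] by (simp add: algebra_simps)
    also have "\<dots> \<le> \<bar>c\<bar> * g y * (\<theta> * x)"
      using xy y gy by (intro mult_mono) (auto simp: algebra_simps)
    also have "\<dots> \<le> (g y / 2) * x"
    proof -
      have "\<bar>c\<bar> * \<theta> \<le> 1/2" by (simp add: \<theta>_def divide_simps)
      then have "(\<bar>c\<bar> * \<theta>) * (g y * x) \<le> 1/2 * (g y * x)"
        using gy x by (intro mult_right_mono) auto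
      then show ?thesis by (simp add: algebra_simps)
    qed
    also have "\<dots> \<le> (g y / 2) * y"
      using xy gy by simp
    finally have "deriv g y * (y - x) \<le> g y / 2"
      using x xy by (rule_tac mult_right_le_imp_le[of _ y]) auto
    with 1 have "g y \<le> 2 * g x" by simp
    moreover have "g ((1 + \<theta>/2) * x) \<le> g y"
      using y(1) x \<theta> xy by (intro mono_onD[OF mono]) auto
    ultimately show ?thesis by simp
  qed
  have iter: "g ((1 + \<theta>/2) ^ n * x) \<le> 2 ^ n * g x" if "0 < x" for n x
  proof (induction n)
    case (Suc n)
    have "g ((1 + \<theta>/2) ^ Suc n * x) \<le> 2 * g ((1 + \<theta>/2) ^ n * x)"
      using step[of "(1 + \<theta>/2) ^ n * x"] that \<theta> by (simp add: mult.assoc)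
    with Suc show ?case by simp
  qed simp
  obtain n where n: "2 < (1 + \<theta>/2) ^ n"
    using real_arch_pow[of "1 + \<theta>/2" 2] \<theta> by auto
  show thesis
  proof (rule that[of "2 ^ n"])
    fix t :: real assume t: "0 < t"
    have "g (2 * t) \<le> g ((1 + \<theta>/2) ^ n * t)"
      using t n by (intro mono_onD[OF mono]) auto
    also have "\<dots> \<le> 2 ^ n * g t" by (rule iter[OF t])
    finally show "g (2 * t) \<le> 2 ^ n * g t" .
  qed simp
qed

section \<open>The primitive of an odd convex function\<close>

lemma primitive_eq_integral:
  assumes "continuous_on {0..t} g"
  shows "primitive g t = integral {0..t} g"
  unfolding primitive_def
  by (rule set_borel_integral_eq_integral) (rule borel_integrable_atLeastAtMost', rule assms)

lemma primitive_deriv_within: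
  assumes "continuous_on {0..b} g" "0 \<le> t" "t \<le> b"
  shows "(primitive g has_real_derivative g t) (at t within {0..b})"
proof -
  have "((\<lambda>x. integral {0..x} g) has_real_derivative g t) (at t within {0..b})"
    using assms by (intro integral_has_real_derivative) auto
  moreover have "primitive g x = integral {0..x} g" if "x \<in> {0..b}" for x
    using that by (intro primitive_eq_integral continuous_on_subset[OF assms(1)]) auto
  ultimately show ?thesis
    using assms by (subst has_field_derivative_cong_eventually[where g = "\<lambda>x. integral {0..x} g"])
      (auto simp: eventually_at_filter)
qed

text \<open>The interface serves two functions: the primitive of g, and later \<open>\<Phi>\<close>,
  whose inverse is the Sobolev conjugate. \<open>inv_half_line\<close> is a bare choice of
  preimages, so its order and continuity properties are derived here from strict monotonicity and
  surjectivity onto [0, \<infinity>).\<close>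

locale half_line_growth =
  fixes F :: "real \<Rightarrow> real"
  assumes F_cont: "continuous_on {0..} F"
    and F_strict: "0 \<le> a \<Longrightarrow> a < b \<Longrightarrow> F a < F b"
    and F_zero: "F 0 = 0"
    and F_top: "filterlim F at_top at_top"
begin

abbreviation Fi :: "real \<Rightarrow> real" where "Fi \<equiv> inv_half_line F"

lemma F_mono: "0 \<le> a \<Longrightarrow> a \<le> b \<Longrightarrow> F a \<le> F b"
  using F_strict[of a b] by (cases "a = b") auto

lemma F_nonneg: "0 \<le> a \<Longrightarrow> 0 \<le> F a"
  using F_mono[of 0 a] by (simp add: F_zero)

lemma F_surj: "0 \<le> y \<Longrightarrow> \<exists>t\<ge>0. F t = y"
proof -
  assume y: "0 \<le> y"
  obtain T where T: "T \<ge> 0" "F T \<ge> y"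
    using F_top y unfolding filterlim_at_top
    by (metis eventually_at_top_linorder nle_le)
  show ?thesis
    using IVT'[of F 0 y T] y T F_zero continuous_on_subset[OF F_cont] by auto
qed

lemma Fi: assumes "0 \<le> y" shows Fi_nonneg: "0 \<le> Fi y" and F_Fi: "F (Fi y) = y"
proof -
  obtain t where t: "t \<ge> 0" "F t = y" using F_surj[OF assms] by blast
  then have "y \<in> F ` {0..}" by auto
  then have "Fi y \<in> {0..}" "F (Fi y) = y"
    unfolding inv_half_line_def by (rule inv_into_into, rule f_inv_into_f)
  then show "0 \<le> Fi y" "F (Fi y) = y" by auto
qed

lemma Fi_F: "0 \<le> t \<Longrightarrow> Fi (F t) = t"
  using F_strict[of t "Fi (F t)"] F_strict[of "Fi (F t)" t] Fi[OF F_nonneg, of t]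
  by (cases t "Fi (F t)" rule: linorder_cases) auto

lemma Fi_zero: "Fi 0 = 0"
  using Fi_F[of 0] by (simp add: F_zero)

lemma Fi_le_iff: "0 \<le> y \<Longrightarrow> 0 \<le> t \<Longrightarrow> Fi y \<le> t \<longleftrightarrow> y \<le> F t"
  using F_mono[of "Fi y" t] F_strict[of t "Fi y"] Fi[of y] by fastforce

lemma le_Fi_iff: "0 \<le> y \<Longrightarrow> 0 \<le> t \<Longrightarrow> t \<le> Fi y \<longleftrightarrow> F t \<le> y"
  using F_mono[of t "Fi y"] F_strict[of "Fi y" t] Fi[of y] by fastforce

lemma Fi_mono: "0 \<le> x \<Longrightarrow> x \<le> y \<Longrightarrow> Fi x \<le> Fi y"
  using Fi[of y] F_Fi[of x] by (subst Fi_le_iff) auto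

lemma Fi_strict: "0 \<le> x \<Longrightarrow> x < y \<Longrightarrow> Fi x < Fi y"
  using Fi[of x] Fi[of y] Fi_mono[of x y] by (cases "Fi x = Fi y") auto

lemma Fi_pos: "0 < y \<Longrightarrow> 0 < Fi y"
  using Fi_strict[of 0 y] by (simp add: Fi_zero)

lemma Fi_cont: "continuous_on {0..} Fi"
proof -
  have "continuous_on {0..} (\<lambda>y. \<bar>Fi y\<bar>)"
    unfolding continuous_on_iff
  proof (intro ballI allI impI)
    fix y e :: real assume y: "y \<in> {0..}" and e: "0 < e"
    define t where "t = Fi y"
    have t: "0 \<le> t" "F t = y" using y Fi[of y] by (auto simp: t_def)
    \<comment> \<open>The smaller of the gaps of \<open>F\<close> on the two sides of t. If t < e,
      the bound from below holds because \<open>Fi\<close> is nonnegative, and 1 is just some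
      positive value.\<close>
    define d where "d = min (F (t + e) - F t) (if t < e then 1 else F t - F (t - e))"
    have "0 < d" using e t by (auto simp: d_def intro!: F_strict)
    moreover have "dist \<bar>Fi x\<bar> \<bar>Fi y\<bar> < e" if x: "x \<in> {0..}" "dist x y < d" for x
    proof -
      have "x < F (t + e)" using x t by (auto simp: d_def dist_real_def)
      then have 1: "Fi x < t + e" using le_Fi_iff[of x "t+e"] x t e by auto
      have 2: "t - e < Fi x"
      proof (cases "t < e")
        case True then show ?thesis using Fi_nonneg[of x] x by auto
      next
        case False
        then have "F (t - e) < x" using x t by (auto simp: d_def dist_real_def)
        then show ?thesis using Fi_le_iff[of x "t-e"] x False by auto
      qed
      show ?thesis using 1 2 t Fi_nonneg[of x] x by (auto simp: dist_real_def t_def[symmetric])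
    qed
    ultimately show "\<exists>d>0. \<forall>x'\<in>{0..}. dist x' y < d \<longrightarrow> dist \<bar>Fi x'\<bar> \<bar>Fi y\<bar> < e" by blast
  qed
  moreover have "\<bar>Fi y\<bar> = Fi y" if "y \<in> {0..}" for y
    using Fi_nonneg[of y] that by simp
  ultimately show ?thesis
    by (metis (no_types, lifting) continuous_on_cong)
qed

lemma Fi_top: "filterlim Fi at_top at_top"
  unfolding filterlim_at_top
proof
  fix Z :: real
  show "eventually (\<lambda>y. Z \<le> Fi y) at_top"
    using eventually_ge_at_top[of "F (max 0 Z)"]
  proof eventually_elim
    case (elim y)
    then have "max 0 Z \<le> Fi y"
      using F_nonneg[of "max 0 Z"] by (subst le_Fi_iff) auto
    then show ?case by simp
  qed
qed

end

section \<open>An odd, convex, doubling function and its even primitive\<close>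

locale odd_convex_growth =
  fixes g :: "real \<Rightarrow> real" and C :: real
  assumes odd: "g (- t) = - g t"
    and pos: "0 < t \<Longrightarrow> 0 < g t"
    and cont: "isCont g t"
    and cvx: "convex_on {0..} g"
    and dbl: "0 \<le> t \<Longrightarrow> g (2 * t) \<le> C * g t"
begin

text \<open>The even extension of G, so that difference quotients of either sign can be inserted
  directly. It is convex and differentiable on the whole line, with derivative g.\<close>

definition E :: "real \<Rightarrow> real" where "E t = primitive g \<bar>t\<bar>"

lemma g_0 [simp]: "g 0 = 0"
  using odd[of 0] by simp

lemma C_pos: "0 < C"
proof -
  have "0 < C * g 1" using dbl[of 1] pos[of 2] by simp
  then show ?thesis using pos[of 1] by (simp add: zero_less_mult_iff)
qed

lemma g_cont [continuous_intros]: "continuous_on A g"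
  using cont by (simp add: continuous_at_imp_continuous_on)

lemma g_measurable [measurable]: "g \<in> borel_measurable borel"
  by (rule borel_measurable_continuous_onI) (rule g_cont)

text \<open>The chord of g from 0 to b gives monotonicity of g(t) / t, stated without division.
  Equivalently, t \<mapsto> G(\<surd>t) has a nondecreasing derivative; all quadratic bounds on
  \<open>E\<close> rest on this.\<close>

lemma g_ratio: "0 \<le> a \<Longrightarrow> a \<le> b \<Longrightarrow> g a * b \<le> g b * a"
proof (cases "b = 0")
  case False
  assume "0 \<le> a" "a \<le> b"
  then have "g ((1 - a/b) *\<^sub>R 0 + (a/b) *\<^sub>R b) \<le> (1 - a/b) * g 0 + (a/b) * g b"
    using False by (intro convex_onD[OF cvx]) auto
  with \<open>0 \<le> a\<close> \<open>a \<le> b\<close> False show ?thesis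
    by (simp add: field_simps)
qed auto

lemma g_strict: "a < b \<Longrightarrow> g a < g b"
proof -
  have *: "g a < g b" if "0 \<le> a" "a < b" for a b
  proof (cases "a = 0")
    case False
    have "g a * a < g a * b"
      using False that pos[of a] by (intro mult_strict_left_mono) auto
    also have "\<dots> \<le> g b * a" using that by (intro g_ratio) auto
    finally show ?thesis using False that by (simp add: mult_less_cancel_right)
  qed (use pos that in auto)
  assume "a < b"
  show ?thesis
  proof (cases "0 \<le> a")
    case True
    then show ?thesis using \<open>a < b\<close> by (rule *)
  next
    case False
    show ?thesis
    proof (cases "0 \<le> b")
      case True
      have "g a < 0" using False pos[of "-a"] odd[of a] by simp
      also have "0 \<le> g b" using True pos[of b] by (cases "b = 0") auto
      finally show ?thesis .
    next
      case False
      with *[of "-b" "-a"] \<open>a < b\<close> show ?thesis by (simp add: odd)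
    qed
  qed
qed

lemma g_mono: "a \<le> b \<Longrightarrow> g a \<le> g b"
  using g_strict[of a b] by (cases "a = b") auto

lemma g_nonneg: "0 \<le> t \<Longrightarrow> 0 \<le> g t"
  using g_mono[of 0 t] by simp

lemma g_abs: "g \<bar>t\<bar> = \<bar>g t\<bar>"
  using odd[of t] g_nonneg[of t] g_nonneg[of "-t"] by (cases "0 \<le> t") auto

lemma E_0 [simp]: "E 0 = 0"
  by (simp add: E_def primitive_eq_integral[OF g_cont])

lemma E_minus [simp]: "E (- t) = E t"
  by (simp add: E_def)

lemma E_abs [simp]: "E \<bar>t\<bar> = E t"
  by (simp add: E_def)

lemma E_eq: "0 \<le> t \<Longrightarrow> E t = integral {0..t} g"
  by (simp add: E_def primitive_eq_integral[OF g_cont])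

lemma E_nonneg: "0 \<le> E t"
  unfolding E_def by (subst primitive_eq_integral[OF g_cont])
    (auto intro!: integral_nonneg integrable_continuous_real g_cont g_nonneg)

lemma E_le: "E t \<le> t * g t"
proof -
  have *: "E t \<le> t * g t" if "0 \<le> t" for t
  proof -
    have "integral {0..t} g \<le> integral {0..t} (\<lambda>_. g t)"
      by (intro integral_le integrable_continuous_real g_cont continuous_intros) (auto intro: g_mono)
    then show ?thesis using that by (simp add: E_eq)
  qed
  show ?thesis
    using *[of t] *[of "- t"] by (cases "0 \<le> t") (simp_all add: odd)
qed

lemma E_deriv: "(E has_real_derivative g t) (at t)"
proof -
  have p: "(E has_real_derivative g t) (at t)" if "0 < t" for t
  proof -
    have "(primitive g has_real_derivative g t) (at t within {0..t+1})"
      using that by (intro primitive_deriv_within g_cont) auto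
    then have "(primitive g has_real_derivative g t) (at t)"
      using that by (subst (asm) at_within_interior) auto
    then show ?thesis
    proof (rule has_field_derivative_transform_within_open)
      show "open {0::real<..}" "t \<in> {0<..}" using that by auto
    qed (simp add: E_def)
  qed
  consider "0 < t" | "t = 0" | "t < 0" by linarith
  then show ?thesis
  proof cases
    case 1
    then show ?thesis by (rule p)
  next
    case 2
    have "((\<lambda>h. E h / h) \<longlongrightarrow> 0) (at 0)"
    proof (rule Lim_null_comparison)
      show "eventually (\<lambda>h. norm (E h / h) \<le> \<bar>g h\<bar>) (at 0)"
        using eventually_neq_at_within
      proof (rule eventually_mono)
        fix h :: real assume h: "h \<noteq> 0"
        have "\<bar>E h\<bar> \<le> \<bar>h * g h\<bar>" using E_le[of h] E_nonneg[of h] by linarith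
        then show "norm (E h / h) \<le> \<bar>g h\<bar>" 
          using h by (simp add: abs_mult divide_le_eq abs_divide mult.commute)
      qed
      have "((\<lambda>h. \<bar>g h\<bar>) \<longlongrightarrow> \<bar>g 0\<bar>) (at 0)"
        using cont[of 0] by (intro tendsto_intros) (simp add: isCont_def)
      then show "((\<lambda>h. \<bar>g h\<bar>) \<longlongrightarrow> 0) (at 0)" by simp
    qed
    with 2 show ?thesis by (simp add: has_field_derivative_iff)
  next
    case 3
    have "(E has_real_derivative g (- t)) (at (- t))"
      using 3 by (intro p) simp
    from DERIV_chain'[OF DERIV_minus[OF DERIV_ident] this]
    show ?thesis by (simp add: odd)
  qed
qed

lemma E_cont [continuous_intros]: "continuous_on A E"
  using E_deriv DERIV_isCont continuous_at_imp_continuous_on by blast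

lemma E_measurable [measurable]: "E \<in> borel_measurable borel"
  by (rule borel_measurable_continuous_onI) (rule E_cont)

lemma E_convex: "convex_on UNIV E"
  by (rule convex_on_realI[OF _ E_deriv]) (auto intro: g_mono)

lemma E_tangent: "E a + g a * (b - a) \<le> E b"
  using convex_on_imp_above_tangent[OF E_convex, of a b "g a"] E_deriv[of a] by simp

lemma E_pos: "t \<noteq> 0 \<Longrightarrow> 0 < E t"
proof -
  assume "t \<noteq> 0"
  have "g (\<bar>t\<bar>/2) * (\<bar>t\<bar>/2) \<le> E \<bar>t\<bar>" 
    using E_tangent[of "\<bar>t\<bar>/2" "\<bar>t\<bar>"] E_nonneg[of "\<bar>t\<bar>/2"] by (simp add: algebra_simps)
  moreover have "0 < g (\<bar>t\<bar>/2) * (\<bar>t\<bar>/2)"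
    using \<open>t \<noteq> 0\<close> by (intro mult_pos_pos pos) auto
  ultimately show ?thesis by simp
qed

lemma E_strict: "0 \<le> a \<Longrightarrow> a < b \<Longrightarrow> E a < E b"
  using E_tangent[of a b] E_pos[of b] pos[of a] by (cases "a = 0") (auto simp: add_strict_increasing intro: order.strict_trans2[rotated])

lemma E_mono: "\<bar>a\<bar> \<le> \<bar>b\<bar> \<Longrightarrow> E a \<le> E b"
  using E_strict[of "\<bar>a\<bar>" "\<bar>b\<bar>"] by (cases "\<bar>a\<bar> = \<bar>b\<bar>") (auto simp: abs_eq_iff)

text \<open>\<open>g_ratio\<close> gives g(c x) \<le> c g(x), and the chain rule contributes another
  factor c, so c^2 E(x) - E(c x) is nondecreasing in x \<ge> 0. The exponent 2, rather than the 1 of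
  plain convexity, later bounds lower-order terms by the square root of the energy.\<close>

lemma E_scale:
  assumes "0 \<le> c" "c \<le> 1"
  shows "E (c * t) \<le> c\<^sup>2 * E t"
proof -
  have *: "E (c * t) \<le> c\<^sup>2 * E t" if "0 \<le> t" for t
  proof -
    have "c\<^sup>2 * E 0 - E (c * 0) \<le> c\<^sup>2 * E t - E (c * t)"
    proof (rule DERIV_nonneg_imp_nondecreasing[OF that])
      fix x :: real assume x: "0 \<le> x" "x \<le> t"
      have "((\<lambda>x. c\<^sup>2 * E x - E (c * x)) has_real_derivative c\<^sup>2 * g x - g (c * x) * c) (at x)"
        by (auto intro!: derivative_eq_intros DERIV_chain2[OF E_deriv] simp: power2_eq_square)
      moreover have "g (c * x) \<le> c * g x"
      proof (cases "x = 0")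
        case False
        have "g (c * x) * x \<le> g x * (c * x)"
          using x assms by (intro g_ratio) (auto simp: mult_left_le_one_le)
        then have "g (c * x) * x \<le> (c * g x) * x" by (simp add: algebra_simps)
        then show ?thesis using False x by (simp add: mult_le_cancel_right)
      qed simp
      then have "g (c * x) * c \<le> (c * g x) * c" using assms by (intro mult_right_mono) auto
      then have "0 \<le> c\<^sup>2 * g x - g (c * x) * c" by (simp add: power2_eq_square algebra_simps)
      ultimately show "\<exists>y. ((\<lambda>x. c\<^sup>2 * E x - E (c * x)) has_real_derivative y) (at x) \<and> 0 \<le> y"
        by blast
    qed
    then show ?thesis by simp
  qed
  show ?thesis
    using *[of "\<bar>t\<bar>"] E_abs[of "c * t"] assms by (simp add: abs_mult)
qed

text \<open>Superadditivity of \<tau> \<mapsto> G(\<surd>\<tau>): with r^2 = x^2 + y^2,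
  \<open>E_scale\<close> bounds E(x) and E(y) by the fractions x^2 / r^2 and y^2 / r^2 of
  E(r).\<close>

lemma E_super:
  "E x + E y \<le> E (sqrt (x\<^sup>2 + y\<^sup>2))"
proof (cases "x = 0 \<and> y = 0")
  case False
  define r where "r = sqrt (x\<^sup>2 + y\<^sup>2)"
  have r: "0 < r" using False by (auto simp: r_def sum_power2_gt_zero_iff)
  have rs: "r\<^sup>2 = x\<^sup>2 + y\<^sup>2" by (simp add: r_def)
  have *: "E z \<le> (z/r)\<^sup>2 * E r" if "z\<^sup>2 \<le> r\<^sup>2" for z
  proof -
    have "\<bar>z\<bar> \<le> r" using that r abs_le_square_iff[of z r] by simp
    then have "E (\<bar>z\<bar>/r * r) \<le> (\<bar>z\<bar>/r)\<^sup>2 * E r"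
      using r by (intro E_scale) auto
    then show ?thesis using r by (simp add: power_divide)
  qed
  have "E x + E y \<le> (x/r)\<^sup>2 * E r + (y/r)\<^sup>2 * E r"
    using rs by (intro add_mono *) auto
  also have "\<dots> = ((x\<^sup>2 + y\<^sup>2) / r\<^sup>2) * E r" by (simp add: power_divide add_divide_distrib distrib_right)
  also have "\<dots> = E r" using r unfolding rs[symmetric] by simp
  finally show ?thesis by (simp add: r_def)
qed simp

text \<open>The tangent line of \<tau> \<mapsto> G(\<surd>\<tau>) at \<tau> = m^2, whose slope is
  g(m) / (2 m). Since g(x) / x is nondecreasing, E(x) - k x^2 / 2 with k = g(m) / m is smallest at x
  = m.\<close>

lemma E_quadratic_support:
  assumes "0 < m" "0 \<le> a"
  shows "E m + g m / (2 * m) * (a\<^sup>2 - m\<^sup>2) \<le> E a"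
proof -
  define k where "k = g m / m"
  have der: "((\<lambda>x. E x - k / 2 * x\<^sup>2) has_real_derivative g x - k * x) (at x)" for x
    by (auto intro!: derivative_eq_intros DERIV_chain2[OF E_deriv])
  have "E m - k / 2 * m\<^sup>2 \<le> E a - k / 2 * a\<^sup>2"
  proof (cases "m \<le> a")
    case True
    show ?thesis
    proof (rule DERIV_nonneg_imp_nondecreasing[OF True])
      fix x assume x: "m \<le> x" "x \<le> a"
      have "0 \<le> g x - k * x" 
        using g_ratio[of m x] x assms by (simp add: k_def field_simps)
      with der show "\<exists>y. ((\<lambda>x. E x - k / 2 * x\<^sup>2) has_real_derivative y) (at x) \<and> 0 \<le> y" by blast
    qed
  next
    case False
    then have "a \<le> m" by simp
    then show ?thesis
    proof (rule DERIV_nonpos_imp_nonincreasing)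
      fix x assume x: "a \<le> x" "x \<le> m"
      have "g x - k * x \<le> 0" 
        using g_ratio[of x m] x assms by (simp add: k_def field_simps)
      with der show "\<exists>y. ((\<lambda>x. E x - k / 2 * x\<^sup>2) has_real_derivative y) (at x) \<and> y \<le> 0" by blast
    qed
  qed
  moreover have "k / 2 = g m / (2 * m)" by (simp add: k_def)
  ultimately show ?thesis by (simp add: right_diff_distrib)
qed

text \<open>By the parallelogram identity the squares of (a + b)/2 and (a - b)/2 add up to m^2 =
  (a^2 + b^2)/2, so superadditivity bounds the left side by E(m). In the average of the two support
  inequalities at m the slope terms cancel, which bounds E(m) by the right side.\<close>

lemma clarkson: "E ((a + b) / 2) + E ((a - b) / 2) \<le> (E a + E b) / 2"
proof (cases "a = 0 \<and> b = 0")
  case False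
  define m where "m = sqrt ((a\<^sup>2 + b\<^sup>2) / 2)"
  have m: "0 < m" using False by (auto simp: m_def sum_power2_gt_zero_iff)
  have ms: "m\<^sup>2 = (a\<^sup>2 + b\<^sup>2) / 2" by (simp add: m_def)
  have "((a + b) / 2)\<^sup>2 + ((a - b) / 2)\<^sup>2 = (a\<^sup>2 + b\<^sup>2) / 2"
    by (simp add: power2_eq_square field_simps)
  then have "E ((a + b) / 2) + E ((a - b) / 2) \<le> E m"
    using E_super[of "(a+b)/2" "(a-b)/2"] by (metis m_def)
  moreover have "E m + g m / (2 * m) * (a\<^sup>2 - m\<^sup>2) \<le> E a" "E m + g m / (2 * m) * (b\<^sup>2 - m\<^sup>2) \<le> E b"
    using E_quadratic_support[OF m, of "\<bar>a\<bar>"] E_quadratic_support[OF m, of "\<bar>b\<bar>"] by auto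
  moreover have "g m / (2 * m) * (a\<^sup>2 - m\<^sup>2) + g m / (2 * m) * (b\<^sup>2 - m\<^sup>2) = 0"
    unfolding distrib_left[symmetric] by (simp add: ms)
  ultimately show ?thesis by simp
qed simp

lemma E_double: "E (2 * t) \<le> 2 * C * E t"
proof -
  have *: "E (2 * t) \<le> 2 * C * E t" if "0 \<le> t" for t
  proof -
    have "2 * C * E 0 - E (2 * 0) \<le> 2 * C * E t - E (2 * t)"
    proof (rule DERIV_nonneg_imp_nondecreasing[OF that])
      fix x :: real assume x: "0 \<le> x" "x \<le> t"
      have "((\<lambda>x. 2 * C * E x - E (2 * x)) has_real_derivative 2 * C * g x - g (2 * x) * 2) (at x)"
        by (auto intro!: derivative_eq_intros DERIV_chain2[OF E_deriv])
      then show "\<exists>y. ((\<lambda>x. 2 * C * E x - E (2 * x)) has_real_derivative y) (at x) \<and> 0 \<le> y"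
        using dbl[of x] x by (intro exI[of _ "2 * C * g x - g (2 * x) * 2"] conjI) auto
    qed
    then show ?thesis by simp
  qed
  show ?thesis
    using *[of "\<bar>t\<bar>"] E_abs[of "2 * t"] by (simp add: abs_mult)
qed

lemma E_mult_bound:
  obtains K where "0 < K" "\<And>t. E (c * t) \<le> K * E t"
proof -
  obtain n :: nat where n: "\<bar>c\<bar> < 2 ^ n"
    using real_arch_pow[of 2 "\<bar>c\<bar>"] by auto
  have pow: "E (2 ^ n * t) \<le> (2 * C) ^ n * E t" for n t
  proof (induction n)
    case (Suc n)
    have "E (2 ^ Suc n * t) \<le> 2 * C * E (2 ^ n * t)"
      using E_double[of "2 ^ n * t"] by (simp add: mult.assoc)
    also have "\<dots> \<le> 2 * C * ((2 * C) ^ n * E t)"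
      using C_pos Suc by (intro mult_left_mono) auto
    finally show ?case by simp
  qed simp
  have "E (c * t) \<le> (2 * C) ^ n * E t" for t
  proof -
    have "E (c * t) \<le> E (2 ^ n * t)"
      using n by (intro E_mono) (auto simp: abs_mult intro!: mult_right_mono)
    with pow[of n t] show ?thesis by linarith
  qed
  then show thesis using C_pos that[of "(2 * C) ^ n"] by simp
qed

text \<open>The tangent at t is evaluated at 2 t, followed by doubling.\<close>

lemma g_mult_le: "t * g t \<le> 2 * C * E t"
proof -
  have "E t + g t * (2 * t - t) \<le> E (2 * t)" by (rule E_tangent)
  with E_double[of t] E_nonneg[of t] show ?thesis by (simp add: algebra_simps)
qed

text \<open>If \<bar>b\<bar> \<le> \<theta> \<bar>a\<bar>, then \<open>g_mult_le\<close> absorbs the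
  product into E(a); otherwise \<bar>a\<bar> is at most \<bar>b\<bar> / \<theta> and doubling leaves
  only E(b). This is a Young inequality expressed through \<open>E\<close> alone, with an
  arbitrarily small coefficient of E(a).\<close>

lemma young_split:
  assumes "0 < \<eta>"
  obtains K where "0 < K" "\<And>a b. \<bar>g a * b\<bar> \<le> \<eta> * E a + K * E b"
proof -
  define \<theta> where "\<theta> = \<eta> / (2 * C)"
  have \<theta>: "0 < \<theta>" using assms C_pos by (simp add: \<theta>_def)
  obtain K where K: "0 < K" "\<And>t. E (1/\<theta> * t) \<le> K * E t" using E_mult_bound[of "1/\<theta>"] by blast
  have "\<bar>g a * b\<bar> \<le> \<eta> * E a + \<eta> * K * E b" for a b
  proof (cases "\<bar>b\<bar> \<le> \<theta> * \<bar>a\<bar>")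
    case True
    have "\<bar>g a * b\<bar> \<le> g \<bar>a\<bar> * (\<theta> * \<bar>a\<bar>)"
      unfolding abs_mult g_abs using True by (intro mult_left_mono) auto
    also have "\<dots> \<le> \<theta> * (2 * C * E a)"
      using g_mult_le[of "\<bar>a\<bar>"] \<theta> by (simp add: algebra_simps)
    also have "\<dots> = \<eta> * E a" using C_pos by (simp add: \<theta>_def)
    finally show ?thesis using assms K(1) E_nonneg[of b] by (simp add: add_increasing2)
  next
    case False
    have "\<bar>a\<bar> \<le> \<bar>b\<bar> / \<theta>" using False \<theta> by (simp add: field_simps)
    then have "\<bar>g a * b\<bar> \<le> g (\<bar>b\<bar> / \<theta>) * \<bar>b\<bar>"
      unfolding abs_mult g_abs[symmetric] by (intro mult_right_mono g_mono) auto
    also have "\<dots> = \<theta> * (\<bar>b\<bar> / \<theta> * g (\<bar>b\<bar> / \<theta>))" using \<theta> by simp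
    also have "\<dots> \<le> \<theta> * (2 * C * E (\<bar>b\<bar> / \<theta>))" using \<theta> by (intro mult_left_mono g_mult_le) auto
    also have "\<dots> = \<eta> * E (\<bar>b\<bar> / \<theta>)" using C_pos by (simp add: \<theta>_def)
    also have "\<dots> \<le> \<eta> * (K * E b)" using K(2)[of "\<bar>b\<bar>"] assms by (intro mult_left_mono) auto
    finally show ?thesis using assms E_nonneg[of a] by (simp add: add_increasing algebra_simps)
  qed
  then show thesis using that[of "\<eta> * K"] K assms by simp
qed

text \<open>By convexity no chord inside [0, T] is steeper than the chord over
  [\<bar>T\<bar>, \<bar>T\<bar> + 1]. Oddness covers negative arguments, and points of opposite sign
  are joined through 0.\<close>

lemma g_lipschitz:
  obtains L where "0 \<le> L" "\<And>a b. \<bar>a\<bar> \<le> T \<Longrightarrow> \<bar>b\<bar> \<le> T \<Longrightarrow> b \<le> a \<Longrightarrow> g a - g b \<le> L * (a - b)"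
proof -
  define L where "L = g (\<bar>T\<bar> + 1) - g \<bar>T\<bar>"
  have L: "0 \<le> L" by (simp add: L_def g_mono)
  have p: "g a - g b \<le> L * (a - b)" if "0 \<le> b" "b \<le> a" "a \<le> T" for a b
  proof (cases "a = b")
    case False
    have "(g a - g b) / (a - b) \<le> (g (\<bar>T\<bar>+1) - g a) / (\<bar>T\<bar>+1 - a)"
      using that False by (intro convex_on_real_slopes[OF cvx]) auto
    also have "\<dots> \<le> L"
    proof (cases "a = \<bar>T\<bar>")
      case False
      have "(g a - g (\<bar>T\<bar>+1)) / (a - (\<bar>T\<bar>+1)) \<le> (g \<bar>T\<bar> - g (\<bar>T\<bar>+1)) / (\<bar>T\<bar> - (\<bar>T\<bar>+1))"
        using that False by (intro convex_on_slope_le(2)[OF cvx]) auto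
      moreover have "(g a - g (\<bar>T\<bar>+1)) / (a - (\<bar>T\<bar>+1)) = (g (\<bar>T\<bar>+1) - g a) / (\<bar>T\<bar>+1 - a)"
        by (metis minus_diff_eq minus_divide_divide)
      ultimately show ?thesis by (simp add: L_def)
    qed (simp add: L_def)
    finally show ?thesis using that False by (simp add: divide_le_eq)
  qed auto
  have "g a - g b \<le> L * (a - b)" if "\<bar>a\<bar> \<le> T" "\<bar>b\<bar> \<le> T" "b \<le> a" for a b
  proof -
    consider "0 \<le> b" | "a \<le> 0" | "b < 0" "0 < a" by linarith
    then show ?thesis
    proof cases
      case 1
      then show ?thesis using that by (intro p) auto
    next
      case 2
      with p[of "-a" "-b"] that show ?thesis by (simp add: odd algebra_simps)
    next
      case 3
      have "g a - g 0 \<le> L * (a - 0)" "g (-b) - g 0 \<le> L * (- b - 0)" using 3 that by (intro p; simp)+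
      then show ?thesis by (simp add: odd algebra_simps)
    qed
  qed
  with L that show thesis by blast
qed

text \<open>Induction on \<open>E_super\<close>, because the root of a sum of squares of nonnegative
  numbers is at most their sum.\<close>

lemma E_superadd:
  assumes "finite J" "\<And>j. j \<in> J \<Longrightarrow> 0 \<le> d j"
  shows "(\<Sum>j\<in>J. E (d j)) \<le> E (\<Sum>j\<in>J. d j)"
  using assms
proof (induction J rule: finite_induct)
  case (insert x J)
  have nn: "0 \<le> d x" "0 \<le> sum d J" using insert by (auto intro: sum_nonneg)
  have "E (d x) + E (sum d J) \<le> E (sqrt ((d x)\<^sup>2 + (sum d J)\<^sup>2))" by (rule E_super)
  also have "\<dots> \<le> E (d x + sum d J)"
    using nn by (intro E_mono) (auto intro!: real_le_lsqrt simp: power2_sum)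
  finally show ?case using insert by auto
qed simp

lemma E_at_top: "filterlim E at_top at_top"
proof (rule filterlim_at_top_mono)
  have "0 < g 1" by (simp add: pos)
  then show "filterlim (\<lambda>t. g 1 * (t - 1)) at_top at_top"
    using filterlim_tendsto_add_at_top[OF tendsto_const filterlim_ident, of "-1"]
    by (auto intro!: filterlim_tendsto_pos_mult_at_top[OF tendsto_const])
  show "eventually (\<lambda>t. g 1 * (t - 1) \<le> E t) at_top"
  proof (intro always_eventually allI)
    fix t show "g 1 * (t - 1) \<le> E t"
      using E_tangent[of 1 t] E_nonneg[of 1] by linarith
  qed
qed

sublocale primitive: half_line_growth "primitive g"
proof
  show "continuous_on {0..} (primitive g)"
    using E_cont by (rule continuous_on_eq) (simp add: E_def)
  show "primitive g a < primitive g b" if "0 \<le> a" "a < b" for a b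
    using E_strict[OF that] that by (simp add: E_def)
  show "primitive g 0 = 0"
    using E_0 by (simp add: E_def)
  show "filterlim (primitive g) at_top at_top"
    using E_at_top by (rule filterlim_mono_eventually)
      (auto simp: E_def eventually_at_top_linorder intro!: exI[of _ 0])
qed

abbreviation Ei :: "real \<Rightarrow> real" where "Ei \<equiv> inv_half_line (primitive g)"

lemma E_Ei: "0 \<le> y \<Longrightarrow> E (Ei y) = y"
  using primitive.Fi[of y] by (simp add: E_def)

text \<open>The gain c^2 of \<open>E_scale\<close> is weakened to c. The result says that
  \<open>Ei\<close> \<tau> / \<tau> is nonincreasing, the form needed for the Sobolev
  integrand.\<close>

lemma Ei_scale: "0 \<le> y \<Longrightarrow> 0 \<le> c \<Longrightarrow> c \<le> 1 \<Longrightarrow> c * Ei y \<le> Ei (c * y)"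
proof -
  assume *: "0 \<le> y" "0 \<le> c" "c \<le> 1"
  have "E (c * Ei y) \<le> c\<^sup>2 * y"
    using E_scale[of c "Ei y"] * E_Ei[of y] by simp
  also have "\<dots> \<le> c * y" using * by (simp add: power2_eq_square mult_left_le_one_le mult_right_mono)
  finally show ?thesis
    using * primitive.Fi_nonneg[of y] by (subst primitive.le_Fi_iff) (auto simp: E_def)
qed

end

section \<open>Conjugates and Young's inequality\<close>

lemma primitive_mono_on:
  assumes a: "mono_on {0..} a" "a 0 = 0" and t: "0 \<le> t"
  shows nn_integral_primitive: "(\<integral>\<^sup>+x. ennreal (a x) * indicator {0..t} x \<partial>lborel) = ennreal (primitive a t)"
    and primitive_nonneg: "0 \<le> primitive a t"
proof -
  have nn: "0 \<le> a x" if "0 \<le> x" for x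
    using mono_onD[OF a(1), of 0 x] a(2) that by simp
  \<comment> \<open>\<open>a\<close> is controlled on [0, \<infinity>) only. Constant continuation
    to the left makes it monotone on the line, hence Borel.\<close>
  define b where "b x = a (max 0 x)" for x
  have "mono b"
    using a(1) by (auto simp: b_def mono_def intro!: mono_onD[OF a(1)])
  then have [measurable]: "b \<in> borel_measurable borel"
    by (rule borel_measurable_mono)
  have eq: "indicator {0..t} x *\<^sub>R a x = indicator {0..t} x *\<^sub>R b x" for x
    by (auto simp: b_def indicator_def)
  have int: "integrable lborel (\<lambda>x. indicator {0..t} x *\<^sub>R b x)"
  proof (rule integrableI_bounded_set_indicator[where B = "a t"])
    show "emeasure lborel {0..t} < \<infinity>" by (simp add: emeasure_lborel_Icc_eq)
    show "AE x in lborel. x \<in> {0..t} \<longrightarrow> norm (b x) \<le> a t"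
    proof (intro AE_I2 impI)
      fix x assume "x \<in> {0..t}"
      then show "norm (b x) \<le> a t"
        using nn[of x] mono_onD[OF a(1), of x t] t by (simp add: b_def)
    qed
  qed auto
  then have si: "set_integrable lborel {0..t} a"
    unfolding set_integrable_def eq .
  have "(\<integral>\<^sup>+x. ennreal (indicator {0..t} x *\<^sub>R a x) \<partial>lborel) = ennreal (primitive a t)"
    unfolding primitive_def set_lebesgue_integral_def
    using si nn by (intro nn_integral_eq_integral) (auto simp: set_integrable_def indicator_def)
  moreover have "ennreal (indicator {0..t} x *\<^sub>R a x) = ennreal (a x) * indicator {0..t} x" for x
    by (simp add: indicator_def)
  ultimately show "(\<integral>\<^sup>+x. ennreal (a x) * indicator {0..t} x \<partial>lborel) = ennreal (primitive a t)"
    by simp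
  show "0 \<le> primitive a t"
    unfolding primitive_def set_lebesgue_integral_def
    using nn by (intro Bochner_Integration.integral_nonneg) (auto simp: indicator_def)
qed

lemma conjugate_density_props:
  assumes "N_density a"
  shows conjugate_density_upper: "0 \<le> \<tau> \<Longrightarrow> a \<tau> \<le> \<sigma> \<Longrightarrow> \<tau> \<le> conjugate_density a \<sigma>"
    and mono_on_conjugate_density: "mono_on {0..} (conjugate_density a)"
    and conjugate_density_0: "conjugate_density a 0 = 0"
proof -
  have bdd: "bdd_above {\<tau>. 0 \<le> \<tau> \<and> a \<tau> \<le> \<sigma>}" for \<sigma>
  proof -
    have "eventually (\<lambda>x. \<sigma> < a x) at_top"
      using assms by (simp add: N_density_def filterlim_at_top_dense)
    then obtain T where T: "\<And>x. T \<le> x \<Longrightarrow> \<sigma> < a x"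
      by (auto simp: eventually_at_top_linorder)
    show ?thesis
    proof (rule bdd_aboveI)
      fix x assume "x \<in> {\<tau>. 0 \<le> \<tau> \<and> a \<tau> \<le> \<sigma>}"
      then show "x \<le> T" using T[of x] by (cases "T \<le> x") auto
    qed
  qed
  show "0 \<le> \<tau> \<Longrightarrow> a \<tau> \<le> \<sigma> \<Longrightarrow> \<tau> \<le> conjugate_density a \<sigma>"
    unfolding conjugate_density_def by (rule cSup_upper) (use bdd in auto)
  show "mono_on {0..} (conjugate_density a)"
    unfolding conjugate_density_def
  proof (intro mono_onI cSup_subset_mono bdd)
    fix r :: real assume "r \<in> {0..}"
    then show "{\<tau>. 0 \<le> \<tau> \<and> a \<tau> \<le> r} \<noteq> {}"
      using assms by (auto simp: N_density_def intro!: exI[of _ 0])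
  qed auto
  have "{\<tau>. 0 \<le> \<tau> \<and> a \<tau> \<le> 0} = {0}"
  proof (intro equalityI subsetI)
    fix x assume "x \<in> {\<tau>. 0 \<le> \<tau> \<and> a \<tau> \<le> 0}"
    moreover have "0 < a x" if "0 < x" using assms that by (auto simp: N_density_def)
    ultimately show "x \<in> {0}" by fastforce
  qed (use assms in \<open>auto simp: N_density_def\<close>)
  then show "conjugate_density a 0 = 0"
    by (simp add: conjugate_density_def)
qed

text \<open>The rectangle [0, t] x [0, c] is cut by the graph of a. The part below has area at most
  the primitive of a. The part above is integrated in the other order: its section at height y lies
  between 0 and the conjugate density at y.\<close>

lemma young_inequality:
  assumes a: "N_density a" and c: "0 \<le> c" and t: "0 \<le> t"
  shows "c * t \<le> primitive a t + primitive (conjugate_density a) c"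
proof -
  let ?k = "conjugate_density a"
  have ma: "mono_on {0..} a" "a 0 = 0" using a by (auto simp: N_density_def)
  note mk = mono_on_conjugate_density[OF a] conjugate_density_0[OF a]
  have a_nn: "0 \<le> a x" if "0 \<le> x" for x using mono_onD[OF ma(1), of 0 x] ma(2) that by simp
  define b where "b x = a (max 0 x)" for x
  have "mono b"
    using ma(1) by (auto simp: b_def mono_def intro!: mono_onD[OF ma(1)])
  then have [measurable]: "b \<in> borel_measurable borel"
    by (rule borel_measurable_mono)
  let ?I = "indicator {0..t} :: real \<Rightarrow> ennreal" and ?J = "indicator {0..c} :: real \<Rightarrow> ennreal"
  have "ennreal (c * t) = (\<integral>\<^sup>+x. ?I x * (\<integral>\<^sup>+y. ?J y \<partial>lborel) \<partial>lborel)"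
  proof -
    have "(\<integral>\<^sup>+x. ?I x * (\<integral>\<^sup>+y. ?J y \<partial>lborel) \<partial>lborel) = (\<integral>\<^sup>+x. ?I x * ennreal c \<partial>lborel)"
      using c by simp
    also have "\<dots> = ennreal t * ennreal c"
      using t by (subst nn_integral_multc) auto
    finally show ?thesis using c t by (simp add: ennreal_mult mult.commute)
  qed
  also have "\<dots> = (\<integral>\<^sup>+x. (\<integral>\<^sup>+y. ?I x * (?J y * indicator {..b x} y) + ?I x * (?J y * indicator {b x<..} y) \<partial>lborel) \<partial>lborel)"
    by (subst nn_integral_cmult[symmetric]) (auto intro!: nn_integral_cong simp: indicator_def)
  also have "\<dots> = (\<integral>\<^sup>+x. ?I x * (\<integral>\<^sup>+y. ?J y * indicator {..b x} y \<partial>lborel) \<partial>lborel)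
      + (\<integral>\<^sup>+x. (\<integral>\<^sup>+y. ?I x * (?J y * indicator {b x<..} y) \<partial>lborel) \<partial>lborel)"
  proof (subst nn_integral_add[symmetric])
    have *: "(\<lambda>z. indicator {..b (fst z)} (snd z) :: ennreal) \<in> borel_measurable (lborel \<Otimes>\<^sub>M lborel)"
      "(\<lambda>z. indicator {b (fst z)<..} (snd z) :: ennreal) \<in> borel_measurable (lborel \<Otimes>\<^sub>M lborel)"
      by (simp_all add: indicator_def)
    show "(\<lambda>x. ?I x * (\<integral>\<^sup>+y. ?J y * indicator {..b x} y \<partial>lborel)) \<in> borel_measurable lborel"
      "(\<lambda>x. \<integral>\<^sup>+y. ?I x * (?J y * indicator {b x<..} y) \<partial>lborel) \<in> borel_measurable lborel"
      using * by (auto intro!: borel_measurable_times_ennreal lborel.borel_measurable_nn_integral simp: split_beta')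
  qed (auto intro!: nn_integral_cong simp: nn_integral_add nn_integral_cmult)
  finally have 1: "ennreal (c * t) = (\<integral>\<^sup>+x. ?I x * (\<integral>\<^sup>+y. ?J y * indicator {..b x} y \<partial>lborel) \<partial>lborel)
      + (\<integral>\<^sup>+x. (\<integral>\<^sup>+y. ?I x * (?J y * indicator {b x<..} y) \<partial>lborel) \<partial>lborel)" .
  have "(\<integral>\<^sup>+x. ?I x * (\<integral>\<^sup>+y. ?J y * indicator {..b x} y \<partial>lborel) \<partial>lborel) \<le> (\<integral>\<^sup>+x. ennreal (a x) * ?I x \<partial>lborel)"
  proof (intro nn_integral_mono)
    fix x
    show "?I x * (\<integral>\<^sup>+y. ?J y * indicator {..b x} y \<partial>lborel) \<le> ennreal (a x) * ?I x"
    proof (cases "x \<in> {0..t}")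
      case True
      have "(\<integral>\<^sup>+y. ?J y * indicator {..b x} y \<partial>lborel) \<le> (\<integral>\<^sup>+y. indicator {0..b x} y \<partial>lborel)"
        by (intro nn_integral_mono) (auto simp: indicator_def)
      also have "\<dots> = ennreal (a x)" using True a_nn by (simp add: b_def)
      finally show ?thesis using True by simp
    qed simp
  qed
  then have 2: "(\<integral>\<^sup>+x. ?I x * (\<integral>\<^sup>+y. ?J y * indicator {..b x} y \<partial>lborel) \<partial>lborel) \<le> ennreal (primitive a t)"
    by (simp add: nn_integral_primitive[OF ma t])
  have "(\<integral>\<^sup>+x. (\<integral>\<^sup>+y. ?I x * (?J y * indicator {b x<..} y) \<partial>lborel) \<partial>lborel)
      = (\<integral>\<^sup>+y. (\<integral>\<^sup>+x. ?I x * (?J y * indicator {b x<..} y) \<partial>lborel) \<partial>lborel)"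
  proof (rule lborel_pair.Fubini'[symmetric])
    have "(\<lambda>z. indicator {b (fst z)<..} (snd z) :: ennreal) \<in> borel_measurable (lborel \<Otimes>\<^sub>M lborel)"
      by (simp add: indicator_def)
    then show "(\<lambda>(x, y). ?I x * (?J y * indicator {b x<..} y)) \<in> borel_measurable (lborel \<Otimes>\<^sub>M lborel)"
      unfolding split_beta' by (intro borel_measurable_times_ennreal) auto
  qed
  also have "\<dots> \<le> (\<integral>\<^sup>+y. ennreal (?k y) * ?J y \<partial>lborel)"
  proof (intro nn_integral_mono)
    fix y
    show "(\<integral>\<^sup>+x. ?I x * (?J y * indicator {b x<..} y) \<partial>lborel) \<le> ennreal (?k y) * ?J y"
    proof (cases "y \<in> {0..c}")
      case True
      have "(\<integral>\<^sup>+x. ?I x * (?J y * indicator {b x<..} y) \<partial>lborel) \<le> (\<integral>\<^sup>+x. indicator {0..?k y} x \<partial>lborel)"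
        using conjugate_density_upper[OF a] by (intro nn_integral_mono) (auto simp: indicator_def b_def)
      also have "\<dots> = ennreal (?k y)"
        using mono_onD[OF mk(1), of 0 y] mk(2) True by simp
      finally show ?thesis using True by simp
    qed simp
  qed
  finally have 3: "(\<integral>\<^sup>+x. (\<integral>\<^sup>+y. ?I x * (?J y * indicator {b x<..} y) \<partial>lborel) \<partial>lborel) \<le> ennreal (primitive ?k c)"
    by (simp add: nn_integral_primitive[OF mk c])
  have "ennreal (c * t) \<le> ennreal (primitive a t) + ennreal (primitive ?k c)"
    unfolding 1 by (intro add_mono 2 3)
  then show ?thesis
    using primitive_nonneg[OF ma t] primitive_nonneg[OF mk c]
    by (simp add: ennreal_plus[symmetric] ennreal_le_iff del: ennreal_plus)
qed

section \<open>The Sobolev conjugate and its density\<close>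

locale sobolev_growth = odd_convex_growth +
  fixes N :: nat and s :: real
  assumes N: "0 < N" and s: "0 < s"
    and int_0: "(\<integral>\<^sup>+\<tau>\<in>{0..1}. ennreal (sobolev_integrand N s (primitive g) \<tau>) \<partial>lborel) < \<infinity>"
    and int_inf: "(\<integral>\<^sup>+\<tau>\<in>{1..}. ennreal (sobolev_integrand N s (primitive g) \<tau>) \<partial>lborel) = \<infinity>"
begin

abbreviation h :: "real \<Rightarrow> real" where "h \<equiv> sobolev_integrand N s (primitive g)"

text \<open>The inverse of the Sobolev conjugate, so that \<open>Gs\<close> below is the conjugate
  itself. The integrand \<open>h\<close> is unbounded near 0; \<open>int_0\<close> keeps the
  primitive finite and \<open>int_inf\<close> makes it onto [0, \<infinity>).\<close>

abbreviation \<Phi> :: "real \<Rightarrow> real" where "\<Phi> \<equiv> primitive h"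

definition \<theta> :: real where "\<theta> = s / real N"

lemma \<theta>_pos: "0 < \<theta>" using N s by (simp add: \<theta>_def)

lemma h_eq: "h \<tau> = Ei \<tau> * \<tau> powr (- (1 + \<theta>))"
  using N by (simp add: sobolev_integrand_def \<theta>_def add_divide_distrib)

lemma h_0 [simp]: "h 0 = 0" by (simp add: h_eq)

lemma h_pos: "0 < \<tau> \<Longrightarrow> 0 < h \<tau>"
  by (simp add: h_eq primitive.Fi_pos)

lemma h_nonneg: "0 \<le> \<tau> \<Longrightarrow> 0 \<le> h \<tau>"
  using h_pos[of \<tau>] by (cases "\<tau> = 0") (simp_all add: less_imp_le)

lemma h_cont: "continuous_on {0<..} h"
  unfolding h_eq[abs_def]
  by (intro continuous_intros continuous_on_subset[OF primitive.Fi_cont]) auto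

lemma h_factor: "0 < \<tau> \<Longrightarrow> h \<tau> = Ei \<tau> / \<tau> * \<tau> powr (- \<theta>)"
  using powr_add[of \<tau> "-1" "-\<theta>"] by (simp add: h_eq powr_neg_one)

lemma Ei_ratio: "0 < a \<Longrightarrow> a \<le> b \<Longrightarrow> Ei b / b \<le> Ei a / a"
  using Ei_scale[of b "a / b"] by (simp add: field_simps)

text \<open>Both factors in \<open>h_factor\<close> are nonincreasing. Hence \<open>\<Phi>\<close>
  is concave, and each of its increments is comparable with an endpoint value of \<open>h\<close>
  times the length of the interval.\<close>

lemma h_antimono: "h b \<le> h a" if ab: "0 < a" "a \<le> b"
proof -
  have "Ei b / b * b powr (- \<theta>) \<le> Ei a / a * a powr (- \<theta>)"
    using ab Ei_ratio[OF ab] primitive.Fi_nonneg[of a] \<theta>_pos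
    by (intro mult_mono powr_mono2') auto
  then show ?thesis using ab using h_factor[of a] h_factor[of b] by simp
qed

lemma h_measurable: "(\<lambda>\<tau>. indicator {0..t} \<tau> * h \<tau>) \<in> borel_measurable borel"
proof -
  have "(\<lambda>\<tau>. indicator {0<..} \<tau> *\<^sub>R h \<tau>) \<in> borel_measurable borel"
    by (rule borel_measurable_continuous_on_indicator[OF _ h_cont]) simp
  then have "(\<lambda>\<tau>. indicator {..t} \<tau> * (indicator {0<..} \<tau> *\<^sub>R h \<tau>)) \<in> borel_measurable borel"
    by (rule borel_measurable_times[rotated]) simp
  moreover have eq: "indicator {..t} \<tau> * (indicator {0<..} \<tau> *\<^sub>R h \<tau>) = indicator {0..t} \<tau> * h \<tau>" for \<tau> :: real
    by (cases "\<tau> = 0") (auto simp: indicator_def)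
  ultimately show ?thesis unfolding eq by simp
qed

lemma h_nn_finite: "(\<integral>\<^sup>+\<tau>. ennreal (indicator {0..t} \<tau> * h \<tau>) \<partial>lborel) < \<infinity>"
proof -
  have "(\<integral>\<^sup>+\<tau>. ennreal (indicator {0..t} \<tau> * h \<tau>) \<partial>lborel)
      \<le> (\<integral>\<^sup>+\<tau>. ennreal (indicator {0..1} \<tau> * h \<tau>) + ennreal (h 1) * indicator {1..t} \<tau> \<partial>lborel)"
  proof (intro nn_integral_mono)
    fix \<tau> show "ennreal (indicator {0..t} \<tau> * h \<tau>) \<le> ennreal (indicator {0..1} \<tau> * h \<tau>) + ennreal (h 1) * indicator {1..t} \<tau>"
    proof (cases "1 < \<tau> \<and> \<tau> \<le> t")
      case True
      then show ?thesis using h_antimono[of 1 \<tau>] by (simp add: indicator_def ennreal_leI)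
    next
      case False
      then have "indicator {0..t} \<tau> * h \<tau> = 0 \<or> indicator {0..t} \<tau> * h \<tau> = indicator {0..1} \<tau> * h \<tau>"
        by (auto simp: indicator_def)
      then show ?thesis by (auto simp: add_increasing2)
    qed
  qed
  also have "\<dots> = (\<integral>\<^sup>+\<tau>. ennreal (indicator {0..1} \<tau> * h \<tau>) \<partial>lborel) + ennreal (h 1) * emeasure lborel {1..t}"
  proof (subst nn_integral_add)
    show "(\<lambda>\<tau>. ennreal (indicator {0..1} \<tau> * h \<tau>)) \<in> borel_measurable lborel"
      using measurable_compose[OF h_measurable measurable_ennreal, of 1] by simp
  qed (simp_all add: nn_integral_cmult)
  also have "\<dots> < \<infinity>"
  proof -
    have "(\<integral>\<^sup>+\<tau>. ennreal (indicator {0..1} \<tau> * h \<tau>) \<partial>lborel) = (\<integral>\<^sup>+\<tau>\<in>{0..1}. ennreal (h \<tau>) \<partial>lborel)"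
      by (intro nn_integral_cong) (auto simp: indicator_def)
    then show ?thesis using int_0 by (simp add: ennreal_mult_less_top emeasure_lborel_Icc_eq)
  qed
  finally show ?thesis .
qed

lemma h_integrable: "set_integrable lborel {0..t} h"
  unfolding set_integrable_def
proof (rule integrableI_bounded)
  show "(\<lambda>\<tau>. indicat_real {0..t} \<tau> *\<^sub>R h \<tau>) \<in> borel_measurable lborel"
    using h_measurable[of t] by simp
  show "(\<integral>\<^sup>+\<tau>. ennreal (norm (indicat_real {0..t} \<tau> *\<^sub>R h \<tau>)) \<partial>lborel) < \<infinity>"
  proof -
    have "norm (indicat_real {0..t} \<tau> *\<^sub>R h \<tau>) = indicator {0..t} \<tau> * h \<tau>" for \<tau>
      using h_nonneg[of \<tau>] by (auto simp: indicator_def)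
    then show ?thesis using h_nn_finite[of t] by simp
  qed
qed

lemma \<Phi>_diff:
  assumes "0 \<le> a" "a \<le> b"
  shows "\<Phi> b - \<Phi> a = (LBINT \<tau>:{a<..b}. h \<tau>)" and "(b - a) * h b \<le> \<Phi> b - \<Phi> a"
    and "0 < a \<Longrightarrow> \<Phi> b - \<Phi> a \<le> (b - a) * h a"
proof -
  have si: "set_integrable lborel {a<..b} h"
    using assms by (intro set_integrable_subset[OF h_integrable[of b]]) auto
  have "{0..b} = {0..a} \<union> {a<..b}" "{0..a} \<inter> {a<..b} = {}" using assms by auto
  then show eq: "\<Phi> b - \<Phi> a = (LBINT \<tau>:{a<..b}. h \<tau>)"
    unfolding primitive_def[of h] using set_integral_Un[OF _ h_integrable[of a] si] by simp
  have sc: "set_integrable lborel {a<..b} (\<lambda>_. c :: real)" for c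
    using assms unfolding set_integrable_def
    by (auto intro!: integrable_mult_left integrable_real_indicator)
  have m: "(LBINT \<tau>:{a<..b}. c) = (b - a) * c" for c :: real
    using assms by (simp add: set_lebesgue_integral_def measure_def)
  have "(LBINT \<tau>:{a<..b}. h b) \<le> (LBINT \<tau>:{a<..b}. h \<tau>)"
    using assms by (intro set_integral_mono si sc h_antimono) auto
  then show "(b - a) * h b \<le> \<Phi> b - \<Phi> a" by (simp add: eq m)
  show "\<Phi> b - \<Phi> a \<le> (b - a) * h a" if "0 < a"
  proof -
    have "(LBINT \<tau>:{a<..b}. h \<tau>) \<le> (LBINT \<tau>:{a<..b}. h a)"
      using assms that by (intro set_integral_mono si sc h_antimono) auto
    then show ?thesis by (simp add: eq m)
  qed
qed

lemma \<Phi>_0: "\<Phi> 0 = 0"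
  unfolding primitive_def[of h] set_lebesgue_integral_def
  by (rule trans[OF Bochner_Integration.integral_cong integral_zero]) (auto simp: indicator_def)

lemma \<Phi>_nn: "ennreal (\<Phi> t) = (\<integral>\<^sup>+\<tau>. ennreal (indicator {0..t} \<tau> * h \<tau>) \<partial>lborel)"
  unfolding primitive_def[of h] set_lebesgue_integral_def real_scaleR_def
  using h_integrable[of t] h_nonneg unfolding set_integrable_def real_scaleR_def
  by (intro nn_integral_eq_integral[symmetric] AE_I2) (auto simp: indicator_def)

lemma \<Phi>_strict: "0 \<le> a \<Longrightarrow> a < b \<Longrightarrow> \<Phi> a < \<Phi> b"
  using \<Phi>_diff(2)[of a b] mult_pos_pos[OF _ h_pos[of b], of "b - a"] by simp

lemma \<Phi>_deriv: "0 < t \<Longrightarrow> (\<Phi> has_real_derivative h t) (at t)"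
proof -
  assume t: "0 < t"
  have ev: "eventually (\<lambda>y. y \<in> {0<..} - {t}) (at t)"
    using t by (intro eventually_at_in_open) auto
  have h: "h \<midarrow>t\<rightarrow> h t"
    using h_cont t by (simp add: continuous_on_eq_continuous_at isCont_def)
  have *: "min (h t) (h y) \<le> (\<Phi> y - \<Phi> t) / (y - t) \<and> (\<Phi> y - \<Phi> t) / (y - t) \<le> max (h t) (h y)"
    if "y \<in> {0<..} - {t}" for y
  proof (cases "t < y")
    case True
    then show ?thesis using \<Phi>_diff(2,3)[of t y] t by (simp add: min_le_iff_disj le_max_iff_disj field_simps)
  next
    case False
    have "(\<Phi> y - \<Phi> t) / (y - t) = (\<Phi> t - \<Phi> y) / (t - y)"
      by (metis minus_diff_eq minus_divide_divide)
    with False show ?thesis using \<Phi>_diff(2,3)[of y t] that by (simp add: min_le_iff_disj le_max_iff_disj field_simps)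
  qed
  have "((\<lambda>y. (\<Phi> y - \<Phi> t) / (y - t)) \<longlongrightarrow> h t) (at t)"
  proof (rule tendsto_sandwich)
    show "eventually (\<lambda>y. min (h t) (h y) \<le> (\<Phi> y - \<Phi> t) / (y - t)) (at t)"
      "eventually (\<lambda>y. (\<Phi> y - \<Phi> t) / (y - t) \<le> max (h t) (h y)) (at t)"
      using ev by (rule eventually_mono; use * in blast)+
    show "((\<lambda>y. min (h t) (h y)) \<longlongrightarrow> h t) (at t)" "((\<lambda>y. max (h t) (h y)) \<longlongrightarrow> h t) (at t)"
      using tendsto_min[OF tendsto_const h, of "h t"] tendsto_max[OF tendsto_const h, of "h t"]
      by simp_all
  qed
  then show ?thesis by (simp add: has_field_derivative_iff)
qed

lemma \<Phi>_cont: "continuous_on {0..} \<Phi>"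
proof -
  have "continuous_on {0..T} \<Phi>" if "0 \<le> T" for T
  proof -
    have "\<Phi> x = integral {0..x} h" if "x \<in> {0..T}" for x
      unfolding primitive_def[of h] by (rule set_borel_integral_eq_integral(2)[OF h_integrable])
    moreover have "continuous_on {0..T} (\<lambda>x. integral {0..x} h)"
      by (intro indefinite_integral_continuous_1 set_borel_integral_eq_integral(1)[OF h_integrable])
    ultimately show ?thesis by (subst continuous_on_cong[OF refl]) auto
  qed
  note T = this
  have 0: "continuous (at 0 within {0..}) \<Phi>"
  proof -
    have "continuous (at 0 within {0..1}) \<Phi>"
      using T[of 1] by (simp add: continuous_on_eq_continuous_within)
    moreover have "at (0::real) within {0..} = at 0 within {0..1}"
      by (rule at_within_nhd[of _ "{-1<..<1}"]) auto
    ultimately show ?thesis by simp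
  qed
  show ?thesis
    unfolding continuous_on_eq_continuous_within
  proof
    fix x :: real assume "x \<in> {0..}"
    then show "continuous (at x within {0..}) \<Phi>"
      using 0 DERIV_isCont[OF \<Phi>_deriv, of x] by (cases "x = 0") (auto intro: continuous_at_imp_continuous_within)
  qed
qed

lemma \<Phi>_top: "filterlim \<Phi> at_top at_top"
proof -
  have mono: "\<Phi> a \<le> \<Phi> b" if "0 \<le> a" "a \<le> b" for a b
    using \<Phi>_strict[of a b] that by (cases "a = b") auto
  have "\<exists>T\<ge>0. Z < \<Phi> T" for Z
  proof (rule ccontr)
    assume "\<not> ?thesis"
    then have bd: "\<Phi> T \<le> Z" if "0 \<le> T" for T using that by force
    have "(\<integral>\<^sup>+\<tau>. ennreal (indicator {0..} \<tau> * h \<tau>) \<partial>lborel) = (SUP n. \<integral>\<^sup>+\<tau>. ennreal (indicator {0..real n} \<tau> * h \<tau>) \<partial>lborel)"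
    proof (subst nn_integral_monotone_convergence_SUP[symmetric])
      show "incseq (\<lambda>n \<tau>. ennreal (indicator {0..real n} \<tau> * h \<tau>))"
        using h_nonneg by (auto simp: incseq_def le_fun_def indicator_def)
      show "(\<lambda>\<tau>. ennreal (indicator {0..real n} \<tau> * h \<tau>)) \<in> borel_measurable lborel" for n
        using measurable_compose[OF h_measurable measurable_ennreal, of "real n"] by simp
      have "ennreal (indicator {0..} \<tau> * h \<tau>) = (SUP n. ennreal (indicator {0..real n} \<tau> * h \<tau>))" for \<tau>
      proof (rule antisym)
        obtain n where "\<tau> \<le> real n" using real_arch_simple by blast
        then show "ennreal (indicator {0..} \<tau> * h \<tau>) \<le> (SUP n. ennreal (indicator {0..real n} \<tau> * h \<tau>))"
          by (intro SUP_upper2[of n]) (auto simp: indicator_def)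
        show "(SUP n. ennreal (indicator {0..real n} \<tau> * h \<tau>)) \<le> ennreal (indicator {0..} \<tau> * h \<tau>)"
          using h_nonneg by (intro SUP_least) (auto simp: indicator_def)
      qed
      then show "(\<integral>\<^sup>+\<tau>. ennreal (indicator {0..} \<tau> * h \<tau>) \<partial>lborel) = (\<integral>\<^sup>+\<tau>. (SUP n. ennreal (indicator {0..real n} \<tau> * h \<tau>)) \<partial>lborel)"
        by simp
    qed
    also have "\<dots> \<le> ennreal Z"
      unfolding \<Phi>_nn[symmetric] using bd by (intro SUP_least ennreal_leI) auto
    finally have "(\<integral>\<^sup>+\<tau>. ennreal (indicator {0..} \<tau> * h \<tau>) \<partial>lborel) < \<infinity>"
      by (auto simp: order_le_less_trans)
    moreover have "(\<integral>\<^sup>+\<tau>\<in>{1..}. ennreal (h \<tau>) \<partial>lborel) \<le> (\<integral>\<^sup>+\<tau>. ennreal (indicator {0..} \<tau> * h \<tau>) \<partial>lborel)"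
      by (intro nn_integral_mono) (auto simp: indicator_def)
    ultimately show False using int_inf by simp
  qed
  then show ?thesis
    unfolding filterlim_at_top eventually_at_top_linorder
    by (meson mono dual_order.trans less_imp_le)
qed

sublocale conj: half_line_growth \<Phi>
  by unfold_locales (fact \<Phi>_cont \<Phi>_strict \<Phi>_0 \<Phi>_top)+

abbreviation Gs :: "real \<Rightarrow> real" where "Gs \<equiv> inv_half_line \<Phi>"

text \<open>The derivative of the inverse of \<open>\<Phi>\<close>. The value 0 at 0 is the limit
  from the right, as \<open>h\<close> tends to \<infinity> there.\<close>

definition gs :: "real \<Rightarrow> real" where "gs t = (if t \<le> 0 then 0 else 1 / h (Gs t))"

lemma gs_0 [simp]: "gs 0 = 0" by (simp add: gs_def)

lemma gs_pos: "0 < t \<Longrightarrow> 0 < gs t"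
  by (simp add: gs_def h_pos conj.Fi_pos)

lemma gs_mono: "a \<le> b \<Longrightarrow> gs a \<le> gs b"
proof -
  assume "a \<le> b"
  consider "b \<le> 0" | "a \<le> 0" "0 < b" | "0 < a" by linarith
  then show ?thesis
  proof cases
    case 3
    then have "h (Gs b) \<le> h (Gs a)"
      using \<open>a \<le> b\<close> by (intro h_antimono conj.Fi_pos conj.Fi_mono) auto
    then show ?thesis
      using 3 \<open>a \<le> b\<close> by (simp add: gs_def frac_le h_pos conj.Fi_pos)
  qed (use \<open>a \<le> b\<close> gs_pos[of b] in \<open>auto simp: gs_def\<close>)
qed

text \<open>The ratio \<open>Ei\<close> \<tau> / \<tau> is compared with its value at \<tau> = 1.
  Together with \<open>gs_lower\<close>, the same comparison on the other side of 1, this yields the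
  limits 0 at 0 and \<infinity> at \<infinity> demanded of a density.\<close>

lemma gs_upper: "0 < t \<Longrightarrow> Gs t \<le> 1 \<Longrightarrow> gs t \<le> Gs t powr \<theta> / Ei 1"
proof -
  assume t: "0 < t" "Gs t \<le> 1"
  have p: "0 < Gs t" using t by (simp add: conj.Fi_pos)
  have e: "0 < Ei 1" by (simp add: primitive.Fi_pos)
  have "Ei 1 \<le> Ei (Gs t) / Gs t"
    using Ei_ratio[of "Gs t" 1] p t by simp
  from mult_right_mono[OF this, of "Gs t powr (- \<theta>)"]
  have "Ei 1 * Gs t powr (- \<theta>) \<le> h (Gs t)"
    using h_factor[OF p] by simp
  then have "1 / h (Gs t) \<le> 1 / (Ei 1 * Gs t powr (- \<theta>))"
    using p e by (intro divide_left_mono) (auto simp: h_pos)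
  then show ?thesis
    using t p by (simp add: gs_def powr_minus field_simps)
qed

lemma gs_lower: "0 < t \<Longrightarrow> 1 \<le> Gs t \<Longrightarrow> Gs t powr \<theta> / Ei 1 \<le> gs t"
proof -
  assume t: "0 < t" "1 \<le> Gs t"
  have p: "0 < Gs t" using t by (simp add: conj.Fi_pos)
  have e: "0 < Ei 1" by (simp add: primitive.Fi_pos)
  have "Ei (Gs t) / Gs t \<le> Ei 1"
    using Ei_ratio[of 1 "Gs t"] p t by simp
  from mult_right_mono[OF this, of "Gs t powr (- \<theta>)"]
  have "h (Gs t) \<le> Ei 1 * Gs t powr (- \<theta>)"
    using h_factor[OF p] by simp
  then have "1 / (Ei 1 * Gs t powr (- \<theta>)) \<le> 1 / h (Gs t)"
    using p e by (intro divide_left_mono) (auto simp: h_pos)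
  then show ?thesis
    using t p by (simp add: gs_def powr_minus field_simps)
qed

lemma gs_cont: "continuous_on {0..} gs"
  unfolding continuous_on_eq_continuous_within
proof
  fix x :: real assume x: "x \<in> {0..}"
  show "continuous (at x within {0..}) gs"
  proof (cases "x = 0")
    case True
    have G0: "(Gs \<longlongrightarrow> 0) (at 0 within {0..})"
      using conj.Fi_cont conj.Fi_zero by (simp add: continuous_on_def) (metis atLeast_iff order_refl)
    have "(gs \<longlongrightarrow> 0) (at 0 within {0..})"
    proof (rule tendsto_sandwich)
      show "eventually (\<lambda>t. 0 \<le> gs t) (at 0 within {0..})"
        using gs_mono[of 0] by (auto simp: eventually_at_filter)
      have "eventually (\<lambda>t. Gs t < 1) (at 0 within {0..})"
        using G0 by (rule order_tendstoD) simp
      then show "eventually (\<lambda>t. gs t \<le> Gs t powr \<theta> / Ei 1) (at 0 within {0..})"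
        unfolding eventually_at_filter
        by (rule eventually_mono) (use gs_upper in \<open>auto simp: less_imp_le\<close>)
      have "((\<lambda>t. Gs t powr \<theta>) \<longlongrightarrow> 0) (at 0 within {0..})"
        using G0 \<theta>_pos by (intro tendsto_zero_powrI tendsto_const)
           (auto simp: eventually_at_filter conj.Fi_nonneg)
      then show "((\<lambda>t. Gs t powr \<theta> / Ei 1) \<longlongrightarrow> 0) (at 0 within {0..})"
        by (rule tendsto_divide_zero)
    qed simp
    then show ?thesis using True by (simp add: continuous_within)
  next
    case False
    have "continuous_on {0<..} (\<lambda>t. 1 / h (Gs t))"
    proof (intro continuous_intros continuous_on_compose2[OF h_cont])
      show "continuous_on {0<..} Gs" by (rule continuous_on_subset[OF conj.Fi_cont]) auto
    qed (auto simp: conj.Fi_pos h_pos less_imp_neq[symmetric])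
    moreover have "gs t = 1 / h (Gs t)" if "t \<in> {0<..}" for t using that by (simp add: gs_def)
    ultimately have "continuous_on {0<..} gs"
      using continuous_on_cong[of "{0<..}" _ gs "\<lambda>t. 1 / h (Gs t)"] by blast
    then have "isCont gs x" using x False by (simp add: continuous_on_eq_continuous_at)
    then show ?thesis by (rule continuous_at_imp_continuous_within)
  qed
qed

lemma N_density_gs: "N_density gs"
  unfolding N_density_def
proof (intro conjI allI impI)
  fix t :: real assume t: "0 \<le> t"
  have "continuous (at t within {0..}) gs"
    using gs_cont t by (simp add: continuous_on_eq_continuous_within)
  then show "continuous (at_right t) gs"
    by (rule continuous_within_subset) (use t in auto)
next
  show "mono_on {0..} gs" by (rule mono_onI) (rule gs_mono)
  show "filterlim gs at_top at_top"
  proof (rule filterlim_at_top_mono)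
    have e: "0 < Ei 1" by (simp add: primitive.Fi_pos)
    have "filterlim (\<lambda>t. Gs t powr \<theta>) at_top at_top"
      unfolding filterlim_at_top
    proof
      fix Z :: real
      have "eventually (\<lambda>t. max 1 Z powr (1 / \<theta>) \<le> Gs t) at_top"
        using conj.Fi_top unfolding filterlim_at_top by blast
      then show "eventually (\<lambda>t. Z \<le> Gs t powr \<theta>) at_top"
      proof eventually_elim
        case (elim t)
        then have "(max 1 Z powr (1 / \<theta>)) powr \<theta> \<le> Gs t powr \<theta>"
          using \<theta>_pos by (intro powr_mono2) auto
        then show ?case using \<theta>_pos by (simp add: powr_powr)
      qed
    qed
    then have "filterlim (\<lambda>t. 1 / Ei 1 * Gs t powr \<theta>) at_top at_top"
      using e by (intro filterlim_tendsto_pos_mult_at_top[OF tendsto_const]) auto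
    then show "filterlim (\<lambda>t. Gs t powr \<theta> / Ei 1) at_top at_top" by simp
    have "eventually (\<lambda>t. 1 \<le> Gs t) at_top"
      using conj.Fi_top by (simp add: filterlim_at_top)
    then show "eventually (\<lambda>t. Gs t powr \<theta> / Ei 1 \<le> gs t) at_top"
      using eventually_gt_at_top[of 0] by eventually_elim (rule gs_lower)
  qed
qed (auto simp: gs_pos)

lemma Gs_primitive: "0 \<le> t \<Longrightarrow> Gs t = primitive gs t"
proof -
  assume t: "0 \<le> t"
  have c: "continuous_on {0..t} gs" by (rule continuous_on_subset[OF gs_cont]) auto
  have "(gs has_integral (Gs t - Gs 0)) {0..t}"
  proof (rule fundamental_theorem_of_calculus_interior[OF t])
    show "continuous_on {0..t} Gs" by (rule continuous_on_subset[OF conj.Fi_cont]) auto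
    fix x assume x: "x \<in> {0<..<t}"
    have "(Gs has_real_derivative inverse (h (Gs x))) (at x)"
    proof (rule DERIV_inverse_function[where f = \<Phi> and a = 0 and b = "x + 1"])
      show "(\<Phi> has_real_derivative h (Gs x)) (at (Gs x))"
        using x by (intro \<Phi>_deriv conj.Fi_pos) simp
      show "h (Gs x) \<noteq> 0" using h_pos[of "Gs x"] conj.Fi_pos[of x] x by auto
      have "continuous_on {0<..} Gs" by (rule continuous_on_subset[OF conj.Fi_cont]) auto
      then show "isCont Gs x" using x by (simp add: continuous_on_eq_continuous_at)
    qed (use x conj.F_Fi in auto)
    then show "(Gs has_vector_derivative gs x) (at x)"
      using x by (simp add: gs_def has_real_derivative_iff_has_vector_derivative inverse_eq_divide)
  qed
  then show ?thesis
    by (simp add: primitive_eq_integral[OF c] conj.Fi_zero integral_unique)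
qed

text \<open>\<open>density_of\<close> is a choice, and \<open>gs\<close> witnesses that there is
  something to choose. The chosen density enters later only through these two properties.\<close>

lemma density_of_Gs: "N_density (density_of Gs)" "0 \<le> t \<Longrightarrow> Gs t = primitive (density_of Gs) t"
proof -
  have "\<exists>a. N_density a \<and> (\<forall>t\<ge>0. Gs t = primitive a t)"
    using N_density_gs Gs_primitive by blast
  from someI_ex[OF this] show "N_density (density_of Gs)" "0 \<le> t \<Longrightarrow> Gs t = primitive (density_of Gs) t"
    unfolding density_of_def by blast+
qed

text \<open>Young's inequality at t = \<open>\<Phi> b\<close>, where \<open>Gs\<close> takes the
  value b: a quantity bounded by \<open>\<Phi> b\<close> costs only b when it is paired with
  c.\<close>

lemma sobolev_young:
  assumes "0 \<le> c" "0 \<le> b"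
  shows "c * \<Phi> b \<le> b + N_conjugate Gs c"
  using young_inequality[OF density_of_Gs(1) assms(1) conj.F_nonneg[OF assms(2)]]
    density_of_Gs(2)[OF conj.F_nonneg[OF assms(2)]] conj.Fi_F[OF assms(2)]
  by (simp add: N_conjugate_def)

lemma N_conjugate_Gs_nonneg: "0 \<le> c \<Longrightarrow> 0 \<le> N_conjugate Gs c"
  unfolding N_conjugate_def
  by (intro primitive_nonneg mono_on_conjugate_density conjugate_density_0 density_of_Gs)

end

section \<open>The singular kernel\<close>

lemma nn_integral_lborel_translate:
  fixes f :: "'a::euclidean_space \<Rightarrow> ennreal"
  assumes [measurable]: "f \<in> borel_measurable borel"
  shows "(\<integral>\<^sup>+y. f (a + y) \<partial>lborel) = (\<integral>\<^sup>+y. f y \<partial>lborel)"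
    and "(\<integral>\<^sup>+y. f (a - y) \<partial>lborel) = (\<integral>\<^sup>+y. f y \<partial>lborel)"
proof -
  show *: "(\<integral>\<^sup>+y. f (a + y) \<partial>lborel) = (\<integral>\<^sup>+y. f y \<partial>lborel)" for a
    using nn_integral_distr[of "(+) a" lborel borel f] by (simp add: lborel_distr_plus)
  have d: "distr lborel borel (\<lambda>y. a + (- 1) *\<^sub>R y) = lborel"
    using lborel_affine[of "-1" a] by (simp add: density_1)
  show "(\<integral>\<^sup>+y. f (a - y) \<partial>lborel) = (\<integral>\<^sup>+y. f y \<partial>lborel)"
    using nn_integral_distr[of "\<lambda>y. a + (- 1) *\<^sub>R y" lborel borel f] unfolding d by simp
qed

lemma annulus_integral_le:
  fixes r \<beta> :: real
  assumes r: "0 < r"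
  shows "(\<integral>\<^sup>+z. ennreal (norm (z::'a::euclidean_space) powr \<beta>) * indicator {z. r \<le> norm z \<and> norm z \<le> 2 * r} z \<partial>lborel)
    \<le> ennreal (unit_ball_vol DIM('a) * 2 ^ DIM('a) * 2 powr \<bar>\<beta>\<bar> * r powr (DIM('a) + \<beta>))"
proof -
  have pw: "t powr \<beta> \<le> 2 powr \<bar>\<beta>\<bar> * r powr \<beta>" if "r \<le> t" "t \<le> 2 * r" for t
  proof -
    have "t powr \<beta> = (t / r) powr \<beta> * r powr \<beta>" using that r by (simp add: powr_divide)
    also have "(t / r) powr \<beta> \<le> (t / r) powr \<bar>\<beta>\<bar>" using that r by (intro powr_mono) auto
    also have "\<dots> \<le> 2 powr \<bar>\<beta>\<bar>" using that r by (intro powr_mono2) (auto simp: field_simps)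
    finally show ?thesis by (simp add: mult_right_mono)
  qed
  have "(\<integral>\<^sup>+z. ennreal (norm (z::'a) powr \<beta>) * indicator {z. r \<le> norm z \<and> norm z \<le> 2 * r} z \<partial>lborel)
    \<le> (\<integral>\<^sup>+z. ennreal (2 powr \<bar>\<beta>\<bar> * r powr \<beta>) * indicator (cball (0::'a) (2 * r)) z \<partial>lborel)"
    by (intro nn_integral_mono) (auto simp: indicator_def intro!: ennreal_leI pw)
  also have "\<dots> = ennreal (2 powr \<bar>\<beta>\<bar> * r powr \<beta>) * ennreal (unit_ball_vol DIM('a) * (2 * r) ^ DIM('a))"
    using r by (subst nn_integral_cmult_indicator) (simp_all add: emeasure_cball)
  also have "\<dots> = ennreal (unit_ball_vol DIM('a) * 2 ^ DIM('a) * 2 powr \<bar>\<beta>\<bar> * r powr (DIM('a) + \<beta>))"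
    using r by (subst ennreal_mult[symmetric]) (auto simp: powr_add powr_realpow power_mult_distrib algebra_simps)
  finally show ?thesis .
qed

text \<open>The k-th annulus contributes a constant times the k-th power of \<rho>^(N + \<beta>), so
  the sum is a geometric series. The ratio 1/2 treats the kernel near the origin, the ratio 2 the
  kernel near infinity.\<close>

lemma annuli_integral_finite:
  fixes \<rho> \<beta> :: real and f :: "'a::euclidean_space \<Rightarrow> ennreal"
  assumes \<rho>: "0 < \<rho>" and c: "0 < c" and q: "\<rho> powr (DIM('a) + \<beta>) < 1"
    and cover: "\<And>z. f z \<noteq> 0 \<Longrightarrow> f z \<le> ennreal (norm z powr \<beta>) \<and> (\<exists>k. c * \<rho> ^ k \<le> norm z \<and> norm z \<le> 2 * (c * \<rho> ^ k))"
  shows "(\<integral>\<^sup>+z. f z \<partial>lborel) < \<infinity>"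
proof -
  let ?A = "\<lambda>k. {z::'a. c * \<rho> ^ k \<le> norm z \<and> norm z \<le> 2 * (c * \<rho> ^ k)}"
  define K where "K = unit_ball_vol DIM('a) * 2 ^ DIM('a) * 2 powr \<bar>\<beta>\<bar>"
  define \<gamma> where "\<gamma> = DIM('a) + \<beta>"
  have K: "0 \<le> K" by (simp add: K_def)
  have "(\<integral>\<^sup>+z. f z \<partial>lborel) \<le> (\<integral>\<^sup>+z. (\<Sum>k. ennreal (norm z powr \<beta>) * indicator (?A k) z) \<partial>lborel)"
  proof (intro nn_integral_mono)
    fix z
    show "f z \<le> (\<Sum>k. ennreal (norm z powr \<beta>) * indicator (?A k) z)"
    proof (cases "f z = 0")
      case False
      then obtain k where k: "z \<in> ?A k" and le: "f z \<le> ennreal (norm z powr \<beta>)" using cover by blast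
      have "f z \<le> (\<Sum>k\<in>{k}. ennreal (norm z powr \<beta>) * indicator (?A k) z)" using k le by simp
      also have "\<dots> \<le> (\<Sum>k. ennreal (norm z powr \<beta>) * indicator (?A k) z)"
        by (intro sum_le_suminf) auto
      finally show ?thesis .
    qed simp
  qed
  also have "\<dots> = (\<Sum>k. \<integral>\<^sup>+z. ennreal (norm z powr \<beta>) * indicator (?A k) z \<partial>lborel)"
    by (rule nn_integral_suminf) auto
  also have "\<dots> \<le> (\<Sum>k. ennreal (K * c powr \<gamma> * (\<rho> powr \<gamma>) ^ k))"
  proof (intro suminf_le summableI allI)
    fix k
    have "(\<rho> ^ k) powr \<gamma> = (\<rho> powr \<gamma>) ^ k"
      using \<rho> by (simp add: powr_realpow[symmetric] powr_powr mult.commute)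
    then show "(\<integral>\<^sup>+z. ennreal (norm z powr \<beta>) * indicator (?A k) z \<partial>lborel) \<le> ennreal (K * c powr \<gamma> * (\<rho> powr \<gamma>) ^ k)"
      using annulus_integral_le[of "c * \<rho> ^ k" \<beta>, where 'a = 'a] \<rho> c
      by (simp add: powr_mult K_def \<gamma>_def mult.assoc del: power_mult_distrib)
  qed
  also have "\<dots> = ennreal (\<Sum>k. K * c powr \<gamma> * (\<rho> powr \<gamma>) ^ k)"
    using K q by (intro suminf_ennreal2 summable_mult summable_geometric) (auto simp: \<gamma>_def)
  also have "\<dots> < \<infinity>" by simp
  finally show ?thesis .
qed

lemma near_kernel_finite:
  fixes \<alpha> :: real
  assumes "0 < \<alpha>"
  shows "(\<integral>\<^sup>+z. ennreal (norm (z::'a::euclidean_space) powr (\<alpha> - DIM('a))) * indicator (cball 0 1) z \<partial>lborel) < \<infinity>"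
proof (rule annuli_integral_finite[of "1/2" "1/2" "\<alpha> - DIM('a)"])
  show "(1 / 2) powr (real DIM('a) + (\<alpha> - real DIM('a))) < 1"
    using assms powr01_less_one[of "1/2" \<alpha>] by simp
  fix z :: 'a
  assume "ennreal (norm z powr (\<alpha> - DIM('a))) * indicator (cball 0 1) z \<noteq> 0"
  then have z: "0 < norm z" "norm z \<le> 1" by (auto simp: indicator_def split: if_splits)
  define k where "k = (LEAST k. (1/2) ^ Suc k \<le> norm z)"
  have ex: "\<exists>k. (1/2) ^ Suc k \<le> norm z"
  proof -
    obtain n where "(1/2) ^ n < norm z" using real_arch_pow_inv[of "norm z" "1/2"] z by auto
    then show ?thesis by (intro exI[of _ n]) (use z in \<open>simp, linarith\<close>)
  qed
  have k1: "(1/2) ^ Suc k \<le> norm z" unfolding k_def by (rule LeastI_ex[OF ex])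
  have k2: "norm z \<le> (1/2) ^ k"
  proof (cases k)
    case (Suc l)
    then have "\<not> (1/2) ^ Suc l \<le> norm z" unfolding k_def using not_less_Least lessI by metis
    then show ?thesis using Suc by simp
  qed (use z in simp)
  show "ennreal (norm z powr (\<alpha> - DIM('a))) * indicator (cball 0 1) z \<le> ennreal (norm z powr (\<alpha> - DIM('a))) \<and>
    (\<exists>k. 1/2 * (1/2) ^ k \<le> norm z \<and> norm z \<le> 2 * (1/2 * (1/2) ^ k))"
    using k1 k2 by (auto simp: indicator_def)
qed auto

lemma far_kernel_finite:
  fixes \<alpha> :: real
  assumes "0 < \<alpha>"
  shows "(\<integral>\<^sup>+z. ennreal (norm (z::'a::euclidean_space) powr (- \<alpha> - DIM('a))) * indicator (- cball 0 1) z \<partial>lborel) < \<infinity>"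
proof (rule annuli_integral_finite[of 2 1 "- \<alpha> - DIM('a)"])
  show "2 powr (real DIM('a) + (- \<alpha> - real DIM('a))) < 1"
    using assms powr_less_one[of 2 "-\<alpha>"] by simp
  fix z :: 'a
  assume "ennreal (norm z powr (- \<alpha> - DIM('a))) * indicator (- cball 0 1) z \<noteq> 0"
  then have z: "1 < norm z" by (auto simp: indicator_def split: if_splits)
  define k where "k = (LEAST k. norm z \<le> 2 * 2 ^ k)"
  have ex: "\<exists>k. norm z \<le> 2 * 2 ^ k"
  proof -
    obtain n where "norm z < 2 ^ n" using real_arch_pow[of 2 "norm z"] by auto
    then show ?thesis by (intro exI[of _ n]) (use zero_less_power[of "2::real" n] in linarith)
  qed
  have k1: "norm z \<le> 2 * 2 ^ k" unfolding k_def by (rule LeastI_ex[OF ex])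
  have k2: "2 ^ k \<le> norm z"
  proof (cases k)
    case (Suc l)
    then have "\<not> norm z \<le> 2 * 2 ^ l" unfolding k_def using not_less_Least lessI by metis
    then show ?thesis using Suc by simp
  qed (use z in simp)
  show "ennreal (norm z powr (- \<alpha> - DIM('a))) * indicator (- cball 0 1) z \<le> ennreal (norm z powr (- \<alpha> - DIM('a))) \<and>
    (\<exists>k. 1 * 2 ^ k \<le> norm z \<and> norm z \<le> 2 * (1 * 2 ^ k))"
    using k1 k2 by (auto simp: indicator_def)
qed auto

section \<open>Difference quotients and the measure on pairs\<close>

definition diff_quot :: "real \<Rightarrow> ('a::euclidean_space \<Rightarrow> real) \<Rightarrow> 'a \<times> 'a \<Rightarrow> real" where
  "diff_quot s u z = (u (fst z) - u (snd z)) / norm (fst z - snd z) powr s"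

text \<open>The measure dx dy / \<bar>x - y\<bar>^N. It takes N of the exponent N + s in the weak
  form; the remaining s turns \<phi>(x) - \<phi>(y) into a difference quotient, so energy and weak
  form become integrals of E(Du) and g(Du) D\<phi>. Division by 0 gives the diagonal the density
  0.\<close>

definition sing_measure :: "('a::euclidean_space \<times> 'a) measure" where
  "sing_measure = density lborel (\<lambda>z. ennreal (1 / norm (fst z - snd z) ^ DIM('a)))"

lemma sing_density_measurable [measurable]:
  "(\<lambda>z::'a::euclidean_space \<times> 'a. 1 / norm (fst z - snd z) ^ DIM('a)) \<in> borel_measurable borel"
  unfolding borel_prod[symmetric] by measurable

lemma sets_sing_measure [measurable_cong, simp]: "sets sing_measure = sets borel"
  by (simp add: sing_measure_def)

lemma space_sing_measure [simp]: "space sing_measure = UNIV"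
  by (simp add: sing_measure_def)

lemma nn_integral_sing:
  fixes f :: "'a::euclidean_space \<times> 'a \<Rightarrow> ennreal"
  assumes [measurable]: "f \<in> borel_measurable borel"
  shows "(\<integral>\<^sup>+z. f z \<partial>sing_measure) = (\<integral>\<^sup>+z. ennreal (1 / norm (fst z - snd z) ^ DIM('a)) * f z \<partial>lborel)"
    and "(\<integral>\<^sup>+z. f z \<partial>sing_measure) = (\<integral>\<^sup>+x. \<integral>\<^sup>+y. ennreal (1 / norm (x - y) ^ DIM('a)) * f (x, y) \<partial>lborel \<partial>lborel)"
proof -
  show 1: "(\<integral>\<^sup>+z. f z \<partial>sing_measure) = (\<integral>\<^sup>+z. ennreal (1 / norm (fst z - snd z) ^ DIM('a)) * f z \<partial>lborel)"
    unfolding sing_measure_def by (rule nn_integral_density) auto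
  have "(\<lambda>z. ennreal (1 / norm (fst z - snd z) ^ DIM('a)) * f z) \<in> borel_measurable (lborel \<Otimes>\<^sub>M lborel)"
    unfolding lborel_prod by measurable
  from lborel.nn_integral_fst[OF this]
  show "(\<integral>\<^sup>+z. f z \<partial>sing_measure) = (\<integral>\<^sup>+x. \<integral>\<^sup>+y. ennreal (1 / norm (x - y) ^ DIM('a)) * f (x, y) \<partial>lborel \<partial>lborel)"
    by (simp add: 1 lborel_prod)
qed

lemma diff_quot_measurable [measurable]:
  assumes [measurable]: "u \<in> borel_measurable borel"
  shows "diff_quot s u \<in> borel_measurable borel"
  unfolding diff_quot_def[abs_def] borel_prod[symmetric] by measurable

lemma AE_sing_measure_pair:
  assumes "AE x in lborel. P x"
  shows "AE z in sing_measure. P (fst z) \<and> P (snd z)"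
proof -
  obtain A where A: "{x. \<not> P x} \<subseteq> A" "A \<in> null_sets lborel"
    using assms by (auto simp: eventually_ae_filter)
  have [measurable]: "A \<in> sets borel" using A(2) by (auto simp: null_sets_def)
  have n: "emeasure lborel A = 0" using A(2) by auto
  have "{z. fst z \<in> A} = A \<times> UNIV" "{z. snd z \<in> A} = UNIV \<times> A" by auto
  then have "A \<times> UNIV \<in> null_sets lborel" "UNIV \<times> A \<in> null_sets (lborel :: ('a \<times> 'a) measure)"
    unfolding lborel_prod[symmetric] using n
    by (auto intro!: null_setsI simp: lborel.emeasure_pair_measure_Times)
  then have "AE z in lborel. z \<notin> A \<times> UNIV" "AE z in (lborel :: ('a \<times> 'a) measure). z \<notin> UNIV \<times> A"
    by (auto intro: AE_not_in)
  then have "AE z in (lborel :: ('a \<times> 'a) measure). P (fst z) \<and> P (snd z)"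
  proof eventually_elim
    case (elim z) then show ?case using A(1) by (cases z) auto
  qed
  then show ?thesis
    unfolding sing_measure_def by (subst AE_density) auto
qed

section \<open>The Sobolev embedding\<close>

text \<open>J need not be an interval of indices. Filling its gaps only adds nonnegative increments,
  and then the sum telescopes.\<close>

lemma telescoping_gap:
  fixes v :: "nat \<Rightarrow> real"
  assumes mono: "\<And>j. v j \<le> v (Suc j)" and J: "finite J" "J \<noteq> {}"
    and hi: "\<And>j. j \<in> J \<Longrightarrow> v (Suc j) \<le> a" and lo: "\<And>j. j \<in> J \<Longrightarrow> b \<le> v j"
  shows "(\<Sum>j\<in>J. v (Suc j) - v j) \<le> a - b"
proof -
  let ?l = "Min J" and ?u = "Max J"
  have lu: "?l \<in> J" "?u \<in> J" "?l \<le> ?u" using J by auto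
  have "(\<Sum>j\<in>J. v (Suc j) - v j) \<le> (\<Sum>j=?l..?u. v (Suc j) - v j)"
    using J mono by (intro sum_mono2) auto
  also have "\<dots> = v (Suc ?u) - v ?l"
    using lu by (intro sum_Suc_diff) auto
  also have "\<dots> \<le> a - b" using hi[OF lu(2)] lo[OF lu(1)] by simp
  finally show ?thesis .
qed

text \<open>The levels \<open>v j\<close> are the values at \<open>r j\<close> of the decreasing rearrangement of \<open>u\<close>.\<close>

lemma rearrangement_levels:
  fixes u :: "'a::euclidean_space \<Rightarrow> real" and V :: real
  assumes [measurable]: "u \<in> borel_measurable borel"
    and supp: "emeasure lborel {x. 0 < u x} \<le> ennreal V" and V: "0 < V"
  obtains v where "v 0 = 0" "\<And>j. v j \<le> v (Suc j)"
    "\<And>j. emeasure lborel {x. v j < u x} \<le> ennreal (V / 2 ^ j)"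
    "\<And>j. 0 < v j \<Longrightarrow> ennreal (V / 2 ^ j) \<le> emeasure lborel {x. v j \<le> u x}"
proof -
  define r where "r j = V / 2 ^ j" for j :: nat
  define S where "S j = {t. 0 \<le> t \<and> emeasure lborel {x. t < u x} \<le> ennreal (r j)}" for j
  define v where "v j = Inf (S j)" for j
  have r: "0 < r j" for j using V by (simp add: r_def)
  have fin: "emeasure lborel {x. t < u x} < \<infinity>" if "0 \<le> t" for t
  proof -
    have "emeasure lborel {x. t < u x} \<le> emeasure lborel {x. 0 < u x}"
      using that by (intro emeasure_mono) auto
    then show ?thesis using supp by (simp add: order_le_less_trans)
  qed
  have ne: "S j \<noteq> {}" for j
  proof -
    have "(\<lambda>n. emeasure lborel {x. real n < u x}) \<longlonglongrightarrow> emeasure lborel (\<Inter>n. {x. real n < u x})"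
      using fin by (intro Lim_emeasure_decseq) (auto simp: decseq_def less_top[symmetric] intro: order_le_less_trans)
    moreover have "(\<Inter>n. {x. real n < u x}) = {}"
    proof -
      have "\<exists>n. \<not> real n < u x" for x using reals_Archimedean2[of "u x"] by (auto simp: not_less intro: less_imp_le)
      then show ?thesis by blast
    qed
    ultimately have "(\<lambda>n. emeasure lborel {x. real n < u x}) \<longlonglongrightarrow> 0" by simp
    then have "eventually (\<lambda>n. emeasure lborel {x. real n < u x} < ennreal (r j)) sequentially"
      using r[of j] by (intro order_tendstoD) auto
    then obtain n where "emeasure lborel {x. real n < u x} < ennreal (r j)"
      using eventually_sequentially by auto
    then have "real n \<in> S j" by (auto simp: S_def)
    then show ?thesis by blast
  qed
  have bdd: "bdd_below (S j)" for j by (auto simp: S_def intro!: bdd_belowI[of _ 0])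
  have v0: "0 \<le> v j" for j unfolding v_def by (rule cInf_greatest[OF ne]) (auto simp: S_def)
  show thesis
  proof (rule that[of v])
    have "0 \<in> S 0" using supp by (simp add: S_def r_def)
    then have "v 0 \<le> 0" unfolding v_def by (rule cInf_lower[OF _ bdd])
    then show "v 0 = 0" using v0[of 0] by simp
    have "S (Suc j) \<subseteq> S j" for j
    proof
      fix t assume t: "t \<in> S (Suc j)"
      have "ennreal (r (Suc j)) \<le> ennreal (r j)" using V by (intro ennreal_leI) (simp add: r_def field_simps)
      with t show "t \<in> S j" unfolding S_def by (blast intro: order_trans)
    qed
    then show "v j \<le> v (Suc j)" for j
      unfolding v_def by (intro cInf_superset_mono ne bdd)
    show "emeasure lborel {x. v j < u x} \<le> ennreal (V / 2 ^ j)" for j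
    proof -
      have "{x. v j < u x} = (\<Union>n. {x. v j + 1 / real (Suc n) < u x})"
      proof (intro equalityI subsetI)
        fix x assume "x \<in> {x. v j < u x}"
        then obtain n where "1 / real (Suc n) < u x - v j"
          using nat_approx_posE[of "u x - v j"] by auto
        then show "x \<in> (\<Union>n. {x. v j + 1 / real (Suc n) < u x})" by (auto intro!: exI[of _ n])
      next
        fix x assume "x \<in> (\<Union>n. {x. v j + 1 / real (Suc n) < u x})"
        then obtain n where "v j + 1 / real (Suc n) < u x" by auto
        moreover have "0 < 1 / real (Suc n)" by simp
        ultimately have "v j < u x" by linarith
        then show "x \<in> {x. v j < u x}" by simp
      qed
      moreover have "emeasure lborel (\<Union>n. {x. v j + 1 / real (Suc n) < u x}) = (SUP n. emeasure lborel {x. v j + 1 / real (Suc n) < u x})"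
      proof (rule SUP_emeasure_incseq[symmetric])
        show "incseq (\<lambda>n. {x. v j + 1 / real (Suc n) < u x})"
        proof (rule incseq_SucI)
          fix n
          have "1 / real (Suc (Suc n)) \<le> 1 / real (Suc n)" by (simp add: frac_le)
          then show "{x. v j + 1 / real (Suc n) < u x} \<subseteq> {x. v j + 1 / real (Suc (Suc n)) < u x}" by auto
        qed
      qed auto
      moreover have "\<dots> \<le> ennreal (r j)"
      proof (intro SUP_least)
        fix n
        have "Inf (S j) < v j + 1 / real (Suc n)" by (simp add: v_def)
        then obtain t where t: "t \<in> S j" "t < v j + 1 / real (Suc n)"
          using cInf_lessD[OF ne] by blast
        have "emeasure lborel {x. v j + 1 / real (Suc n) < u x} \<le> emeasure lborel {x. t < u x}"
          using t by (intro emeasure_mono) auto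
        then show "emeasure lborel {x. v j + 1 / real (Suc n) < u x} \<le> ennreal (r j)"
          using t by (auto simp: S_def)
      qed
      ultimately show ?thesis by (simp add: r_def)
    qed
    show "ennreal (V / 2 ^ j) \<le> emeasure lborel {x. v j \<le> u x}" if vj: "0 < v j" for j
    proof -
      \<comment> \<open>These levels stay nonnegative and lie strictly below the infimum of
        \<open>S j\<close>, hence outside \<open>S j\<close>, so each superlevel set has measure
        above \<open>r j\<close>; they decrease to a set contained in {v j \<le> u}.\<close>
      have "(\<lambda>n. emeasure lborel {x. v j * (1 - 1 / real (Suc n)) < u x}) \<longlonglongrightarrow> emeasure lborel (\<Inter>n. {x. v j * (1 - 1 / real (Suc n)) < u x})"
      proof (rule Lim_emeasure_decseq)
        show "decseq (\<lambda>n. {x. v j * (1 - 1 / real (Suc n)) < u x})"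
        proof (rule decseq_SucI)
          fix n
          have "1 / real (Suc (Suc n)) \<le> 1 / real (Suc n)" by (simp add: frac_le)
          then have "v j * (1 - 1 / real (Suc n)) \<le> v j * (1 - 1 / real (Suc (Suc n)))"
            using vj by (intro mult_left_mono) auto
          then show "{x. v j * (1 - 1 / real (Suc (Suc n))) < u x} \<subseteq> {x. v j * (1 - 1 / real (Suc n)) < u x}" by auto
        qed
        show "emeasure lborel {x. v j * (1 - 1 / real (Suc n)) < u x} \<noteq> \<infinity>" for n
          using fin[of "v j * (1 - 1 / real (Suc n))"] vj by simp
      qed auto
      moreover have "(\<Inter>n. {x. v j * (1 - 1 / real (Suc n)) < u x}) \<subseteq> {x. v j \<le> u x}"
      proof
        fix x assume x: "x \<in> (\<Inter>n. {x. v j * (1 - 1 / real (Suc n)) < u x})"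
        have "(\<lambda>n. v j * (1 - 1 / real (Suc n))) \<longlonglongrightarrow> v j * (1 - 0)"
          by (intro tendsto_intros LIMSEQ_Suc lim_1_over_n)
        moreover have "\<forall>n. v j * (1 - 1 / real (Suc n)) \<le> u x" using x by (auto intro: less_imp_le)
        ultimately have "v j * (1 - 0) \<le> u x" by (intro LIMSEQ_le_const2) auto
        then show "x \<in> {x. v j \<le> u x}" by simp
      qed
      moreover have "ennreal (r j) \<le> emeasure lborel {x. v j * (1 - 1 / real (Suc n)) < u x}" for n
      proof (rule ccontr)
        let ?t = "v j * (1 - 1 / real (Suc n))"
        assume "\<not> ?thesis"
        then have "?t \<in> S j" using vj by (auto simp: S_def)
        then have "v j \<le> ?t" unfolding v_def by (rule cInf_lower[OF _ bdd])
        moreover have "?t < v j" using vj by (simp add: algebra_simps)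
        ultimately show False by simp
      qed
      ultimately have "ennreal (r j) \<le> emeasure lborel (\<Inter>n. {x. v j * (1 - 1 / real (Suc n)) < u x})"
        by (intro LIMSEQ_le_const) auto
      also have "\<dots> \<le> emeasure lborel {x. v j \<le> u x}"
        using \<open>(\<Inter>n. {x. v j * (1 - 1 / real (Suc n)) < u x}) \<subseteq> {x. v j \<le> u x}\<close> by (intro emeasure_mono) auto
      finally show ?thesis by (simp add: r_def)
    qed
  qed
qed

locale nonlocal_domain = sobolev_growth g C "DIM('a::euclidean_space)" s
  for g :: "real \<Rightarrow> real" and C s :: real and \<Omega> :: "'a::euclidean_space set" +
  assumes s1: "s < 1" and open_dom: "open \<Omega>" and bounded_dom: "bounded \<Omega>"
begin

abbreviation D :: "('a \<Rightarrow> real) \<Rightarrow> 'a \<times> 'a \<Rightarrow> real" where "D \<equiv> diff_quot s"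

abbreviation \<kappa> :: "('a \<times> 'a) measure" where "\<kappa> \<equiv> sing_measure"

definition M :: "('a \<Rightarrow> real) \<Rightarrow> ennreal" where "M u = (\<integral>\<^sup>+z. ennreal (E (D u z)) \<partial>\<kappa>)"

text \<open>The ball of radius R about x has volume 2 r and the complement of L has measure at most
  r, so at least r of the ball lies in L. There the kernel is at least E(d / R^s) / R^N, and r / R^N
  is half the volume of the unit ball.\<close>

lemma inner_energy_lower:
  fixes x :: 'a
  assumes [measurable]: "L \<in> sets borel" and r: "0 < r" and R: "0 < R" "unit_ball_vol (real DIM('a)) * R ^ DIM('a) = 2 * r"
    and L: "emeasure lborel (- L) \<le> ennreal r" and d: "0 \<le> d"
  shows "ennreal (unit_ball_vol (real DIM('a)) / 2 * E (d / R powr s))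
    \<le> (\<integral>\<^sup>+y. indicator L y * ennreal (1 / norm (x - y) ^ DIM('a) * E (d / norm (x - y) powr s)) \<partial>lborel)"
proof -
  let ?q = "1 / R ^ DIM('a) * E (d / R powr s)"
  have q: "0 \<le> ?q" using R E_nonneg by simp
  have "ennreal r + ennreal r = emeasure lborel (cball x R)"
    using R r by (simp add: emeasure_cball ennreal_plus[symmetric] del: ennreal_plus)
  also have "\<dots> \<le> emeasure lborel (L \<inter> cball x R) + emeasure lborel (- L)"
    by (rule order_trans[OF emeasure_mono emeasure_subadditive]) auto
  also have "\<dots> \<le> emeasure lborel (L \<inter> cball x R) + ennreal r"
    using L by (intro add_left_mono)
  finally have m: "ennreal r \<le> emeasure lborel (L \<inter> cball x R)"
    by (simp add: ennreal_add_left_cancel_le add.commute)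
  have eq: "unit_ball_vol (real DIM('a)) / 2 * E (d / R powr s) = ?q * r"
    using R r by (simp add: field_simps)
  have "ennreal (unit_ball_vol (real DIM('a)) / 2 * E (d / R powr s)) = ennreal ?q * ennreal r"
    unfolding eq using q r by (intro ennreal_mult) auto
  also have "\<dots> \<le> ennreal ?q * emeasure lborel (L \<inter> cball x R)"
    using m by (intro mult_left_mono) auto
  also have "\<dots> = (\<integral>\<^sup>+y. ennreal ?q * indicator (L \<inter> cball x R) y \<partial>lborel)"
    by (subst nn_integral_cmult_indicator) auto
  also have "\<dots> \<le> (\<integral>\<^sup>+y. indicator L y * ennreal (1 / norm (x - y) ^ DIM('a) * E (d / norm (x - y) powr s)) \<partial>lborel)"
  proof (rule nn_integral_mono_AE)
    show "AE y in lborel. ennreal ?q * indicator (L \<inter> cball x R) y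
      \<le> indicator L y * ennreal (1 / norm (x - y) ^ DIM('a) * E (d / norm (x - y) powr s))"
      using AE_lborel_singleton[of x]
    proof eventually_elim
      case (elim y)
      show ?case
      proof (cases "y \<in> L \<inter> cball x R")
        case True
        then have n: "0 < norm (x - y)" "norm (x - y) \<le> R" using elim by (auto simp: dist_norm)
        have "R powr s \<ge> norm (x - y) powr s" using n s by (intro powr_mono2) auto
        then have "E (d / R powr s) \<le> E (d / norm (x - y) powr s)"
          using n d R by (intro E_mono) (auto simp: abs_of_nonneg intro!: divide_left_mono)
        moreover have "1 / R ^ DIM('a) \<le> 1 / norm (x - y) ^ DIM('a)"
          using n R by (intro divide_left_mono power_mono) auto
        ultimately have "?q \<le> 1 / norm (x - y) ^ DIM('a) * E (d / norm (x - y) powr s)"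
          using R E_nonneg by (intro mult_mono) auto
        then show ?thesis using True by (simp add: ennreal_leI)
      qed auto
    qed
  qed
  finally show ?thesis .
qed

text \<open>For each j, pairs with u(x) \<ge> v (Suc j) and u(y) \<le> v j contribute at least the
  energy of the jump from v j to v (Suc j). One pair may serve many j, but its jumps are
  nonoverlapping subintervals of [u(y), u(x)], so \<open>E_superadd\<close> fits the sum of their
  energies under E(Du).\<close>

lemma energy_lower:
  fixes v :: "nat \<Rightarrow> real"
  assumes [measurable]: "u \<in> borel_measurable borel"
    and r: "\<And>j. 0 < r j" and R: "\<And>j. 0 < R j" "\<And>j. unit_ball_vol (real DIM('a)) * R j ^ DIM('a) = 2 * r j"
    and v0: "v 0 = 0" and v: "\<And>j. v j \<le> v (Suc j)"
    and up: "\<And>j. emeasure lborel {x. v j < u x} \<le> ennreal (r j)"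
    and low: "\<And>j. 0 < v j \<Longrightarrow> ennreal (r j) \<le> emeasure lborel {x. v j \<le> u x}"
  shows "ennreal (\<Sum>j<n. r (Suc j) * (unit_ball_vol (real DIM('a)) / 2 * E ((v (Suc j) - v j) / R j powr s))) \<le> M u"
proof -
  let ?d = "\<lambda>j. v (Suc j) - v j"
  let ?U = "\<lambda>j. {x. v (Suc j) \<le> u x}" and ?L = "\<lambda>j. {x. u x \<le> v j}"
  let ?q = "\<lambda>j. unit_ball_vol (real DIM('a)) / 2 * E (?d j / R j powr s)"
  let ?k = "\<lambda>j (x::'a) y. ennreal (1 / norm (x - y) ^ DIM('a) * E (?d j / norm (x - y) powr s))"
  have vnn: "0 \<le> v j" for j using lift_Suc_mono_le[of v 0 j] v v0 by simp
  have q0: "0 \<le> ?q j" for j using E_nonneg by simp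
  have pw: "(\<Sum>j<n. indicator (?U j) x * (indicator (?L j) y * ?k j x y))
      \<le> ennreal (1 / norm (x - y) ^ DIM('a)) * ennreal (E (D u (x, y)))" for x y :: 'a
  proof (cases "x = y")
    case False
    then have \<rho>: "0 < norm (x - y) powr s" by simp
    define J where "J = {j\<in>{..<n}. x \<in> ?U j \<and> y \<in> ?L j}"
    have "(\<Sum>j<n. indicator (?U j) x * (indicator (?L j) y * ?k j x y)) = (\<Sum>j\<in>J. ?k j x y)"
      unfolding J_def by (intro sum.mono_neutral_cong_right) (auto simp: indicator_def)
    also have "\<dots> = ennreal (\<Sum>j\<in>J. 1 / norm (x - y) ^ DIM('a) * E (?d j / norm (x - y) powr s))"
      using E_nonneg by (intro sum_ennreal) auto
    also have "(\<Sum>j\<in>J. 1 / norm (x - y) ^ DIM('a) * E (?d j / norm (x - y) powr s))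
        \<le> 1 / norm (x - y) ^ DIM('a) * E (D u (x, y))"
      unfolding sum_distrib_left[symmetric]
    proof (rule mult_left_mono)
      show "(\<Sum>j\<in>J. E (?d j / norm (x - y) powr s)) \<le> E (D u (x, y))"
      proof (cases "J = {}")
        case False
        have "(\<Sum>j\<in>J. E (?d j / norm (x - y) powr s)) \<le> E (\<Sum>j\<in>J. ?d j / norm (x - y) powr s)"
          using v by (intro E_superadd) (auto simp: J_def)
        also have "\<dots> \<le> E (D u (x, y))"
        proof (rule E_mono)
          have "0 \<le> (\<Sum>j\<in>J. ?d j)" using v by (intro sum_nonneg) auto
          moreover have "(\<Sum>j\<in>J. ?d j) \<le> u x - u y"
            using v False by (intro telescoping_gap) (auto simp: J_def)
          ultimately show "\<bar>\<Sum>j\<in>J. ?d j / norm (x - y) powr s\<bar> \<le> \<bar>D u (x, y)\<bar>"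
            using \<rho> by (simp add: diff_quot_def sum_divide_distrib[symmetric] divide_right_mono)
        qed
        finally show ?thesis .
      qed (simp add: E_nonneg)
    qed simp
    finally show ?thesis using E_nonneg by (simp add: ennreal_mult[symmetric] ennreal_leI)
  qed simp
  have [measurable]: "(\<lambda>y. ?k j x y) \<in> borel_measurable lborel" for j x by measurable
  have m2: "(\<lambda>x. \<integral>\<^sup>+y. indicator (?L j) y * ?k j x y \<partial>lborel) \<in> borel_measurable lborel" for j
    by (intro lborel.borel_measurable_nn_integral) (unfold split_beta', measurable)
  have "ennreal (\<Sum>j<n. r (Suc j) * ?q j) = (\<Sum>j<n. ennreal (r (Suc j) * ?q j))"
    using r q0 by (intro sum_ennreal[symmetric]) (auto simp: less_imp_le)
  also have "\<dots> \<le> (\<Sum>j<n. \<integral>\<^sup>+x. indicator (?U j) x * (\<integral>\<^sup>+y. indicator (?L j) y * ?k j x y \<partial>lborel) \<partial>lborel)"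
  proof (rule sum_mono)
    fix j
    show "ennreal (r (Suc j) * ?q j) \<le> (\<integral>\<^sup>+x. indicator (?U j) x * (\<integral>\<^sup>+y. indicator (?L j) y * ?k j x y \<partial>lborel) \<partial>lborel)"
    proof (cases "?d j = 0")
      case False
      then have "0 < v (Suc j)" using vnn[of j] vnn[of "Suc j"] v[of j] by linarith
      then have "ennreal (?q j) * ennreal (r (Suc j)) \<le> ennreal (?q j) * emeasure lborel (?U j)"
        by (intro mult_left_mono low) auto
      moreover have "ennreal (r (Suc j) * ?q j) = ennreal (?q j) * ennreal (r (Suc j))"
        using r[of "Suc j"] q0[of j] by (subst mult.commute, intro ennreal_mult) auto
      ultimately have "ennreal (r (Suc j) * ?q j) \<le> ennreal (?q j) * emeasure lborel (?U j)"
        by simp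
      also have "\<dots> = (\<integral>\<^sup>+x. ennreal (?q j) * indicator (?U j) x \<partial>lborel)"
        by (subst nn_integral_cmult_indicator) auto
      also have "\<dots> \<le> (\<integral>\<^sup>+x. indicator (?U j) x * (\<integral>\<^sup>+y. indicator (?L j) y * ?k j x y \<partial>lborel) \<partial>lborel)"
      proof (rule nn_integral_mono)
        fix x
        have "- ?L j = {x. v j < u x}" by auto
        then have "ennreal (?q j) \<le> (\<integral>\<^sup>+y. indicator (?L j) y * ?k j x y \<partial>lborel)"
          using v[of j] up[of j] by (intro inner_energy_lower[OF _ r R]) auto
        then show "ennreal (?q j) * indicator (?U j) x \<le> indicator (?U j) x * (\<integral>\<^sup>+y. indicator (?L j) y * ?k j x y \<partial>lborel)"
          by (simp add: indicator_def)
      qed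
      finally show ?thesis .
    qed simp
  qed
  also have "\<dots> = (\<integral>\<^sup>+x. (\<Sum>j<n. indicator (?U j) x * (\<integral>\<^sup>+y. indicator (?L j) y * ?k j x y \<partial>lborel)) \<partial>lborel)"
    using m2 by (intro nn_integral_sum[symmetric] borel_measurable_times_ennreal) auto
  also have "\<dots> = (\<integral>\<^sup>+x. \<integral>\<^sup>+y. (\<Sum>j<n. indicator (?U j) x * (indicator (?L j) y * ?k j x y)) \<partial>lborel \<partial>lborel)"
  proof (rule nn_integral_cong)
    fix x
    have "(\<integral>\<^sup>+y. (\<Sum>j<n. indicator (?U j) x * (indicator (?L j) y * ?k j x y)) \<partial>lborel)
        = (\<Sum>j<n. \<integral>\<^sup>+y. indicator (?U j) x * (indicator (?L j) y * ?k j x y) \<partial>lborel)"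
      by (intro nn_integral_sum) measurable
    also have "\<dots> = (\<Sum>j<n. indicator (?U j) x * (\<integral>\<^sup>+y. indicator (?L j) y * ?k j x y \<partial>lborel))"
      by (intro sum.cong refl nn_integral_cmult) measurable
    finally show "(\<Sum>j<n. indicator (?U j) x * (\<integral>\<^sup>+y. indicator (?L j) y * ?k j x y \<partial>lborel))
        = (\<integral>\<^sup>+y. (\<Sum>j<n. indicator (?U j) x * (indicator (?L j) y * ?k j x y)) \<partial>lborel)" by simp
  qed
  also have "\<dots> \<le> (\<integral>\<^sup>+x. \<integral>\<^sup>+y. ennreal (1 / norm (x - y) ^ DIM('a)) * ennreal (E (D u (x, y))) \<partial>lborel \<partial>lborel)"
    by (intro nn_integral_mono pw)
  also have "\<dots> = M u"
    unfolding M_def by (subst nn_integral_sing(2)) auto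
  finally show ?thesis .
qed

lemma N_conjugate_measurable:
  assumes [measurable]: "F \<in> borel_measurable M'" and "\<And>x. 0 \<le> F x"
  shows "(\<lambda>x. N_conjugate Gs (F x)) \<in> borel_measurable M'"
proof -
  let ?k = "conjugate_density (density_of Gs)"
  have mk: "mono_on {0..} ?k" "?k 0 = 0"
    by (intro mono_on_conjugate_density conjugate_density_0 density_of_Gs)+
  have "mono (\<lambda>t. N_conjugate Gs (max 0 t))"
  proof (rule monoI)
    fix a b :: real assume "a \<le> b"
    have "ennreal (N_conjugate Gs (max 0 a)) \<le> ennreal (N_conjugate Gs (max 0 b))"
      unfolding N_conjugate_def using \<open>a \<le> b\<close>
      by (subst (1 2) nn_integral_primitive[OF mk, symmetric]) (auto intro!: nn_integral_mono simp: indicator_def)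
    then show "N_conjugate Gs (max 0 a) \<le> N_conjugate Gs (max 0 b)"
      by (simp add: ennreal_le_iff N_conjugate_Gs_nonneg)
  qed
  then have [measurable]: "(\<lambda>t. N_conjugate Gs (max 0 t)) \<in> borel_measurable borel"
    by (rule borel_measurable_mono)
  have "(\<lambda>x. N_conjugate Gs (max 0 (F x))) \<in> borel_measurable M'" by measurable
  then show ?thesis using assms(2) by (simp add: max_def)
qed

text \<open>Where v k < u \<le> v (Suc k), u is bounded by a multiple of \<open>\<Phi>\<close> at a
  number b k, and Young's inequality trades F u for b k plus the conjugate function at F. As {u > v
  k} has measure at most r k, the terms b k sum up to the quantities \<open>At\<close>, which the
  modular controls. The core is v (Suc k) \<le> c2 * \<Phi> (b k), where every increment of v is
  compared with an increment of \<open>\<Phi>\<close>.\<close>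

lemma embedding:
  obtains c where "0 < c"
    "\<And>u F. u \<in> borel_measurable borel \<Longrightarrow> F \<in> borel_measurable borel \<Longrightarrow> (\<And>x. 0 \<le> u x) \<Longrightarrow>
      (\<And>x. 0 \<le> F x) \<Longrightarrow> (\<And>x. x \<notin> \<Omega> \<Longrightarrow> u x = 0) \<Longrightarrow> M u \<le> 1 \<Longrightarrow>
      (\<integral>\<^sup>+x. ennreal (F x * u x) \<partial>lborel)
        \<le> ennreal c * (1 + (\<integral>\<^sup>+x. ennreal (N_conjugate Gs (F x)) * indicator \<Omega> x \<partial>lborel))"
proof -
  define w where "w = unit_ball_vol (real DIM('a))"
  have w: "0 < w" by (simp add: w_def)
  \<comment> \<open>A factor 4 lost in passing from \<open>A\<close> to \<open>At\<close>, times the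
    bound 4 / w for the sums of \<open>A\<close>.\<close>
  define K where "K = 16 / w"
  \<comment> \<open>The power turns \<open>R j powr s\<close> into b^(-\<theta>); the factor 3 is
    the loss in comparing b h(b) with an increment of \<open>\<Phi>\<close>.\<close>
  define c2 where "c2 = 3 * (2 * K / w) powr \<theta>"
  have K: "0 < K" using w by (simp add: K_def)
  have c2: "0 < c2" using K w by (simp add: c2_def)
  obtain B where B: "0 < B" "\<Omega> \<subseteq> cball 0 B"
    using bounded_dom unfolding bounded_pos by (auto simp: subset_iff)
  define V where "V = w * B ^ DIM('a)"
  have V: "0 < V" using w B by (simp add: V_def)
  have [measurable]: "\<Omega> \<in> sets borel" using open_dom by simp
  have "emeasure lborel \<Omega> \<le> emeasure lborel (cball (0::'a) B)"
    using B by (intro emeasure_mono) auto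
  then have \<Omega>V: "emeasure lborel \<Omega> \<le> ennreal V" using B by (simp add: emeasure_cball V_def w_def)
  show thesis
  proof (rule that[of "c2 * (K + 1)"])
    show "0 < c2 * (K + 1)" using c2 K by simp
    fix u F :: "'a \<Rightarrow> real"
    assume [measurable]: "u \<in> borel_measurable borel" "F \<in> borel_measurable borel"
      and u0: "\<And>x. 0 \<le> u x" and F0: "\<And>x. 0 \<le> F x" and u\<Omega>: "\<And>x. x \<notin> \<Omega> \<Longrightarrow> u x = 0" and M1: "M u \<le> 1"
    define r where "r j = V / 2 ^ j" for j :: nat
    have r: "0 < r j" "r (Suc j) = r j / 2" for j using V by (auto simp: r_def)
    have "{x. 0 < u x} \<subseteq> \<Omega>" using u\<Omega> by force
    then have "emeasure lborel {x. 0 < u x} \<le> emeasure lborel \<Omega>" by (intro emeasure_mono) auto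
    then have "emeasure lborel {x. 0 < u x} \<le> ennreal V" using \<Omega>V by (rule order_trans)
    then obtain v where v0: "v 0 = 0" and v: "\<And>j. v j \<le> v (Suc j)"
      and up: "\<And>j. emeasure lborel {x. v j < u x} \<le> ennreal (r j)"
      and low: "\<And>j. 0 < v j \<Longrightarrow> ennreal (r j) \<le> emeasure lborel {x. v j \<le> u x}"
      using rearrangement_levels[of u V] V unfolding r_def by auto
    \<comment> \<open>The ball of this radius has volume 2 r j, twice the bound on the measure of {u
      > v j}, as \<open>inner_energy_lower\<close> requires.\<close>
    define R where "R j = (2 * r j / w) powr (1 / real DIM('a))" for j
    define d where "d j = v (Suc j) - v j" for j
    have d: "0 \<le> d j" for j using v by (simp add: d_def)
    have R: "0 < R j" "w * R j ^ DIM('a) = 2 * r j" "R j powr s = (2 * r j / w) powr \<theta>" for j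
      using r(1)[of j] w
      by (auto simp: R_def powr_realpow[symmetric] powr_powr \<theta>_def)
    define A where "A j = r j * E (d j / R j powr s)" for j
    have A: "0 \<le> A j" for j using r(1)[of j] E_nonneg by (simp add: A_def)
    have A_sum: "(\<Sum>j<n. A j) \<le> 4 / w" for n
    proof -
      have "ennreal (\<Sum>j<n. r (Suc j) * (w / 2 * E (d j / R j powr s))) \<le> M u"
        unfolding d_def w_def by (rule energy_lower) (use r R v0 v up low in \<open>simp_all add: w_def\<close>)
      also have "(\<Sum>j<n. r (Suc j) * (w / 2 * E (d j / R j powr s))) = w / 4 * (\<Sum>j<n. A j)"
        unfolding A_def sum_distrib_left by (intro sum.cong) (auto simp: r(2))
      finally have "ennreal (w / 4 * (\<Sum>j<n. A j)) \<le> ennreal 1" using M1 by (metis ennreal_1 order_trans)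
      then have "w / 4 * (\<Sum>j<n. A j) \<le> 1" by (subst (asm) ennreal_le_iff) auto
      then show ?thesis using w by (simp add: field_simps)
    qed
    \<comment> \<open>Running sums with ratio 3/4. They dominate \<open>A\<close> and cost a factor
      4 in the total. Since r j halves at each step and 2 * 3/4 = 3/2, the quotients At j / r j grow
      at least geometrically, which the quotients A j / r j need not do.\<close>
    define At where "At = rec_nat (A 0) (\<lambda>n a. A (Suc n) + 3/4 * a)"
    have At: "At 0 = A 0" "At (Suc n) = A (Suc n) + 3/4 * At n" for n by (auto simp: At_def)
    have At0: "0 \<le> At n" for n using A by (induction n) (auto simp: At)
    have AAt: "A n \<le> At n" for n using At0 by (cases n) (auto simp: At)
    have "(\<Sum>j<Suc n. At j) + 3 * At n = 4 * (\<Sum>j<Suc n. A j)" for n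
      by (induction n) (auto simp: At algebra_simps)
    then have "(\<Sum>j<Suc n. At j) \<le> 4 * (\<Sum>j<Suc n. A j)" for n using At0[of n] by (metis add_increasing2 mult_nonneg_nonneg order_refl zero_le_numeral)
    then have At_sum: "(\<Sum>j<n. At j) \<le> K" for n
    proof (cases n)
      case (Suc m)
      have "4 * (\<Sum>j<n. A j) \<le> 4 * (4 / w)" by (intro mult_left_mono A_sum) auto
      then show ?thesis
        using \<open>\<And>n. (\<Sum>j<Suc n. At j) \<le> 4 * (\<Sum>j<Suc n. A j)\<close>[of m] unfolding Suc K_def by linarith
    qed (use K in simp)
    have AtK: "At j \<le> K" for j
      using At_sum[of "Suc j"] sum_nonneg[of "{..<j}" At] At0 by simp
    define b where "b j = At j / r j" for j
    have b0: "0 \<le> b j" for j using At0 r(1)[of j] by (simp add: b_def)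
    have b_growth: "3 / 2 * b j \<le> b (Suc j)" for j
      using A[of "Suc j"] r(1)[of j] by (simp add: b_def At r(2) field_simps)
    have d_le: "d j \<le> c2 / 3 * (b j * h (b j))" for j
    proof -
      have "E (d j / R j powr s) \<le> b j"
      proof -
        have "r j * E (d j / R j powr s) \<le> r j * b j"
          using AAt[of j] r(1)[of j] by (simp add: b_def A_def[symmetric])
        then show ?thesis using r(1)[of j] by simp
      qed
      then have "d j / R j powr s \<le> Ei (b j)"
        using d[of j] R(1)[of j] b0 by (subst primitive.le_Fi_iff) (auto simp: E_def)
      then have dj: "d j \<le> R j powr s * Ei (b j)" using R(1)[of j] by (simp add: field_simps)
      show ?thesis
      proof (cases "b j = 0")
        case True
        then show ?thesis using dj by (simp add: primitive.Fi_zero)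
      next
        case False
        then have bp: "0 < b j" using b0[of j] by simp
        \<comment> \<open>The measure r j is itself at most K / b j. This converts the radius into a
          power of b j, and b^(-\<theta>) Ei(b) equals b h(b).\<close>
        have "r j = At j / b j" using False r(1)[of j] by (auto simp: b_def)
        then have "2 * r j / w \<le> (2 * K / w) / b j"
          using AtK[of j] bp w by (simp add: field_simps)
        then have "R j powr s \<le> ((2 * K / w) / b j) powr \<theta>"
          unfolding R(3) using r(1)[of j] w \<theta>_pos by (intro powr_mono2) auto
        also have "\<dots> = c2 / 3 * b j powr (- \<theta>)"
        proof -
          have "((2 * K / w) / b j) powr \<theta> = (2 * K / w) powr \<theta> / b j powr \<theta>"
            by (rule powr_divide)
          then show ?thesis by (simp add: c2_def powr_minus_divide)
        qed
        finally have "d j \<le> c2 / 3 * b j powr (- \<theta>) * Ei (b j)"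
          using dj primitive.Fi_nonneg[OF b0[of j]] by (meson mult_right_mono order_trans)
        also have "\<dots> = c2 / 3 * (b j * h (b j))"
          using h_factor[OF bp] bp by simp
        finally show ?thesis .
      qed
    qed
    have v_le: "v (Suc k) \<le> c2 * \<Phi> (b k)" for k
    proof (induction k)
      case 0
      have "v (Suc 0) = d 0" by (simp add: d_def v0)
      also have "\<dots> \<le> c2 / 3 * (b 0 * h (b 0))" by (rule d_le)
      also have "\<dots> \<le> c2 / 3 * \<Phi> (b 0)"
        using \<Phi>_diff(2)[of 0 "b 0"] b0 c2 by (intro mult_left_mono) (auto simp: \<Phi>_0)
      also have "\<dots> \<le> c2 * \<Phi> (b 0)"
        using c2 conj.F_nonneg[OF b0] by (intro mult_right_mono) auto
      finally show ?case .
    next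
      case (Suc k)
      \<comment> \<open>Growth by 3/2 means that b (Suc k) is at most three times the gap b (Suc k)
        - b k. Since \<open>h\<close> is nonincreasing, b h(b) at the upper end is then at most
        three times the increment of \<open>\<Phi>\<close>.\<close>
      have bk: "b k \<le> b (Suc k)" "b (Suc k) \<le> 3 * (b (Suc k) - b k)" using b_growth[of k] b0[of k] by auto
      have "b (Suc k) * h (b (Suc k)) \<le> 3 * (b (Suc k) - b k) * h (b (Suc k))"
        using bk(2) h_nonneg[OF b0] by (intro mult_right_mono)
      also have "\<dots> \<le> 3 * (\<Phi> (b (Suc k)) - \<Phi> (b k))"
        unfolding mult.assoc using \<Phi>_diff(2)[OF b0 bk(1)] by (intro mult_left_mono) auto
      finally have "c2 / 3 * (b (Suc k) * h (b (Suc k))) \<le> c2 / 3 * (3 * (\<Phi> (b (Suc k)) - \<Phi> (b k)))"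
        using c2 by (intro mult_left_mono) auto
      then have "d (Suc k) \<le> c2 / 3 * (3 * (\<Phi> (b (Suc k)) - \<Phi> (b k)))"
        by (rule order_trans[OF d_le])
      also have "\<dots> = c2 * (\<Phi> (b (Suc k)) - \<Phi> (b k))"
        by (simp add: algebra_simps)
      finally have "d (Suc k) \<le> c2 * (\<Phi> (b (Suc k)) - \<Phi> (b k))" .
      moreover have "v (Suc (Suc k)) = d (Suc k) + v (Suc k)" by (simp add: d_def)
      ultimately show ?case using Suc.IH by (simp add: algebra_simps)
    qed
    let ?S = "\<lambda>k. {x. v k < u x}" and ?N = "\<lambda>x. N_conjugate Gs (F x)"
    have [measurable]: "?N \<in> borel_measurable borel" by (intro N_conjugate_measurable F0) simp
    have N0: "0 \<le> ?N x" for x by (intro N_conjugate_Gs_nonneg F0)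
    have null: "AE x in lborel. \<exists>j. \<not> v j < u x"
    proof -
      have "emeasure lborel (\<Inter>j. ?S j) \<le> ennreal (r j)" for j
        by (rule order_trans[OF emeasure_mono up]) auto
      moreover have "(\<lambda>j. ennreal (r j)) \<longlonglongrightarrow> ennreal 0"
        unfolding r_def by (intro tendsto_ennrealI LIMSEQ_divide_realpow_zero) auto
      ultimately have "emeasure lborel (\<Inter>j. ?S j) \<le> ennreal 0"
        by (intro LIMSEQ_le_const) auto
      then have "(\<Inter>j. ?S j) \<in> null_sets lborel" by (intro null_setsI) auto
      then have "AE x in lborel. x \<notin> (\<Inter>j. ?S j)" by (rule AE_not_in)
      then show ?thesis by simp
    qed
    have "(\<integral>\<^sup>+x. ennreal (F x * u x) \<partial>lborel)
      \<le> (\<integral>\<^sup>+x. ennreal c2 * ((\<Sum>k. ennreal (b k) * indicator (?S k) x) + ennreal (?N x) * indicator \<Omega> x) \<partial>lborel)"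
    proof (rule nn_integral_mono_AE)
      show "AE x in lborel. ennreal (F x * u x)
          \<le> ennreal c2 * ((\<Sum>k. ennreal (b k) * indicator (?S k) x) + ennreal (?N x) * indicator \<Omega> x)"
        using null
      proof eventually_elim
        case (elim x)
        show ?case
        proof (cases "u x = 0")
          case False
          then have ux: "0 < u x" using u0[of x] by simp
          \<comment> \<open>The first level not exceeded by u(x); \<open>null\<close> provides one
            for almost every x. As v 0 = 0 < u(x), it has a predecessor k, and u(x) lies between
            these two levels.\<close>
          define j where "j = (LEAST j. \<not> v j < u x)"
          have j: "\<not> v j < u x" unfolding j_def using elim by (rule LeastI_ex)
          obtain k where k: "j = Suc k" using j v0 ux by (cases j) auto
          have vk: "v k < u x" using not_less_Least[of k "\<lambda>j. \<not> v j < u x"] k unfolding j_def by auto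
          have "u x \<le> c2 * \<Phi> (b k)" using j v_le[of k] unfolding k by simp
          then have "F x * u x \<le> F x * (c2 * \<Phi> (b k))"
            using F0[of x] by (intro mult_left_mono)
          also have "\<dots> = c2 * (F x * \<Phi> (b k))" by simp
          also have "\<dots> \<le> c2 * (b k + ?N x)"
            using c2 by (intro mult_left_mono sobolev_young F0 b0) auto
          finally have "ennreal (F x * u x) \<le> ennreal (c2 * (b k + ?N x))" by (rule ennreal_leI)
          also have "\<dots> = ennreal c2 * (ennreal (b k) + ennreal (?N x))"
            using c2 b0[of k] N0[of x] by (simp add: ennreal_mult ennreal_plus)
          also have "ennreal (b k) + ennreal (?N x) \<le> (\<Sum>k. ennreal (b k) * indicator (?S k) x) + ennreal (?N x) * indicator \<Omega> x"
          proof (rule add_mono)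
            have "ennreal (b k) = (\<Sum>k\<in>{k}. ennreal (b k) * indicator (?S k) x)" using vk by simp
            also have "\<dots> \<le> (\<Sum>k. ennreal (b k) * indicator (?S k) x)" by (intro sum_le_suminf) auto
            finally show "ennreal (b k) \<le> (\<Sum>k. ennreal (b k) * indicator (?S k) x)" .
            show "ennreal (?N x) \<le> ennreal (?N x) * indicator \<Omega> x"
              using u\<Omega>[of x] False by (cases "x \<in> \<Omega>") auto
          qed
          finally show ?thesis by (simp add: mult_left_mono)
        qed simp
      qed
    qed
    also have "\<dots> = ennreal c2 * ((\<Sum>k. \<integral>\<^sup>+x. ennreal (b k) * indicator (?S k) x \<partial>lborel) + (\<integral>\<^sup>+x. ennreal (?N x) * indicator \<Omega> x \<partial>lborel))"
      by (simp add: nn_integral_cmult nn_integral_add nn_integral_suminf)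
    also have "\<dots> \<le> ennreal c2 * (ennreal K + (\<integral>\<^sup>+x. ennreal (?N x) * indicator \<Omega> x \<partial>lborel))"
    proof (intro mult_left_mono add_right_mono)
      have "(\<Sum>k. \<integral>\<^sup>+x. ennreal (b k) * indicator (?S k) x \<partial>lborel) \<le> (\<Sum>k. ennreal (At k))"
      proof (intro suminf_le summableI allI)
        fix k
        have "(\<integral>\<^sup>+x. ennreal (b k) * indicator (?S k) x \<partial>lborel) = ennreal (b k) * emeasure lborel (?S k)"
          by (rule nn_integral_cmult_indicator) auto
        also have "\<dots> \<le> ennreal (b k) * ennreal (r k)" by (intro mult_left_mono up) auto
        also have "\<dots> = ennreal (At k)" using b0[of k] r(1)[of k] by (simp add: ennreal_mult[symmetric] b_def)
        finally show "(\<integral>\<^sup>+x. ennreal (b k) * indicator (?S k) x \<partial>lborel) \<le> ennreal (At k)" .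
      qed
      also have "\<dots> \<le> ennreal K"
        unfolding suminf_eq_SUP using At_sum At0 by (intro SUP_least) (simp add: sum_ennreal ennreal_leI)
      finally show "(\<Sum>k. \<integral>\<^sup>+x. ennreal (b k) * indicator (?S k) x \<partial>lborel) \<le> ennreal K" .
    qed auto
    also have "\<dots> \<le> ennreal c2 * (ennreal (K + 1) * (1 + (\<integral>\<^sup>+x. ennreal (?N x) * indicator \<Omega> x \<partial>lborel)))"
    proof (intro mult_left_mono)
      let ?I = "\<integral>\<^sup>+x. ennreal (?N x) * indicator \<Omega> x \<partial>lborel"
      have "ennreal K + ?I \<le> (ennreal K + 1) * 1 + (ennreal K + 1) * ?I"
      proof (rule add_mono)
        show "?I \<le> (ennreal K + 1) * ?I" using mult_right_mono[of 1 "ennreal K + 1" ?I] by simp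
      qed simp
      also have "\<dots> = (ennreal K + 1) * (1 + ?I)" by (simp only: distrib_left)
      also have "ennreal K + 1 = ennreal (K + 1)" using K by (simp add: ennreal_plus)
      finally show "ennreal K + ?I \<le> ennreal (K + 1) * (1 + ?I)" .
    qed auto
    also have "\<dots> = ennreal (c2 * (K + 1)) * (1 + (\<integral>\<^sup>+x. ennreal (?N x) * indicator \<Omega> x \<partial>lborel))"
      using c2 K by (simp add: ennreal_mult mult.assoc)
    finally show "(\<integral>\<^sup>+x. ennreal (F x * u x) \<partial>lborel)
        \<le> ennreal (c2 * (K + 1)) * (1 + (\<integral>\<^sup>+x. ennreal (N_conjugate Gs (F x)) * indicator \<Omega> x \<partial>lborel))" .
  qed
qed

section \<open>The energy space\<close>

lemma D_add: "D (\<lambda>x. u x + v x) z = D u z + D v z"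
  by (simp add: diff_quot_def add_divide_distrib[symmetric] diff_divide_distrib[symmetric] algebra_simps)

lemma D_diff: "D (\<lambda>x. u x - v x) z = D u z - D v z"
  by (simp add: diff_quot_def add_divide_distrib[symmetric] diff_divide_distrib[symmetric] algebra_simps)

lemma D_cmult: "D (\<lambda>x. c * u x) z = c * D u z"
  by (simp add: diff_quot_def algebra_simps)

lemma D_abs_le:
  assumes "\<bar>w (fst z) - w (snd z)\<bar> \<le> \<bar>u (fst z) - u (snd z)\<bar>"
  shows "\<bar>D w z\<bar> \<le> \<bar>D u z\<bar>"
  using assms by (simp add: diff_quot_def divide_right_mono)

lemma E_add_le: "E (\<bar>a\<bar> + \<bar>b\<bar>) \<le> 2 * C * (E a + E b)"
proof -
  have "E (\<bar>a\<bar> + \<bar>b\<bar>) \<le> E (2 * max \<bar>a\<bar> \<bar>b\<bar>)" by (intro E_mono) auto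
  also have "\<dots> \<le> 2 * C * E (max \<bar>a\<bar> \<bar>b\<bar>)" by (rule E_double)
  also have "\<dots> \<le> 2 * C * (E a + E b)"
    using C_pos E_nonneg by (intro mult_left_mono) (auto simp: max_def)
  finally show ?thesis .
qed

text \<open>Borel functions, so that Fubini applies to \<open>lborel\<close> directly, vanishing at
  every point outside \<Omega>. The modular of u itself is required to be finite, not that of some
  multiple; doubling makes this a vector space all the same.\<close>

definition W :: "('a \<Rightarrow> real) set" where
  "W = {u \<in> borel_measurable borel. (\<forall>x. x \<notin> \<Omega> \<longrightarrow> u x = 0) \<and> M u < \<infinity>}"

lemma W_measurable [measurable_dest]: "u \<in> W \<Longrightarrow> u \<in> borel_measurable borel"
  by (simp add: W_def)

lemma W_outside: "u \<in> W \<Longrightarrow> x \<notin> \<Omega> \<Longrightarrow> u x = 0"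
  by (simp add: W_def)

lemma W_integrable: "u \<in> W \<Longrightarrow> integrable \<kappa> (\<lambda>z. E (D u z))"
  unfolding W_def M_def using E_nonneg
  by (intro integrableI_bounded) (auto simp: measurable_compose[OF diff_quot_measurable])

definition Mr :: "('a \<Rightarrow> real) \<Rightarrow> real" where "Mr u = (\<integral>z. E (D u z) \<partial>\<kappa>)"

lemma M_eq_Mr: "u \<in> W \<Longrightarrow> M u = ennreal (Mr u)"
  unfolding M_def Mr_def by (intro nn_integral_eq_integral W_integrable) (auto simp: E_nonneg)

lemma Mr_nonneg: "0 \<le> Mr u"
  unfolding Mr_def by (intro Bochner_Integration.integral_nonneg) (auto simp: E_nonneg)

text \<open>Closure of \<open>W\<close> under sums, differences and truncations reduces to this
  pointwise bound on difference quotients; doubling pays for the sum on the right.\<close>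

lemma W_dominated:
  assumes [measurable]: "w \<in> borel_measurable borel" and "\<And>x. x \<notin> \<Omega> \<Longrightarrow> w x = 0"
    and u: "u \<in> W" and v: "v \<in> W" and le: "\<And>z. \<bar>D w z\<bar> \<le> \<bar>D u z\<bar> + \<bar>D v z\<bar>"
  shows "w \<in> W"
proof -
  note [measurable] = W_measurable[OF u] W_measurable[OF v]
  have "M w \<le> (\<integral>\<^sup>+z. ennreal (2 * C) * (ennreal (E (D u z)) + ennreal (E (D v z))) \<partial>\<kappa>)"
    unfolding M_def
  proof (intro nn_integral_mono)
    fix z
    have "E (D w z) \<le> E (\<bar>D u z\<bar> + \<bar>D v z\<bar>)" using le[of z] by (intro E_mono) auto
    also have "\<dots> \<le> 2 * C * (E (D u z) + E (D v z))" by (rule E_add_le)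
    finally have "ennreal (E (D w z)) \<le> ennreal (2 * C * (E (D u z) + E (D v z)))" by (rule ennreal_leI)
    also have "\<dots> = ennreal (2 * C) * (ennreal (E (D u z)) + ennreal (E (D v z)))"
      using C_pos E_nonneg by (simp add: ennreal_mult ennreal_plus)
    finally show "ennreal (E (D w z)) \<le> ennreal (2 * C) * (ennreal (E (D u z)) + ennreal (E (D v z)))" .
  qed
  also have "\<dots> = ennreal (2 * C) * (M u + M v)"
    unfolding M_def by (simp add: nn_integral_cmult nn_integral_add)
  also have "\<dots> < \<infinity>" using u v by (simp add: W_def ennreal_mult_less_top)
  finally show ?thesis using assms by (simp add: W_def)
qed

lemma W_zero: "(\<lambda>x. 0) \<in> W"
  by (simp add: W_def M_def diff_quot_def)

lemma W_add: "u \<in> W \<Longrightarrow> v \<in> W \<Longrightarrow> (\<lambda>x. u x + v x) \<in> W"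
  by (rule W_dominated[of _ u v]) (auto simp: W_outside D_add W_measurable)

lemma W_diff: "u \<in> W \<Longrightarrow> v \<in> W \<Longrightarrow> (\<lambda>x. u x - v x) \<in> W"
  by (rule W_dominated[of _ u v]) (auto simp: W_outside D_diff W_measurable)

lemma W_cmult:
  assumes u: "u \<in> W" shows "(\<lambda>x. c * u x) \<in> W"
proof -
  obtain K where K: "0 < K" "\<And>t. E (c * t) \<le> K * E t" using E_mult_bound[of c] by blast
  note [measurable] = W_measurable[OF u]
  have "M (\<lambda>x. c * u x) \<le> (\<integral>\<^sup>+z. ennreal K * ennreal (E (D u z)) \<partial>\<kappa>)"
    unfolding M_def D_cmult using K
    by (intro nn_integral_mono) (simp add: ennreal_mult[symmetric] E_nonneg ennreal_leI)
  also have "\<dots> = ennreal K * M u" unfolding M_def by (simp add: nn_integral_cmult)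
  also have "\<dots> < \<infinity>" using u by (simp add: W_def ennreal_mult_less_top)
  finally show ?thesis using u by (simp add: W_def)
qed

lemma W_lipschitz_image:
  assumes u: "u \<in> W" and [measurable]: "w \<in> borel_measurable borel"
    and "\<And>x. x \<notin> \<Omega> \<Longrightarrow> w x = 0" and le: "\<And>x y. \<bar>w x - w y\<bar> \<le> \<bar>u x - u y\<bar>"
  shows "w \<in> W"
proof (rule W_dominated[OF _ _ u W_zero])
  show "\<bar>D w z\<bar> \<le> \<bar>D u z\<bar> + \<bar>D (\<lambda>x. 0) z\<bar>" for z
    using D_abs_le[of w z u] le by simp
qed (use assms in auto)

lemma W_pos:
  assumes "u \<in> W" shows "(\<lambda>x. max (u x) 0) \<in> W"
  by (rule W_lipschitz_image[OF assms]) (use assms in \<open>auto simp: W_outside W_measurable\<close>)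

lemma W_abs:
  assumes "u \<in> W" shows "(\<lambda>x. \<bar>u x\<bar>) \<in> W"
  by (rule W_lipschitz_image[OF assms]) (use assms in \<open>auto simp: W_outside W_measurable\<close>)

lemma Mr_mono:
  assumes "u \<in> W" "w \<in> W" "\<And>z. \<bar>D w z\<bar> \<le> \<bar>D u z\<bar>"
  shows "Mr w \<le> Mr u"
  unfolding Mr_def by (intro integral_mono W_integrable assms E_mono)

lemma gD_integrable:
  assumes u: "u \<in> W" and \<phi>: "\<phi> \<in> W"
  shows "integrable \<kappa> (\<lambda>z. g (D u z) * D \<phi> z)"
proof -
  note [measurable] = W_measurable[OF u] W_measurable[OF \<phi>]
  obtain K where "0 < K" and K: "\<And>a b. \<bar>g a * b\<bar> \<le> 1 * E a + K * E b"
    by (rule young_split[OF zero_less_one]) (rule that)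
  show ?thesis
  proof (rule Bochner_Integration.integrable_bound)
    show "integrable \<kappa> (\<lambda>z. 1 * E (D u z) + K * E (D \<phi> z))"
      using W_integrable[OF u] W_integrable[OF \<phi>] by auto
    show "AE z in \<kappa>. norm (g (D u z) * D \<phi> z) \<le> norm (1 * E (D u z) + K * E (D \<phi> z))"
    proof (rule AE_I2)
      fix z
      show "norm (g (D u z) * D \<phi> z) \<le> norm (1 * E (D u z) + K * E (D \<phi> z))"
        using K[of "D u z" "D \<phi> z"] by simp
    qed
  qed measurable
qed

end

section \<open>The data of the problem and the weighted integral bounds\<close>

locale singular_problem = nonlocal_domain g C s \<Omega>
  for g :: "real \<Rightarrow> real" and C s :: real and \<Omega> :: "'a::euclidean_space set" +
  fixes f q :: "'a \<Rightarrow> real" and \<tau> Q :: real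
  assumes f_measurable [measurable]: "f \<in> borel_measurable borel" and f_nonneg: "0 \<le> f x"
    and \<tau>: "0 < \<tau>"
    and f_conj: "(\<integral>\<^sup>+x. ennreal (N_conjugate Gs (f x / \<tau>)) * indicator \<Omega> x \<partial>lborel) < \<infinity>"
    and q_measurable [measurable]: "q \<in> borel_measurable borel"
    and q_nonneg: "0 \<le> q x" and q_le: "q x \<le> Q"
begin

text \<open>The norm of L^1 with weight 1 + f. It controls u and f u at once, and since the weight
  is at least 1, convergence in it yields pointwise convergence of a subsequence.\<close>

definition I :: "('a \<Rightarrow> real) \<Rightarrow> ennreal" where
  "I u = (\<integral>\<^sup>+x. ennreal ((1 + f x) * \<bar>u x\<bar>) \<partial>lborel)"

text \<open>The embedding is used with F = 1, whose conjugate integral is finite because \<Omega> is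
  bounded, and with F = f / \<tau>.\<close>

lemma I_bounded:
  obtains c where "0 < c" "\<And>u. u \<in> W \<Longrightarrow> M u \<le> 1 \<Longrightarrow> I u \<le> ennreal c"
proof -
  obtain c where c: "0 < c" and emb: "\<And>u F. u \<in> borel_measurable borel \<Longrightarrow> F \<in> borel_measurable borel \<Longrightarrow> (\<And>x. 0 \<le> u x) \<Longrightarrow>
      (\<And>x. 0 \<le> F x) \<Longrightarrow> (\<And>x. x \<notin> \<Omega> \<Longrightarrow> u x = 0) \<Longrightarrow> M u \<le> 1 \<Longrightarrow>
      (\<integral>\<^sup>+x. ennreal (F x * u x) \<partial>lborel)
        \<le> ennreal c * (1 + (\<integral>\<^sup>+x. ennreal (N_conjugate Gs (F x)) * indicator \<Omega> x \<partial>lborel))"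
    using embedding by blast
  let ?A = "\<integral>\<^sup>+x. ennreal (N_conjugate Gs (f x / \<tau>)) * indicator \<Omega> x \<partial>lborel"
  let ?B = "\<integral>\<^sup>+x. ennreal (N_conjugate Gs 1) * indicator \<Omega> x \<partial>lborel"
  have [measurable]: "\<Omega> \<in> sets borel" using open_dom by simp
  have "emeasure lborel \<Omega> < \<infinity>"
    using emeasure_bounded_finite[OF bounded_dom] by simp
  then have B: "?B < \<infinity>"
    by (subst nn_integral_cmult_indicator) (auto simp: ennreal_mult_less_top)
  let ?T = "ennreal c * (1 + ?B) + ennreal \<tau> * (ennreal c * (1 + ?A))"
  have T: "?T < \<infinity>" using B f_conj by (simp add: ennreal_mult_less_top)
  have le: "I u \<le> ?T" if u: "u \<in> W" "M u \<le> 1" for u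
  proof -
    note [measurable] = W_measurable[OF u(1)]
    let ?u = "\<lambda>x. \<bar>u x\<bar>"
    have "M ?u \<le> M u" unfolding M_def
      by (intro nn_integral_mono ennreal_leI E_mono D_abs_le) auto
    then have M1: "M ?u \<le> 1" using u(2) by simp
    have "I u = (\<integral>\<^sup>+x. ennreal (1 * ?u x) + ennreal \<tau> * ennreal (f x / \<tau> * ?u x) \<partial>lborel)"
      unfolding I_def
    proof (intro nn_integral_cong)
      fix x
      have "ennreal ((1 + f x) * ?u x) = ennreal (1 * ?u x + \<tau> * (f x / \<tau> * ?u x))"
        using \<tau> by (simp add: algebra_simps)
      also have "\<dots> = ennreal (1 * ?u x) + ennreal (\<tau> * (f x / \<tau> * ?u x))"
        using \<tau> f_nonneg[of x] by (intro ennreal_plus) auto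
      also have "ennreal (\<tau> * (f x / \<tau> * ?u x)) = ennreal \<tau> * ennreal (f x / \<tau> * ?u x)"
        using \<tau> f_nonneg[of x] by (intro ennreal_mult) auto
      finally show "ennreal ((1 + f x) * ?u x) = ennreal (1 * ?u x) + ennreal \<tau> * ennreal (f x / \<tau> * ?u x)" .
    qed
    also have "\<dots> = (\<integral>\<^sup>+x. ennreal (1 * ?u x) \<partial>lborel) + ennreal \<tau> * (\<integral>\<^sup>+x. ennreal (f x / \<tau> * ?u x) \<partial>lborel)"
      by (simp add: nn_integral_add nn_integral_cmult)
    also have "\<dots> \<le> ?T"
      using \<tau> f_nonneg u M1
      by (intro add_mono mult_left_mono emb) (auto simp: W_outside)
    finally show ?thesis .
  qed
  obtain t where t: "?T = ennreal t" "0 \<le> t" using T by (cases ?T) auto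
  show thesis
  proof (rule that[of "t + 1"])
    show "I u \<le> ennreal (t + 1)" if "u \<in> W" "M u \<le> 1" for u
    proof -
      have "I u \<le> ennreal t" using le[OF that] t(1) by simp
      also have "\<dots> \<le> ennreal (t + 1)" by (intro ennreal_leI) simp
      finally show ?thesis .
    qed
  qed (use t in simp)
qed

definition c_emb :: real where
  "c_emb = (SOME c. 0 < c \<and> (\<forall>u\<in>W. M u \<le> 1 \<longrightarrow> I u \<le> ennreal c))"

lemma c_emb: "0 < c_emb" "u \<in> W \<Longrightarrow> M u \<le> 1 \<Longrightarrow> I u \<le> ennreal c_emb"
proof -
  have "\<exists>c. 0 < c \<and> (\<forall>u\<in>W. M u \<le> 1 \<longrightarrow> I u \<le> ennreal c)"
    by (meson I_bounded)
  from someI_ex[OF this] show "0 < c_emb" "u \<in> W \<Longrightarrow> M u \<le> 1 \<Longrightarrow> I u \<le> ennreal c_emb"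
    unfolding c_emb_def by blast+
qed

lemma I_cmult:
  assumes "u \<in> borel_measurable borel"
  shows "I (\<lambda>x. c * u x) = ennreal \<bar>c\<bar> * I u"
proof -
  note [measurable] = assms
  have "ennreal ((1 + f x) * \<bar>c * u x\<bar>) = ennreal \<bar>c\<bar> * ennreal ((1 + f x) * \<bar>u x\<bar>)" for x
    using f_nonneg[of x] by (subst ennreal_mult[symmetric]) (auto simp: abs_mult algebra_simps)
  then show ?thesis unfolding I_def by (simp add: nn_integral_cmult)
qed

lemma I_scaled:
  assumes u: "u \<in> W" and t: "0 < t" and "M (\<lambda>x. u x / t) \<le> 1"
  shows "I u \<le> ennreal (c_emb * t)"
proof -
  have w: "(\<lambda>x. u x / t) \<in> W" using W_cmult[OF u, of "1/t"] by simp
  have "I u = I (\<lambda>x. t * (u x / t))" using t by simp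
  also have "\<dots> = ennreal \<bar>t\<bar> * I (\<lambda>x. u x / t)" by (rule I_cmult) (use w W_measurable in blast)
  also have "\<dots> \<le> ennreal \<bar>t\<bar> * ennreal c_emb" by (intro mult_left_mono c_emb w assms) auto
  also have "\<dots> = ennreal (c_emb * t)" using t c_emb(1) by (simp add: ennreal_mult[symmetric] mult.commute)
  finally show ?thesis .
qed

text \<open>Division by t = max 1 (sqrt (Mr u)) brings the modular below 1, because
  \<open>E_scale\<close> gains 1 / t^2. The linear quantity I thus grows like the square root of the
  energy.\<close>

lemma I_coercive:
  assumes u: "u \<in> W"
  shows "I u \<le> ennreal (c_emb * (1 + sqrt (Mr u)))"
proof -
  define t where "t = max 1 (sqrt (Mr u))"
  have t: "1 \<le> t" "Mr u \<le> t\<^sup>2"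
    using Mr_nonneg[of u] by (auto simp: t_def max_def real_le_rsqrt dest: real_sqrt_le_iff[THEN iffD1])
  have "M (\<lambda>x. u x / t) \<le> 1"
  proof -
    have w: "(\<lambda>x. u x / t) \<in> W" using W_cmult[OF u, of "1/t"] by simp
    have "Mr (\<lambda>x. u x / t) \<le> (\<integral>z. (1/t)\<^sup>2 * E (D u z) \<partial>\<kappa>)"
      unfolding Mr_def
    proof (rule integral_mono[OF W_integrable[OF w]])
      show "integrable \<kappa> (\<lambda>z. (1 / t)\<^sup>2 * E (D u z))" using W_integrable[OF u] by simp
      show "E (D (\<lambda>x. u x / t) z) \<le> (1/t)\<^sup>2 * E (D u z)" for z
        using D_cmult[of "1/t" u z] E_scale[of "1/t" "D u z"] t by simp
    qed
    also have "\<dots> = Mr u / t\<^sup>2" by (simp add: Mr_def power_divide)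
    also have "\<dots> \<le> 1" using t by (simp add: divide_le_eq)
    finally show ?thesis unfolding M_eq_Mr[OF w] by (simp add: ennreal_le_1)
  qed
  then have "I u \<le> ennreal (c_emb * t)" using t by (intro I_scaled u) auto
  also have "\<dots> \<le> ennreal (c_emb * (1 + sqrt (Mr u)))"
    using c_emb(1) Mr_nonneg[of u] by (intro ennreal_leI mult_left_mono) (auto simp: t_def)
  finally show ?thesis .
qed

lemma I_finite: "u \<in> W \<Longrightarrow> I u < \<infinity>"
  using I_coercive[of u] by (simp add: order_le_less_trans)

text \<open>Magnifying u by 1 / t multiplies its energy by at most a doubling constant K, so energy
  below 1 / K still leaves the magnified function in the unit ball of the embedding.\<close>

lemma I_small:
  assumes "0 < \<eta>"
  obtains \<delta> where "0 < \<delta>" "\<And>u. u \<in> W \<Longrightarrow> Mr u \<le> \<delta> \<Longrightarrow> I u \<le> ennreal \<eta>"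
proof -
  define t where "t = \<eta> / c_emb"
  have t: "0 < t" using assms c_emb(1) by (simp add: t_def)
  obtain K where K: "0 < K" "\<And>a. E (1/t * a) \<le> K * E a" using E_mult_bound[of "1/t"] by blast
  show thesis
  proof (rule that[of "1 / K"])
    fix u assume u: "u \<in> W" and Mu: "Mr u \<le> 1 / K"
    have w: "(\<lambda>x. u x / t) \<in> W" using W_cmult[OF u, of "1/t"] by simp
    have "Mr (\<lambda>x. u x / t) \<le> (\<integral>z. K * E (D u z) \<partial>\<kappa>)"
      unfolding Mr_def
    proof (rule integral_mono[OF W_integrable[OF w]])
      show "integrable \<kappa> (\<lambda>z. K * E (D u z))" using W_integrable[OF u] by simp
      show "E (D (\<lambda>x. u x / t) z) \<le> K * E (D u z)" for z
        using D_cmult[of "1/t" u z] K(2)[of "D u z"] by simp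
    qed
    also have "\<dots> = K * Mr u" by (simp add: Mr_def)
    also have "\<dots> \<le> 1" using Mu K(1) by (simp add: field_simps)
    finally have "M (\<lambda>x. u x / t) \<le> 1" unfolding M_eq_Mr[OF w] by (simp add: ennreal_le_1)
    then have "I u \<le> ennreal (c_emb * t)" by (intro I_scaled u t)
    then show "I u \<le> ennreal \<eta>" using c_emb(1) by (simp add: t_def)
  qed (use K in simp)
qed

lemma Mr_0_imp:
  assumes u: "u \<in> W" and "Mr u = 0"
  shows "AE x in lborel. u x = 0"
proof -
  note [measurable] = W_measurable[OF u]
  have "I u \<le> ennreal \<eta>" if "0 < \<eta>" for \<eta>
    using I_small[OF that] assms by (metis less_imp_le)
  then have "I u = 0"
    by (metis ennreal_less_zero_iff linorder_not_less nle_le dense ennreal_0 zero_less_iff_neq_zero ennreal_le_epsilon add_0 zero_le)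
  then have "AE x in lborel. ennreal ((1 + f x) * \<bar>u x\<bar>) = 0"
    unfolding I_def by (subst (asm) nn_integral_0_iff_AE) auto
  then show ?thesis
  proof eventually_elim
    case (elim x)
    then show ?case using f_nonneg[of x] by (auto simp: ennreal_eq_0_iff mult_le_0_iff)
  qed
qed

lemma I_AE_L1:
  assumes u: "u \<in> W"
  shows "integrable lborel (\<lambda>x. (1 + f x) * u x)" "integrable lborel u" "integrable lborel (\<lambda>x. f x * u x)"
proof -
  note [measurable] = W_measurable[OF u]
  show 1: "integrable lborel (\<lambda>x. (1 + f x) * u x)"
    using I_finite[OF u] f_nonneg unfolding I_def
    by (intro integrableI_bounded) (auto simp: abs_mult)
  show "integrable lborel u"
  proof (rule Bochner_Integration.integrable_bound[OF 1])
    show "AE x in lborel. norm (u x) \<le> norm ((1 + f x) * u x)"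
      using f_nonneg by (intro AE_I2) (auto simp: abs_mult mult_le_cancel_right1)
  qed simp
  show "integrable lborel (\<lambda>x. f x * u x)"
  proof (rule Bochner_Integration.integrable_bound[OF 1])
    show "AE x in lborel. norm (f x * u x) \<le> norm ((1 + f x) * u x)"
      using f_nonneg by (intro AE_I2) (auto simp: abs_mult intro!: mult_right_mono)
  qed simp
qed

section \<open>Minimisers of the regularised energy\<close>

definition p :: "real \<Rightarrow> 'a \<Rightarrow> real \<Rightarrow> real" where
  "p \<epsilon> x t = (max t 0 + \<epsilon>) powr (- q x)"

text \<open>The primitive in t of \<open>p \<epsilon> x\<close> vanishing at 0, with the logarithm
  at q = 1. For negative t the truncation in \<open>p\<close> makes the nonlinearity constant, hence
  the linear branch.\<close>

definition P :: "real \<Rightarrow> 'a \<Rightarrow> real \<Rightarrow> real" where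
  "P \<epsilon> x t = (if t \<le> 0 then \<epsilon> powr (- q x) * t
     else if q x = 1 then ln (t + \<epsilon>) - ln \<epsilon>
     else ((t + \<epsilon>) powr (1 - q x) - \<epsilon> powr (1 - q x)) / (1 - q x))"

lemma P_0 [simp]: "P \<epsilon> x 0 = 0"
  by (simp add: P_def)

lemma p_pos: "0 < \<epsilon> \<Longrightarrow> 0 < p \<epsilon> x t"
  by (simp add: p_def max_def)

lemma p_antimono: "0 < \<epsilon> \<Longrightarrow> a \<le> b \<Longrightarrow> p \<epsilon> x b \<le> p \<epsilon> x a"
  unfolding p_def using q_nonneg[of x] by (intro powr_mono2') auto

lemma p_le: "0 < \<epsilon> \<Longrightarrow> \<epsilon> \<le> 1 \<Longrightarrow> p \<epsilon> x t \<le> \<epsilon> powr (- Q)"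
proof -
  assume \<epsilon>: "0 < \<epsilon>" "\<epsilon> \<le> 1"
  have "p \<epsilon> x t \<le> \<epsilon> powr (- q x)"
    unfolding p_def using \<epsilon> q_nonneg[of x] by (intro powr_mono2') auto
  also have "\<dots> \<le> \<epsilon> powr (- Q)"
    using \<epsilon> q_le[of x] by (intro powr_mono') auto
  finally show ?thesis .
qed

text \<open>Concavity of \<open>P\<close> with supergradient \<open>p\<close>. The smooth branch L
  is concave and the other branch is linear with the same slope at 0; points of opposite sign are
  compared through 0.\<close>

lemma P_tangent:
  assumes \<epsilon>: "0 < \<epsilon>"
  shows "P \<epsilon> x b \<le> P \<epsilon> x a + p \<epsilon> x a * (b - a)"
proof -
  define L where "L t = (if q x = 1 then ln (t + \<epsilon>) - ln \<epsilon>
     else ((t + \<epsilon>) powr (1 - q x) - \<epsilon> powr (1 - q x)) / (1 - q x))" for t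
  have L0: "L 0 = 0" by (simp add: L_def)
  have PL: "P \<epsilon> x t = L t" if "0 \<le> t" for t
    using that L0 by (cases "t = 0") (auto simp: P_def L_def)
  have Pneg: "P \<epsilon> x t = p \<epsilon> x 0 * t" if "t \<le> 0" for t
    using that by (simp add: P_def p_def)
  have der: "(L has_real_derivative (t + \<epsilon>) powr (- q x)) (at t)" if "- \<epsilon> < t" for t
  proof (cases "q x = 1")
    case True
    have "((\<lambda>t. ln (t + \<epsilon>) - ln \<epsilon>) has_real_derivative 1 / (t + \<epsilon>)) (at t)"
      using that by (auto intro!: derivative_eq_intros)
    then show ?thesis using True that by (simp add: L_def[abs_def] powr_neg_one)
  next
    case False
    have "((\<lambda>t. ((t + \<epsilon>) powr (1 - q x) - \<epsilon> powr (1 - q x)) / (1 - q x)) has_real_derivative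
        ((1 - q x) * (t + \<epsilon>) powr (1 - q x - 1)) / (1 - q x)) (at t)"
      using that by (auto intro!: derivative_eq_intros)
    then show ?thesis using False by (simp add: L_def[abs_def])
  qed
  have cvx: "convex_on {- \<epsilon><..} (\<lambda>t. - L t)"
  proof (rule convex_on_realI)
    show "((\<lambda>t. - L t) has_real_derivative - ((t + \<epsilon>) powr (- q x))) (at t)" if "t \<in> {- \<epsilon><..}" for t
      using der[of t] that by (auto intro: DERIV_minus)
    show "- ((a + \<epsilon>) powr (- q x)) \<le> - ((b + \<epsilon>) powr (- q x))"
      if "a \<in> {- \<epsilon><..}" "b \<in> {- \<epsilon><..}" "a \<le> b" for a b
      using that q_nonneg[of x] by (simp add: powr_mono2')
  qed (simp add: is_interval_connected)
  have tan: "L b \<le> L a + (a + \<epsilon>) powr (- q x) * (b - a)" if "0 \<le> a" "0 \<le> b" for a b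
  proof -
    have "- L b - (- L a) \<ge> - ((a + \<epsilon>) powr (- q x)) * (b - a)"
    proof (rule convex_on_imp_above_tangent[OF cvx])
      show "((\<lambda>t. - L t) has_real_derivative - ((a + \<epsilon>) powr (- q x))) (at a within {- \<epsilon><..})"
        using der[of a] \<epsilon> that by (auto intro: DERIV_minus has_field_derivative_at_within)
      show "connected {- \<epsilon><..}" by simp
      show "a \<in> interior {- \<epsilon><..}" "b \<in> {- \<epsilon><..}" using \<epsilon> that by (simp_all add: interior_open)
    qed
    then show ?thesis by simp
  qed
  have pp: "p \<epsilon> x a = (a + \<epsilon>) powr (- q x)" if "0 \<le> a" for a using that by (simp add: p_def)
  have pneg: "p \<epsilon> x a = p \<epsilon> x 0" if "a \<le> 0" for a using that by (simp add: p_def)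
  consider "0 \<le> a" "0 \<le> b" | "a < 0" "b < 0" | "a < 0" "0 \<le> b" | "0 \<le> a" "b < 0" by atomize_elim linarith
  then show ?thesis
  proof cases
    case 1
    then show ?thesis unfolding PL[OF 1(1)] PL[OF 1(2)] pp[OF 1(1)] by (rule tan)
  next
    case 2
    then have "a \<le> 0" "b \<le> 0" by simp_all
    then show ?thesis by (simp only: Pneg pneg[of a]) (simp add: algebra_simps)
  next
    case 3
    then have "P \<epsilon> x b \<le> p \<epsilon> x 0 * b"
      unfolding PL[OF 3(2)] pp[OF order_refl] using tan[of 0 b] L0 by simp
    moreover have "P \<epsilon> x a = p \<epsilon> x 0 * a" "p \<epsilon> x a = p \<epsilon> x 0" using 3 by (intro Pneg pneg; simp)+
    ultimately show ?thesis by (simp add: algebra_simps)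
  next
    case 4
    have "0 \<le> P \<epsilon> x a + p \<epsilon> x a * (0 - a)"
      unfolding PL[OF 4(1)] pp[OF 4(1)] using tan[of a 0] L0 4 by simp
    moreover have "p \<epsilon> x 0 * b \<le> p \<epsilon> x a * b"
      using 4 p_antimono[OF \<epsilon>, of 0 a x] by (simp add: mult_right_mono_neg)
    moreover have "P \<epsilon> x b = p \<epsilon> x 0 * b" using 4 by (intro Pneg) simp
    ultimately show ?thesis by (simp add: algebra_simps)
  qed
qed

lemma P_lipschitz:
  assumes "0 < \<epsilon>" "\<epsilon> \<le> 1"
  shows "\<bar>P \<epsilon> x a - P \<epsilon> x b\<bar> \<le> \<epsilon> powr (- Q) * \<bar>a - b\<bar>"
proof -
  have *: "P \<epsilon> x a - P \<epsilon> x b \<le> \<epsilon> powr (- Q) * \<bar>a - b\<bar>" for a b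
  proof -
    have "P \<epsilon> x a - P \<epsilon> x b \<le> p \<epsilon> x b * (a - b)"
      using P_tangent[OF assms(1), of x a b] by simp
    also have "\<dots> \<le> p \<epsilon> x b * \<bar>a - b\<bar>"
      using p_pos[OF assms(1), of x b] by (intro mult_left_mono) auto
    also have "\<dots> \<le> \<epsilon> powr (- Q) * \<bar>a - b\<bar>"
      by (intro mult_right_mono p_le assms) auto
    finally show ?thesis .
  qed
  show ?thesis using *[of a b] *[of b a] by (simp add: abs_minus_commute abs_le_iff)
qed

lemma P_mono: "0 < \<epsilon> \<Longrightarrow> a \<le> b \<Longrightarrow> P \<epsilon> x a \<le> P \<epsilon> x b"
  using P_tangent[of \<epsilon> x a b] mult_nonneg_nonpos[of "p \<epsilon> x b" "a - b"] p_pos[of \<epsilon> x b] by simp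

lemma P_measurable [measurable]:
  assumes [measurable]: "u \<in> borel_measurable borel"
  shows "(\<lambda>x. P \<epsilon> x (u x)) \<in> borel_measurable borel"
  unfolding P_def by measurable

lemma p_measurable [measurable]:
  assumes [measurable]: "u \<in> borel_measurable borel"
  shows "(\<lambda>x. p \<epsilon> x (u x)) \<in> borel_measurable borel"
  unfolding p_def by measurable

lemma fP_integrable:
  assumes u: "u \<in> W" and \<epsilon>: "0 < \<epsilon>" "\<epsilon> \<le> 1"
  shows "integrable lborel (\<lambda>x. f x * P \<epsilon> x (u x))"
proof -
  note [measurable] = W_measurable[OF u]
  show ?thesis
  proof (rule Bochner_Integration.integrable_bound)
    show "integrable lborel (\<lambda>x. \<epsilon> powr (- Q) * (f x * u x))" using I_AE_L1(3)[OF u] by simp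
    show "AE x in lborel. norm (f x * P \<epsilon> x (u x)) \<le> norm (\<epsilon> powr (- Q) * (f x * u x))"
    proof (rule AE_I2)
      fix x
      have "f x * \<bar>P \<epsilon> x (u x)\<bar> \<le> f x * (\<epsilon> powr (- Q) * \<bar>u x\<bar>)"
        using P_lipschitz[OF \<epsilon>, of x "u x" 0] f_nonneg[of x] by (intro mult_left_mono) auto
      then show "norm (f x * P \<epsilon> x (u x)) \<le> norm (\<epsilon> powr (- Q) * (f x * u x))"
        using f_nonneg[of x] by (simp add: abs_mult algebra_simps)
    qed
  qed simp
qed

lemma fp_integrable:
  assumes u: "u \<in> borel_measurable borel" and \<phi>: "\<phi> \<in> W" and \<epsilon>: "0 < \<epsilon>" "\<epsilon> \<le> 1"
  shows "integrable lborel (\<lambda>x. f x * p \<epsilon> x (u x) * \<phi> x)"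
proof -
  note [measurable] = u W_measurable[OF \<phi>]
  show ?thesis
  proof (rule Bochner_Integration.integrable_bound)
    show "integrable lborel (\<lambda>x. \<epsilon> powr (- Q) * (f x * \<phi> x))" using I_AE_L1(3)[OF \<phi>] by simp
    show "AE x in lborel. norm (f x * p \<epsilon> x (u x) * \<phi> x) \<le> norm (\<epsilon> powr (- Q) * (f x * \<phi> x))"
    proof (rule AE_I2)
      fix x
      have "p \<epsilon> x (u x) * (f x * \<bar>\<phi> x\<bar>) \<le> \<epsilon> powr (- Q) * (f x * \<bar>\<phi> x\<bar>)"
        using p_le[OF \<epsilon>] f_nonneg[of x] by (intro mult_right_mono) auto
      then show "norm (f x * p \<epsilon> x (u x) * \<phi> x) \<le> norm (\<epsilon> powr (- Q) * (f x * \<phi> x))"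
        using f_nonneg[of x] p_pos[OF \<epsilon>(1), of x "u x"] by (simp add: abs_mult algebra_simps)
    qed
  qed simp
qed

section \<open>The regularised energy functional\<close>

definition J :: "real \<Rightarrow> ('a \<Rightarrow> real) \<Rightarrow> real" where
  "J \<epsilon> u = Mr u - (\<integral>x. f x * P \<epsilon> x (u x) \<partial>lborel)"

lemma fP_diff_le:
  assumes u: "u \<in> W" and v: "v \<in> W" and \<epsilon>: "0 < \<epsilon>" "\<epsilon> \<le> 1" and I: "I (\<lambda>x. u x - v x) \<le> ennreal a" and a: "0 \<le> a"
  shows "\<bar>(\<integral>x. f x * P \<epsilon> x (u x) \<partial>lborel) - (\<integral>x. f x * P \<epsilon> x (v x) \<partial>lborel)\<bar> \<le> \<epsilon> powr (- Q) * a"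
proof -
  note [measurable] = W_measurable[OF u] W_measurable[OF v]
  have i: "integrable lborel (\<lambda>x. f x * P \<epsilon> x (u x) - f x * P \<epsilon> x (v x))"
    using fP_integrable[OF u \<epsilon>] fP_integrable[OF v \<epsilon>] by simp
  have "ennreal (norm (\<integral>x. f x * P \<epsilon> x (u x) - f x * P \<epsilon> x (v x) \<partial>lborel))
      \<le> (\<integral>\<^sup>+x. ennreal (norm (f x * P \<epsilon> x (u x) - f x * P \<epsilon> x (v x))) \<partial>lborel)"
    by (rule integral_norm_bound_ennreal[OF i])
  also have "\<dots> \<le> (\<integral>\<^sup>+x. ennreal (\<epsilon> powr (- Q)) * ennreal ((1 + f x) * \<bar>u x - v x\<bar>) \<partial>lborel)"
  proof (intro nn_integral_mono)
    fix x
    have "norm (f x * P \<epsilon> x (u x) - f x * P \<epsilon> x (v x)) = f x * \<bar>P \<epsilon> x (u x) - P \<epsilon> x (v x)\<bar>"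
      using f_nonneg[of x] by (simp add: right_diff_distrib[symmetric] abs_mult)
    also have "\<dots> \<le> (1 + f x) * (\<epsilon> powr (- Q) * \<bar>u x - v x\<bar>)"
      using f_nonneg[of x] by (intro mult_mono P_lipschitz \<epsilon>) auto
    also have "\<dots> = \<epsilon> powr (- Q) * ((1 + f x) * \<bar>u x - v x\<bar>)" by simp
    finally have "ennreal (norm (f x * P \<epsilon> x (u x) - f x * P \<epsilon> x (v x))) \<le> ennreal (\<epsilon> powr (- Q) * ((1 + f x) * \<bar>u x - v x\<bar>))"
      by (rule ennreal_leI)
    also have "\<dots> = ennreal (\<epsilon> powr (- Q)) * ennreal ((1 + f x) * \<bar>u x - v x\<bar>)"
      using f_nonneg[of x] by (intro ennreal_mult) auto
    finally show "ennreal (norm (f x * P \<epsilon> x (u x) - f x * P \<epsilon> x (v x))) \<le> ennreal (\<epsilon> powr (- Q)) * ennreal ((1 + f x) * \<bar>u x - v x\<bar>)" .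
  qed
  also have "\<dots> = ennreal (\<epsilon> powr (- Q)) * I (\<lambda>x. u x - v x)"
    unfolding I_def by (simp add: nn_integral_cmult)
  also have "\<dots> \<le> ennreal (\<epsilon> powr (- Q)) * ennreal a" by (intro mult_left_mono I) auto
  also have "\<dots> = ennreal (\<epsilon> powr (- Q) * a)" using a by (intro ennreal_mult[symmetric]) auto
  finally have "norm (\<integral>x. f x * P \<epsilon> x (u x) - f x * P \<epsilon> x (v x) \<partial>lborel) \<le> \<epsilon> powr (- Q) * a"
    using a by (subst (asm) ennreal_le_iff) auto
  then show ?thesis
    using fP_integrable[OF u \<epsilon>] fP_integrable[OF v \<epsilon>] by simp
qed

text \<open>The lower-order integral is at most b (1 + sqrt (Mr u)), and the bound on twice a
  product by the sum of squares absorbs half of the energy.\<close>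

lemma J_coercive:
  assumes u: "u \<in> W" and \<epsilon>: "0 < \<epsilon>" "\<epsilon> \<le> 1"
  defines "b \<equiv> \<epsilon> powr (- Q) * c_emb"
  shows "Mr u \<le> 2 * (J \<epsilon> u + b + b\<^sup>2)"
proof -
  let ?m = "sqrt (Mr u)"
  have "I (\<lambda>x. u x - 0) \<le> ennreal (c_emb * (1 + ?m))" using I_coercive[OF u] by simp
  then have "\<bar>(\<integral>x. f x * P \<epsilon> x (u x) \<partial>lborel) - (\<integral>x. f x * P \<epsilon> x 0 \<partial>lborel)\<bar> \<le> \<epsilon> powr (- Q) * (c_emb * (1 + ?m))"
    using c_emb(1) Mr_nonneg[of u] by (intro fP_diff_le[OF u W_zero \<epsilon>]) auto
  then have "(\<integral>x. f x * P \<epsilon> x (u x) \<partial>lborel) \<le> b * (1 + ?m)" by (simp add: b_def mult.assoc)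
  then have "Mr u \<le> J \<epsilon> u + b + b * ?m" by (simp add: J_def algebra_simps)
  moreover have "2 * (b * ?m) \<le> Mr u + b\<^sup>2"
    using sum_squares_bound[of b ?m] Mr_nonneg[of u] by (simp add: algebra_simps)
  moreover have "0 \<le> b\<^sup>2" by simp
  ultimately have "Mr u \<le> 2 * J \<epsilon> u + 2 * b + 2 * b\<^sup>2" by linarith
  then show ?thesis by (simp only: distrib_left)
qed

text \<open>Clarkson's inequality for the energy is added to midpoint concavity of \<open>P\<close>;
  the support terms of \<open>P\<close> at the midpoint cancel.\<close>

lemma J_clarkson:
  assumes u: "u \<in> W" and v: "v \<in> W" and \<epsilon>: "0 < \<epsilon>" "\<epsilon> \<le> 1"
  shows "J \<epsilon> (\<lambda>x. (u x + v x) / 2) + Mr (\<lambda>x. (u x - v x) / 2) \<le> (J \<epsilon> u + J \<epsilon> v) / 2"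
proof -
  have w1: "(\<lambda>x. (u x + v x) / 2) \<in> W" using W_cmult[OF W_add[OF u v], of "1/2"] by simp
  have w2: "(\<lambda>x. (u x - v x) / 2) \<in> W" using W_cmult[OF W_diff[OF u v], of "1/2"] by simp
  have d1: "D (\<lambda>x. (u x + v x) / 2) z = (D u z + D v z) / 2" for z
    using D_cmult[of "1/2" "\<lambda>x. u x + v x" z] by (simp add: D_add)
  have d2: "D (\<lambda>x. (u x - v x) / 2) z = (D u z - D v z) / 2" for z
    using D_cmult[of "1/2" "\<lambda>x. u x - v x" z] by (simp add: D_diff)
  have "Mr (\<lambda>x. (u x + v x) / 2) + Mr (\<lambda>x. (u x - v x) / 2)
      = (\<integral>z. E ((D u z + D v z) / 2) + E ((D u z - D v z) / 2) \<partial>\<kappa>)"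
    unfolding Mr_def d1[symmetric] d2[symmetric]
    using W_integrable[OF w1] W_integrable[OF w2] by simp
  also have "\<dots> \<le> (\<integral>z. (E (D u z) + E (D v z)) / 2 \<partial>\<kappa>)"
    using W_integrable[OF w1] W_integrable[OF w2] W_integrable[OF u] W_integrable[OF v]
    by (intro integral_mono clarkson) (auto simp: d1[symmetric] d2[symmetric])
  also have "\<dots> = (Mr u + Mr v) / 2"
    unfolding Mr_def using W_integrable[OF u] W_integrable[OF v] by simp
  finally have 1: "Mr (\<lambda>x. (u x + v x) / 2) + Mr (\<lambda>x. (u x - v x) / 2) \<le> (Mr u + Mr v) / 2" .
  have "((\<integral>x. f x * P \<epsilon> x (u x) \<partial>lborel) + (\<integral>x. f x * P \<epsilon> x (v x) \<partial>lborel)) / 2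
      = (\<integral>x. (f x * P \<epsilon> x (u x) + f x * P \<epsilon> x (v x)) / 2 \<partial>lborel)"
    using fP_integrable[OF u \<epsilon>] fP_integrable[OF v \<epsilon>] by simp
  also have "\<dots> \<le> (\<integral>x. f x * P \<epsilon> x ((u x + v x) / 2) \<partial>lborel)"
  proof (rule integral_mono)
    show "(f x * P \<epsilon> x (u x) + f x * P \<epsilon> x (v x)) / 2 \<le> f x * P \<epsilon> x ((u x + v x) / 2)" for x
    proof -
      have e: "p \<epsilon> x ((u x + v x) / 2) * (u x - (u x + v x) / 2) + p \<epsilon> x ((u x + v x) / 2) * (v x - (u x + v x) / 2) = 0"
        unfolding distrib_left[symmetric] by simp
      have "(P \<epsilon> x (u x) + P \<epsilon> x (v x)) / 2 \<le> P \<epsilon> x ((u x + v x) / 2)"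
      proof -
        have aux: "(A + B) / 2 \<le> T" if "A \<le> T + r" "B \<le> T + r'" "r + r' = 0" for A B T r r' :: real
          using that by simp
        show ?thesis by (rule aux[OF P_tangent[OF \<epsilon>(1)] P_tangent[OF \<epsilon>(1)] e])
      qed
      then have "f x * ((P \<epsilon> x (u x) + P \<epsilon> x (v x)) / 2) \<le> f x * P \<epsilon> x ((u x + v x) / 2)"
        using f_nonneg[of x] by (intro mult_left_mono)
      moreover have "(f x * P \<epsilon> x (u x) + f x * P \<epsilon> x (v x)) / 2 = f x * ((P \<epsilon> x (u x) + P \<epsilon> x (v x)) / 2)"
        by (simp add: algebra_simps)
      ultimately show ?thesis by (simp only:)
    qed
  qed (use fP_integrable[OF u \<epsilon>] fP_integrable[OF v \<epsilon>] fP_integrable[OF w1 \<epsilon>] in auto)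
  finally show ?thesis using 1 by (simp add: J_def)
qed

end

context nonlocal_domain
begin

lemma AE_diff_quot_tendsto:
  assumes "AE x in lborel. (\<lambda>n. u n x) \<longlonglongrightarrow> v x"
  shows "AE z in \<kappa>. (\<lambda>n. D (u n) z) \<longlonglongrightarrow> D v z"
  using AE_sing_measure_pair[OF assms]
proof eventually_elim
  case (elim z)
  then have "(\<lambda>n. (u n (fst z) - u n (snd z)) * inverse (norm (fst z - snd z) powr s))
      \<longlonglongrightarrow> (v (fst z) - v (snd z)) * inverse (norm (fst z - snd z) powr s)"
    by (intro tendsto_mult tendsto_diff tendsto_const) auto
  then show ?case by (simp add: diff_quot_def divide_inverse)
qed

text \<open>Fatou's lemma for \<open>\<kappa>\<close>. Almost everywhere convergence of the
  functions passes to the difference quotients because a null set of points produces a null set of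
  pairs.\<close>

lemma W_limit:
  assumes u: "\<And>n. u n \<in> W" and le: "\<And>n. Mr (u n) \<le> B"
    and v: "v \<in> borel_measurable borel" "\<And>x. x \<notin> \<Omega> \<Longrightarrow> v x = 0"
    and lim: "AE x in lborel. (\<lambda>n. u n x) \<longlonglongrightarrow> v x"
  shows "v \<in> W" "Mr v \<le> B"
proof -
  note [measurable] = v(1) W_measurable[OF u]
  have B: "0 \<le> B" using le[of 0] Mr_nonneg[of "u 0"] by simp
  have "M v = (\<integral>\<^sup>+z. liminf (\<lambda>n. ennreal (E (D (u n) z))) \<partial>\<kappa>)"
    unfolding M_def
  proof (rule nn_integral_cong_AE)
    show "AE z in \<kappa>. ennreal (E (D v z)) = liminf (\<lambda>n. ennreal (E (D (u n) z)))"
      using AE_diff_quot_tendsto[OF lim]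
    proof eventually_elim
      case (elim z)
      have "isCont E (D v z)" by (rule DERIV_isCont[OF E_deriv])
      from isCont_tendsto_compose[OF this elim]
      have "(\<lambda>n. ennreal (E (D (u n) z))) \<longlonglongrightarrow> ennreal (E (D v z))" by (rule tendsto_ennrealI)
      then show ?case by (rule lim_imp_Liminf[OF sequentially_bot, symmetric])
    qed
  qed
  also have "\<dots> \<le> liminf (\<lambda>n. M (u n))"
    unfolding M_def by (rule nn_integral_liminf) measurable
  also have "\<dots> \<le> liminf (\<lambda>n. ennreal B)"
    using le by (intro Liminf_mono always_eventually allI) (simp add: M_eq_Mr u ennreal_leI)
  finally have *: "M v \<le> ennreal B" by (simp add: Liminf_const)
  then show "v \<in> W" using v by (simp add: W_def order_le_less_trans)
  then show "Mr v \<le> B" using * B by (simp add: M_eq_Mr ennreal_le_iff)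
qed

end

section \<open>Existence of minimisers and their equation\<close>

context singular_problem
begin

lemma I_half_diff:
  assumes "u \<in> W" "v \<in> W"
  shows "I (\<lambda>x. u x - v x) = ennreal 2 * I (\<lambda>x. (u x - v x) / 2)"
proof -
  note [measurable] = W_measurable[OF assms(1)] W_measurable[OF assms(2)]
  have "(\<lambda>x. 2 * ((u x - v x) / 2)) = (\<lambda>x. u x - v x)" by auto
  moreover have "I (\<lambda>x. 2 * ((u x - v x) / 2)) = ennreal \<bar>2\<bar> * I (\<lambda>x. (u x - v x) / 2)"
    by (rule I_cmult) measurable
  ultimately show ?thesis by simp
qed

text \<open>The midpoint of two near-minimisers cannot lie below the infimum, so
  \<open>J_clarkson\<close> makes the energy of half their difference small. A minimising sequence
  is therefore Cauchy for the energy and, by \<open>I_small\<close>, for \<open>I\<close>; Fatou's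
  lemma and \<open>fP_diff_le\<close> carry the infimum over to the limit.\<close>

lemma minimizer_exists:
  assumes \<epsilon>: "0 < \<epsilon>" "\<epsilon> \<le> 1"
  obtains u where "u \<in> W" "\<And>v. v \<in> W \<Longrightarrow> J \<epsilon> u \<le> J \<epsilon> v" "\<And>x. 0 \<le> u x"
proof -
  define b where "b = \<epsilon> powr (- Q) * c_emb"
  define m where "m = Inf (J \<epsilon> ` W)"
  have bdd: "bdd_below (J \<epsilon> ` W)"
  proof (rule bdd_belowI2)
    fix u assume "u \<in> W"
    then show "- (b + b\<^sup>2) \<le> J \<epsilon> u"
      using J_coercive[OF _ \<epsilon>, of u] Mr_nonneg[of u] by (simp add: b_def)
  qed
  have m: "m \<le> J \<epsilon> u" if "u \<in> W" for u
    unfolding m_def using bdd that by (intro cInf_lower) auto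
  have "\<exists>u\<in>W. J \<epsilon> u < m + 1 / real (Suc n)" for n
  proof -
    have "Inf (J \<epsilon> ` W) < m + 1 / real (Suc n)" by (simp add: m_def)
    from cInf_lessD[OF _ this] W_zero show ?thesis by blast
  qed
  then obtain u where u: "\<And>n. u n \<in> W" and Ju: "\<And>n. J \<epsilon> (u n) < m + 1 / real (Suc n)" by metis
  have Mr_half: "Mr (\<lambda>x. (u i x - u j x) / 2) \<le> 1 / real (Suc n)" if "n \<le> i" "n \<le> j" for i j n
  proof -
    have w: "(\<lambda>x. (u i x + u j x) / 2) \<in> W" using W_cmult[OF W_add[OF u u], of "1/2"] by simp
    have "1 / real (Suc i) \<le> 1 / real (Suc n)" "1 / real (Suc j) \<le> 1 / real (Suc n)"
      using that by (auto intro!: divide_left_mono)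
    moreover have "B \<le> c" if "A + B \<le> (X + Y) / 2" "m \<le> A" "X < m + a" "Y < m + b" "a \<le> c" "b \<le> c"
      for A B X Y a b c :: real using that by simp
    ultimately show ?thesis
      using J_clarkson[OF u[of i] u[of j] \<epsilon>] m[OF w] Ju[of i] Ju[of j] by blast
  qed
  have I_cauchy: "\<exists>N. \<forall>i\<ge>N. \<forall>j\<ge>N. I (\<lambda>x. u i x - u j x) \<le> ennreal \<eta>" if "0 < \<eta>" for \<eta>
  proof -
    have "0 < \<eta> / 2" using that by simp
    then obtain \<delta> where \<delta>: "0 < \<delta>" "\<And>u. u \<in> W \<Longrightarrow> Mr u \<le> \<delta> \<Longrightarrow> I u \<le> ennreal (\<eta> / 2)"
      by (rule I_small) (rule that)
    obtain N where N: "1 / real (Suc N) < \<delta>" using nat_approx_posE[OF \<delta>(1)] by blast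
    show ?thesis
    proof (intro exI[of _ N] allI impI)
      fix i j assume "N \<le> i" "N \<le> j"
      then have "Mr (\<lambda>x. (u i x - u j x) / 2) \<le> \<delta>" using Mr_half[of N i j] N by linarith
      then have "I (\<lambda>x. (u i x - u j x) / 2) \<le> ennreal (\<eta> / 2)"
        using W_cmult[OF W_diff[OF u u], of "1/2"] by (intro \<delta>) simp_all
      then have "I (\<lambda>x. u i x - u j x) \<le> ennreal 2 * ennreal (\<eta> / 2)"
        unfolding I_half_diff[OF u u] by (rule mult_left_mono) simp
      also have "\<dots> = ennreal \<eta>" using that by (subst ennreal_mult[symmetric]) auto
      finally show "I (\<lambda>x. u i x - u j x) \<le> ennreal \<eta>" .
    qed
  qed
  let ?s = "\<lambda>n x. (1 + f x) * u n x"
  note um [measurable] = W_measurable[OF u]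
  have si: "integrable lborel (?s n)" for n by (rule I_AE_L1(1)[OF u])
  have "\<exists>N. \<forall>i\<ge>N. \<forall>j\<ge>N. (LINT x|lborel. norm (?s i x - ?s j x)) < e" if "0 < e" for e
  proof -
    obtain N where N: "\<And>i j. N \<le> i \<Longrightarrow> N \<le> j \<Longrightarrow> I (\<lambda>x. u i x - u j x) \<le> ennreal (e / 2)"
      using I_cauchy[of "e / 2"] \<open>0 < e\<close> by auto
    have "(LINT x|lborel. norm (?s i x - ?s j x)) < e" if "N \<le> i" "N \<le> j" for i j
    proof -
      have "ennreal (LINT x|lborel. norm (?s i x - ?s j x)) = (\<integral>\<^sup>+x. ennreal (norm (?s i x - ?s j x)) \<partial>lborel)"
        using si by (intro nn_integral_eq_integral[symmetric]) auto
      also have "\<dots> = I (\<lambda>x. u i x - u j x)"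
        unfolding I_def
      proof (intro nn_integral_cong)
        fix x
        have "norm (?s i x - ?s j x) = (1 + f x) * \<bar>u i x - u j x\<bar>"
          using f_nonneg[of x] by (simp add: right_diff_distrib[symmetric] abs_mult)
        then show "ennreal (norm (?s i x - ?s j x)) = ennreal ((1 + f x) * \<bar>u i x - u j x\<bar>)" by simp
      qed
      also have "\<dots> \<le> ennreal (e / 2)" by (rule N[OF that])
      finally have "(LINT x|lborel. norm (?s i x - ?s j x)) \<le> e / 2"
        using \<open>0 < e\<close> by (subst (asm) ennreal_le_iff) auto
      then show ?thesis using \<open>0 < e\<close> by simp
    qed
    then show ?thesis by blast
  qed
  \<comment> \<open>The products (1 + f) u n are Cauchy in L^1 of Lebesgue measure; dividing by the
    positive weight returns pointwise convergence of u n itself.\<close>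
  from cauchy_L1_AE_cauchy_subseq[OF si this]
  obtain r where r: "strict_mono r" and cau: "AE x in lborel. Cauchy (\<lambda>i. ?s (r i) x)" by blast
  \<comment> \<open>Points of divergence form a null set. Outside \<Omega> the sequence is
    constantly 0, so v vanishes there at every point, as membership in \<open>W\<close>
    demands.\<close>
  define v where "v x = lim (\<lambda>i. u (r i) x)" for x
  have [measurable]: "v \<in> borel_measurable borel" unfolding v_def by measurable
  have v_out: "v x = 0" if "x \<notin> \<Omega>" for x using W_outside[OF u that] by (simp add: v_def)
  have lim: "AE x in lborel. (\<lambda>i. u (r i) x) \<longlonglongrightarrow> v x"
    using cau
  proof eventually_elim
    case (elim x)
    then obtain l where "(\<lambda>i. ?s (r i) x) \<longlonglongrightarrow> l" by (auto simp: Cauchy_convergent_iff convergent_def)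
    then have "(\<lambda>i. inverse (1 + f x) * ?s (r i) x) \<longlonglongrightarrow> inverse (1 + f x) * l" by (intro tendsto_intros)
    moreover have "inverse (1 + f x) * ?s (r i) x = u (r i) x" for i
      using f_nonneg[of x] by (simp add: mult.assoc[symmetric] del: distrib_right_numeral)
    ultimately have "convergent (\<lambda>i. u (r i) x)" by (auto simp: convergent_def)
    then show ?case unfolding v_def by (simp add: convergent_LIMSEQ_iff)
  qed
  have ri: "n \<le> r n" for n by (rule seq_suble[OF r])
  have bound: "Mr (u n) \<le> 2 * (m + 1 + b + b\<^sup>2)" for n
  proof -
    have "1 / real (Suc n) \<le> 1" by simp
    then have "J \<epsilon> (u n) \<le> m + 1" using Ju[of n] by linarith
    then show ?thesis using J_coercive[OF u[of n] \<epsilon>] by (simp add: b_def)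
  qed
  have vW: "v \<in> W" by (rule W_limit(1)[OF u bound _ v_out lim]) simp
  have I_lim: "\<exists>N. \<forall>n\<ge>N. I (\<lambda>x. u (r n) x - v x) \<le> ennreal \<eta>" if "0 < \<eta>" for \<eta>
  proof -
    obtain N where N: "\<And>i j. N \<le> i \<Longrightarrow> N \<le> j \<Longrightarrow> I (\<lambda>x. u i x - u j x) \<le> ennreal \<eta>"
      using I_cauchy[of \<eta>] \<open>0 < \<eta>\<close> by auto
    have "I (\<lambda>x. u (r n) x - v x) \<le> ennreal \<eta>" if "N \<le> n" for n
    proof -
      have "I (\<lambda>x. u (r n) x - v x) = (\<integral>\<^sup>+x. liminf (\<lambda>k. ennreal ((1 + f x) * \<bar>u (r n) x - u (r k) x\<bar>)) \<partial>lborel)"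
        unfolding I_def
      proof (rule nn_integral_cong_AE)
        show "AE x in lborel. ennreal ((1 + f x) * \<bar>u (r n) x - v x\<bar>) = liminf (\<lambda>k. ennreal ((1 + f x) * \<bar>u (r n) x - u (r k) x\<bar>))"
          using lim
        proof eventually_elim
          case (elim x)
          then have "(\<lambda>k. ennreal ((1 + f x) * \<bar>u (r n) x - u (r k) x\<bar>)) \<longlonglongrightarrow> ennreal ((1 + f x) * \<bar>u (r n) x - v x\<bar>)"
            by (intro tendsto_ennrealI tendsto_intros)
          then show ?case by (rule lim_imp_Liminf[OF sequentially_bot, symmetric])
        qed
      qed
      also have "\<dots> \<le> liminf (\<lambda>k. I (\<lambda>x. u (r n) x - u (r k) x))"
        unfolding I_def by (rule nn_integral_liminf) measurable
      also have "\<dots> \<le> liminf (\<lambda>k. ennreal \<eta>)"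
      proof (rule Liminf_mono)
        show "eventually (\<lambda>k. I (\<lambda>x. u (r n) x - u (r k) x) \<le> ennreal \<eta>) sequentially"
          using eventually_ge_at_top[of N]
        proof eventually_elim
          case (elim k)
          show ?case using that elim ri[of n] ri[of k] by (intro N) auto
        qed
      qed
      finally show ?thesis by (simp add: Liminf_const)
    qed
    then show ?thesis by blast
  qed
  have vmin: "J \<epsilon> v \<le> m"
  proof (rule field_le_epsilon)
    fix e :: real assume e: "0 < e"
    define \<eta> where "\<eta> = e / (2 * \<epsilon> powr (- Q))"
    have \<eta>: "0 < \<eta>" "\<epsilon> powr (- Q) * \<eta> = e / 2" using e \<epsilon> by (auto simp: \<eta>_def)
    obtain N where N: "\<And>n. N \<le> n \<Longrightarrow> I (\<lambda>x. u (r n) x - v x) \<le> ennreal \<eta>" using I_lim[OF \<eta>(1)] by blast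
    obtain N' where N': "1 / real (Suc N') < e / 2" using nat_approx_posE[of "e/2"] e by auto
    let ?K = "max N N'"
    let ?A = "\<lambda>w. \<integral>x. f x * P \<epsilon> x (w x) \<partial>lborel"
    have le: "Mr (u (r (n + ?K))) \<le> m + e + ?A v" for n
    proof -
      let ?k = "r (n + ?K)"
      have "\<bar>?A (u ?k) - ?A v\<bar> \<le> e / 2"
        using fP_diff_le[OF u[of ?k] vW \<epsilon> N[of "n + ?K"]] \<eta> by simp
      moreover have "1 / real (Suc ?k) \<le> 1 / real (Suc N')"
        using ri[of "n + ?K"] by (intro divide_left_mono) auto
      ultimately show ?thesis using Ju[of ?k] N' unfolding J_def by linarith
    qed
    have "AE x in lborel. (\<lambda>n. u (r (n + ?K)) x) \<longlonglongrightarrow> v x"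
      using lim by eventually_elim (rule LIMSEQ_ignore_initial_segment)
    from W_limit(2)[OF u le _ v_out this] have "Mr v \<le> m + e + ?A v" by simp
    then show "J \<epsilon> v \<le> m + e" by (simp add: J_def)
  qed
  \<comment> \<open>Taking the positive part does not increase difference quotients and does not
    decrease \<open>P\<close>, so it preserves minimality.\<close>
  let ?w = "\<lambda>x. max (v x) 0"
  have wW: "?w \<in> W" by (rule W_pos[OF vW])
  have "J \<epsilon> ?w \<le> J \<epsilon> v"
    unfolding J_def
  proof (rule diff_mono)
    show "Mr ?w \<le> Mr v" by (intro Mr_mono vW wW D_abs_le) auto
    show "(\<integral>x. f x * P \<epsilon> x (v x) \<partial>lborel) \<le> (\<integral>x. f x * P \<epsilon> x (?w x) \<partial>lborel)"
      using f_nonneg \<epsilon> by (intro integral_mono fP_integrable vW wW mult_left_mono P_mono) auto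
  qed
  then have "J \<epsilon> ?w \<le> m" using vmin by simp
  then show thesis using that[OF wW] m by (meson max.cobounded2 order_trans)
qed

text \<open>The tangent inequalities for \<open>E\<close> and \<open>P\<close> are taken at the
  perturbed point w n, not at u. Minimality then gives the inequality for each n after division by t
  n, and dominated convergence as t n tends to 0 concludes.\<close>

lemma euler_lagrange_ge:
  assumes u: "u \<in> W" and min: "\<And>v. v \<in> W \<Longrightarrow> J \<epsilon> u \<le> J \<epsilon> v" and \<phi>: "\<phi> \<in> W"
    and \<epsilon>: "0 < \<epsilon>" "\<epsilon> \<le> 1"
  shows "(\<integral>x. f x * p \<epsilon> x (u x) * \<phi> x \<partial>lborel) \<le> (\<integral>z. g (D u z) * D \<phi> z \<partial>\<kappa>)"
proof -
  note [measurable] = W_measurable[OF u] W_measurable[OF \<phi>]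
  define t where "t n = 1 / real (Suc n)" for n
  have t: "0 < t n" "t n \<le> 1" for n by (auto simp: t_def)
  define w where "w n x = u x + t n * \<phi> x" for n x
  have wW: "w n \<in> W" for n unfolding w_def by (intro W_add u W_cmult \<phi>)
  note [measurable] = W_measurable[OF wW]
  have Dw: "D (w n) z = D u z + t n * D \<phi> z" for n z
    unfolding w_def by (simp add: D_add D_cmult)
  have t0: "t \<longlonglongrightarrow> 0" unfolding t_def by (intro LIMSEQ_Suc lim_1_over_n)
  have step: "(\<integral>x. f x * p \<epsilon> x (w n x) * \<phi> x \<partial>lborel) \<le> (\<integral>z. g (D (w n) z) * D \<phi> z \<partial>\<kappa>)" for n
  proof -
    let ?A = "\<lambda>v. \<integral>x. f x * P \<epsilon> x (v x) \<partial>lborel"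
    have "Mr (w n) - Mr u = (\<integral>z. E (D (w n) z) - E (D u z) \<partial>\<kappa>)"
      unfolding Mr_def using W_integrable[OF u] W_integrable[OF wW] by simp
    also have "\<dots> \<le> (\<integral>z. t n * (g (D (w n) z) * D \<phi> z) \<partial>\<kappa>)"
    proof (rule integral_mono)
      show "E (D (w n) z) - E (D u z) \<le> t n * (g (D (w n) z) * D \<phi> z)" for z
        using E_tangent[of "D (w n) z" "D u z"] by (simp add: Dw algebra_simps)
    qed (use W_integrable[OF u] W_integrable[OF wW] gD_integrable[OF wW \<phi>] in auto)
    finally have 1: "Mr (w n) - Mr u \<le> t n * (\<integral>z. g (D (w n) z) * D \<phi> z \<partial>\<kappa>)" by simp
    have "t n * (\<integral>x. f x * p \<epsilon> x (w n x) * \<phi> x \<partial>lborel) = (\<integral>x. t n * (f x * p \<epsilon> x (w n x) * \<phi> x) \<partial>lborel)"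
      by simp
    also have "\<dots> \<le> (\<integral>x. f x * P \<epsilon> x (w n x) - f x * P \<epsilon> x (u x) \<partial>lborel)"
    proof (rule integral_mono)
      show "t n * (f x * p \<epsilon> x (w n x) * \<phi> x) \<le> f x * P \<epsilon> x (w n x) - f x * P \<epsilon> x (u x)" for x
      proof -
        have "t n * (p \<epsilon> x (w n x) * \<phi> x) \<le> P \<epsilon> x (w n x) - P \<epsilon> x (u x)"
          using P_tangent[OF \<epsilon>(1), of x "u x" "w n x"] by (simp add: w_def algebra_simps)
        then have "f x * (t n * (p \<epsilon> x (w n x) * \<phi> x)) \<le> f x * (P \<epsilon> x (w n x) - P \<epsilon> x (u x))"
          using f_nonneg[of x] by (intro mult_left_mono)
        then show ?thesis by (simp only: right_diff_distrib mult_ac)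
      qed
    qed (use fP_integrable[OF u \<epsilon>] fP_integrable[OF wW \<epsilon>] fp_integrable[OF _ \<phi> \<epsilon>] in auto)
    also have "\<dots> = ?A (w n) - ?A u" using fP_integrable[OF u \<epsilon>] fP_integrable[OF wW \<epsilon>] by simp
    finally have "t n * (\<integral>x. f x * p \<epsilon> x (w n x) * \<phi> x \<partial>lborel) \<le> t n * (\<integral>z. g (D (w n) z) * D \<phi> z \<partial>\<kappa>)"
      using 1 min[OF wW[of n]] by (simp add: J_def)
    then show ?thesis using t(1)[of n] by simp
  qed
  have lim1: "(\<lambda>n. \<integral>x. f x * p \<epsilon> x (w n x) * \<phi> x \<partial>lborel) \<longlonglongrightarrow> (\<integral>x. f x * p \<epsilon> x (u x) * \<phi> x \<partial>lborel)"
  proof (rule integral_dominated_convergence[where w = "\<lambda>x. \<epsilon> powr (- Q) * (f x * \<bar>\<phi> x\<bar>)"])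
    show "integrable lborel (\<lambda>x. \<epsilon> powr (- Q) * (f x * \<bar>\<phi> x\<bar>))" using I_AE_L1(3)[OF W_abs[OF \<phi>]] by simp
    show "AE x in lborel. (\<lambda>n. f x * p \<epsilon> x (w n x) * \<phi> x) \<longlonglongrightarrow> f x * p \<epsilon> x (u x) * \<phi> x"
    proof (rule AE_I2)
      fix x
      have "(\<lambda>n. w n x) \<longlonglongrightarrow> u x + 0 * \<phi> x" unfolding w_def by (intro tendsto_intros t0)
      then have "(\<lambda>n. p \<epsilon> x (w n x)) \<longlonglongrightarrow> p \<epsilon> x (u x)"
        unfolding p_def using \<epsilon>(1) by (intro tendsto_intros) (auto simp: max_def)
      then show "(\<lambda>n. f x * p \<epsilon> x (w n x) * \<phi> x) \<longlonglongrightarrow> f x * p \<epsilon> x (u x) * \<phi> x" by (intro tendsto_intros)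
    qed
    show "AE x in lborel. norm (f x * p \<epsilon> x (w n x) * \<phi> x) \<le> \<epsilon> powr (- Q) * (f x * \<bar>\<phi> x\<bar>)" for n
    proof (rule AE_I2)
      fix x
      have "p \<epsilon> x (w n x) * (f x * \<bar>\<phi> x\<bar>) \<le> \<epsilon> powr (- Q) * (f x * \<bar>\<phi> x\<bar>)"
        using p_le[OF \<epsilon>] f_nonneg[of x] by (intro mult_right_mono) auto
      then show "norm (f x * p \<epsilon> x (w n x) * \<phi> x) \<le> \<epsilon> powr (- Q) * (f x * \<bar>\<phi> x\<bar>)"
        using f_nonneg[of x] p_pos[OF \<epsilon>(1), of x "w n x"] by (simp add: abs_mult algebra_simps)
    qed
  qed measurable
  obtain K where "0 < K" and K: "\<And>a b. \<bar>g a * b\<bar> \<le> 1 * E a + K * E b"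
    by (rule young_split[OF zero_less_one]) (rule that)
  have lim2: "(\<lambda>n. \<integral>z. g (D (w n) z) * D \<phi> z \<partial>\<kappa>) \<longlonglongrightarrow> (\<integral>z. g (D u z) * D \<phi> z \<partial>\<kappa>)"
  proof (rule integral_dominated_convergence[where w = "\<lambda>z. 2 * C * (E (D u z) + E (D \<phi> z)) + K * E (D \<phi> z)"])
    show "integrable \<kappa> (\<lambda>z. 2 * C * (E (D u z) + E (D \<phi> z)) + K * E (D \<phi> z))"
      using W_integrable[OF u] W_integrable[OF \<phi>] by simp
    show "AE z in \<kappa>. (\<lambda>n. g (D (w n) z) * D \<phi> z) \<longlonglongrightarrow> g (D u z) * D \<phi> z"
    proof (rule AE_I2)
      fix z
      have "(\<lambda>n. D (w n) z) \<longlonglongrightarrow> D u z + 0 * D \<phi> z" unfolding Dw by (intro tendsto_intros t0)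
      then have "(\<lambda>n. D (w n) z) \<longlonglongrightarrow> D u z" by simp
      from isCont_tendsto_compose[OF cont this]
      show "(\<lambda>n. g (D (w n) z) * D \<phi> z) \<longlonglongrightarrow> g (D u z) * D \<phi> z" by (intro tendsto_intros)
    qed
    show "AE z in \<kappa>. norm (g (D (w n) z) * D \<phi> z) \<le> 2 * C * (E (D u z) + E (D \<phi> z)) + K * E (D \<phi> z)" for n
    proof (rule AE_I2)
      fix z
      have "\<bar>D (w n) z\<bar> \<le> \<bar>D u z\<bar> + \<bar>t n * D \<phi> z\<bar>" unfolding Dw by (rule abs_triangle_ineq)
      also have "\<bar>t n * D \<phi> z\<bar> \<le> \<bar>D \<phi> z\<bar>" using t[of n] by (simp add: abs_mult mult_left_le_one_le)
      finally have "E (D (w n) z) \<le> E (\<bar>D u z\<bar> + \<bar>D \<phi> z\<bar>)" by (intro E_mono) auto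
      also have "\<dots> \<le> 2 * C * (E (D u z) + E (D \<phi> z))" by (rule E_add_le)
      finally show "norm (g (D (w n) z) * D \<phi> z) \<le> 2 * C * (E (D u z) + E (D \<phi> z)) + K * E (D \<phi> z)"
        using K[of "D (w n) z" "D \<phi> z"] by simp
    qed
  qed measurable
  show ?thesis by (rule LIMSEQ_le[OF lim1 lim2]) (use step in auto)
qed

lemma euler_lagrange:
  assumes u: "u \<in> W" and min: "\<And>v. v \<in> W \<Longrightarrow> J \<epsilon> u \<le> J \<epsilon> v" and \<phi>: "\<phi> \<in> W"
    and \<epsilon>: "0 < \<epsilon>" "\<epsilon> \<le> 1"
  shows "(\<integral>z. g (D u z) * D \<phi> z \<partial>\<kappa>) = (\<integral>x. f x * p \<epsilon> x (u x) * \<phi> x \<partial>lborel)"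
proof (rule antisym)
  have \<psi>: "(\<lambda>x. (-1) * \<phi> x) \<in> W" by (rule W_cmult[OF \<phi>])
  have "- (\<integral>x. f x * p \<epsilon> x (u x) * \<phi> x \<partial>lborel) \<le> - (\<integral>z. g (D u z) * D \<phi> z \<partial>\<kappa>)"
    using euler_lagrange_ge[OF u min \<psi> \<epsilon>] by (simp only: D_cmult) simp
  then show "(\<integral>z. g (D u z) * D \<phi> z \<partial>\<kappa>) \<le> (\<integral>x. f x * p \<epsilon> x (u x) * \<phi> x \<partial>lborel)" by simp
qed (rule euler_lagrange_ge[OF assms])

end

section \<open>Comparison\<close>

context nonlocal_domain
begin

lemma dom_measurable [measurable]: "\<Omega> \<in> sets borel"
  using open_dom by simp

lemma dom_emeasure_finite: "emeasure lborel \<Omega> < \<infinity>"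
  using emeasure_bounded_finite[OF bounded_dom] by simp

text \<open>For \<bar>x - y\<bar> \<le> 1 the quotient is at most L \<bar>x - y\<bar>^(1 - s), for
  larger distances 2 B \<bar>x - y\<bar>^(-s), and \<open>E_scale\<close> squares these powers; both
  resulting kernels are integrable. A pair contributes only if one of its points lies in \<Omega>,
  which has finite measure.\<close>

lemma W_lipschitz:
  fixes \<phi> :: "'a \<Rightarrow> real"
  assumes lip: "\<And>x y. \<bar>\<phi> x - \<phi> y\<bar> \<le> L * norm (x - y)" and out: "\<And>x. x \<notin> \<Omega> \<Longrightarrow> \<phi> x = 0"
  shows "\<phi> \<in> W"
proof -
  have "0 \<le> L"
  proof -
    obtain b :: 'a where "b \<in> Basis" using nonempty_Basis by blast
    then show ?thesis using lip[of b 0] by simp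
  qed
  then have "L-lipschitz_on UNIV \<phi>"
    using lip by (intro lipschitz_onI) (auto simp: dist_norm)
  then have [measurable]: "\<phi> \<in> borel_measurable borel"
    by (intro borel_measurable_continuous_onI lipschitz_on_continuous_on)
  obtain R where R: "0 < R" "\<And>x. x \<in> \<Omega> \<Longrightarrow> norm x < R"
    using bounded_dom by (meson bounded_pos_less)
  obtain b :: 'a where b: "b \<in> Basis" using nonempty_Basis by blast
  \<comment> \<open>A point at distance R from the origin, hence outside \<Omega>, where \<phi>
    vanishes; the Lipschitz bound against it gives a uniform bound on \<phi>.\<close>
  define y where "y = R *\<^sub>R b"
  have y: "norm y = R" using R b by (simp add: y_def)
  define B where "B = L * (2 * R)"
  have B: "\<bar>\<phi> x\<bar> \<le> B" for x
  proof (cases "x \<in> \<Omega>")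
    case True
    have "y \<notin> \<Omega>" using R(2)[of y] y by auto
    then have "\<bar>\<phi> x\<bar> \<le> L * norm (x - y)" using lip[of x y] out by simp
    also have "\<dots> \<le> B" unfolding B_def using R(2)[OF True] y norm_triangle_ineq4[of x y] \<open>0 \<le> L\<close>
      by (intro mult_left_mono) auto
    finally show ?thesis .
  qed (use out R \<open>0 \<le> L\<close> in \<open>simp add: B_def\<close>)
  define k where "k z = ennreal (E L) * (ennreal (norm (z::'a) powr (2 * (1 - s) - DIM('a))) * indicator (cball 0 1) z)
     + ennreal (E (2 * B)) * (ennreal (norm z powr (- (2 * s) - DIM('a))) * indicator (- cball 0 1) z)" for z
  have [measurable]: "cball (0::'a) 1 \<in> sets borel" "- cball (0::'a) 1 \<in> sets borel" by auto
  have [measurable]: "k \<in> borel_measurable borel" unfolding k_def by measurable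
  have k_fin: "(\<integral>\<^sup>+z. k z \<partial>lborel) < \<infinity>"
    unfolding k_def using near_kernel_finite[of "2 * (1 - s)", where 'a = 'a] far_kernel_finite[of "2 * s", where 'a = 'a] s s1
    by (simp add: nn_integral_add nn_integral_cmult ennreal_mult_less_top)
  have alg: "1 / r ^ DIM('a) * ((r powr a)\<^sup>2 * e) = e * r powr (2 * a - DIM('a))" if "0 < r" for r a e :: real
  proof -
    have "(r powr a)\<^sup>2 = r powr (2 * a)" by (simp add: power2_eq_square powr_add[symmetric])
    then show ?thesis using that by (simp add: powr_diff powr_realpow)
  qed
  have pw: "ennreal (1 / norm (x - y) ^ DIM('a)) * ennreal (E (D \<phi> (x, y))) \<le> indicator \<Omega> x * k (x - y) + indicator \<Omega> y * k (x - y)" for x y :: 'a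
  proof (cases "x = y \<or> (x \<notin> \<Omega> \<and> y \<notin> \<Omega>)")
    case True
    then have "D \<phi> (x, y) = 0" using out by (auto simp: diff_quot_def)
    then show ?thesis by simp
  next
    case False
    then have n: "0 < norm (x - y)" and xy: "x \<in> \<Omega> \<or> y \<in> \<Omega>" by auto
    have "ennreal (1 / norm (x - y) ^ DIM('a)) * ennreal (E (D \<phi> (x, y))) = ennreal (1 / norm (x - y) ^ DIM('a) * E (D \<phi> (x, y)))"
      by (intro ennreal_mult[symmetric]) (auto simp: E_nonneg)
    also have "\<dots> \<le> k (x - y)"
    proof (cases "norm (x - y) \<le> 1")
      case True
      let ?c = "norm (x - y) powr (1 - s)"
      have c: "0 \<le> ?c" "?c \<le> 1" using True n s1 by (auto intro: powr_le1)
      have "\<bar>D \<phi> (x, y)\<bar> \<le> ?c * L"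
        using lip[of x y] n by (simp add: diff_quot_def divide_le_eq powr_diff mult.commute)
      then have "E (D \<phi> (x, y)) \<le> E (?c * L)" by (intro E_mono) auto
      also have "\<dots> \<le> ?c\<^sup>2 * E L" using c by (rule E_scale)
      finally have "1 / norm (x - y) ^ DIM('a) * E (D \<phi> (x, y)) \<le> 1 / norm (x - y) ^ DIM('a) * (?c\<^sup>2 * E L)"
        by (intro mult_left_mono) auto
      also have "\<dots> = E L * norm (x - y) powr (2 * (1 - s) - DIM('a))"
        by (rule alg[OF n])
      finally show ?thesis using True E_nonneg[of L] by (simp add: k_def ennreal_mult[symmetric] ennreal_leI)
    next
      case False
      let ?c = "norm (x - y) powr (- s)"
      have c: "0 \<le> ?c" "?c \<le> 1" using False s powr_mono[of "-s" 0 "norm (x - y)"] n by (auto split: if_splits)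
      have "\<bar>\<phi> x - \<phi> y\<bar> \<le> 2 * B" using B[of x] B[of y] by linarith
      then have "\<bar>D \<phi> (x, y)\<bar> \<le> ?c * (2 * B)"
        using n by (simp add: diff_quot_def divide_le_eq powr_minus field_simps)
      then have "E (D \<phi> (x, y)) \<le> E (?c * (2 * B))" by (intro E_mono) auto
      also have "\<dots> \<le> ?c\<^sup>2 * E (2 * B)" using c by (rule E_scale)
      finally have "1 / norm (x - y) ^ DIM('a) * E (D \<phi> (x, y)) \<le> 1 / norm (x - y) ^ DIM('a) * (?c\<^sup>2 * E (2 * B))"
        by (intro mult_left_mono) auto
      also have "\<dots> = E (2 * B) * norm (x - y) powr (- (2 * s) - DIM('a))"
        using alg[OF n, of "- s"] by simp
      finally show ?thesis using False E_nonneg[of "2 * B"] by (simp add: k_def ennreal_mult[symmetric] ennreal_leI)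
    qed
    also have "\<dots> \<le> indicator \<Omega> x * k (x - y) + indicator \<Omega> y * k (x - y)"
      using xy by (auto simp: indicator_def)
    finally show ?thesis .
  qed
  have mk: "(\<lambda>z. k (fst z - snd z)) \<in> borel_measurable (lborel \<Otimes>\<^sub>M lborel)" by measurable
  have "M \<phi> = (\<integral>\<^sup>+x. \<integral>\<^sup>+y. ennreal (1 / norm (x - y) ^ DIM('a)) * ennreal (E (D \<phi> (x, y))) \<partial>lborel \<partial>lborel)"
    unfolding M_def by (rule nn_integral_sing(2)) measurable
  also have "\<dots> \<le> (\<integral>\<^sup>+x. \<integral>\<^sup>+y. indicator \<Omega> x * k (x - y) + indicator \<Omega> y * k (x - y) \<partial>lborel \<partial>lborel)"
    by (intro nn_integral_mono pw)
  also have "\<dots> = (\<integral>\<^sup>+x. indicator \<Omega> x * (\<integral>\<^sup>+y. k (x - y) \<partial>lborel) + (\<integral>\<^sup>+y. indicator \<Omega> y * k (x - y) \<partial>lborel) \<partial>lborel)"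
    by (intro nn_integral_cong) (simp add: nn_integral_add nn_integral_cmult)
  also have "\<dots> = (\<integral>\<^sup>+x. indicator \<Omega> x * (\<integral>\<^sup>+y. k (x - y) \<partial>lborel) \<partial>lborel) + (\<integral>\<^sup>+x. \<integral>\<^sup>+y. indicator \<Omega> y * k (x - y) \<partial>lborel \<partial>lborel)"
    using mk by (intro nn_integral_add) (auto intro!: borel_measurable_times_ennreal lborel.borel_measurable_nn_integral simp: split_beta')
  also have "(\<integral>\<^sup>+x. \<integral>\<^sup>+y. indicator \<Omega> y * k (x - y) \<partial>lborel \<partial>lborel) = (\<integral>\<^sup>+y. \<integral>\<^sup>+x. indicator \<Omega> y * k (x - y) \<partial>lborel \<partial>lborel)"
    using mk by (intro lborel_pair.Fubini'[symmetric]) (auto simp: split_beta')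
  also have "\<dots> = (\<integral>\<^sup>+y. indicator \<Omega> y * (\<integral>\<^sup>+x. k (x - y) \<partial>lborel) \<partial>lborel)"
    by (intro nn_integral_cong nn_integral_cmult) measurable
  also have "(\<integral>\<^sup>+x. indicator \<Omega> x * (\<integral>\<^sup>+y. k (x - y) \<partial>lborel) \<partial>lborel) = (\<integral>\<^sup>+x. (\<integral>\<^sup>+y. k y \<partial>lborel) * indicator \<Omega> x \<partial>lborel)"
    by (intro nn_integral_cong) (simp add: nn_integral_lborel_translate(2) mult.commute)
  also have "(\<integral>\<^sup>+y. indicator \<Omega> y * (\<integral>\<^sup>+x. k (x - y) \<partial>lborel) \<partial>lborel) = (\<integral>\<^sup>+x. (\<integral>\<^sup>+y. k y \<partial>lborel) * indicator \<Omega> x \<partial>lborel)"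
  proof (intro nn_integral_cong)
    fix y
    have "(\<integral>\<^sup>+x. k (x - y) \<partial>lborel) = (\<integral>\<^sup>+x. k x \<partial>lborel)"
      using nn_integral_lborel_translate(1)[of k "- y"] by simp
    then show "indicator \<Omega> y * (\<integral>\<^sup>+x. k (x - y) \<partial>lborel) = (\<integral>\<^sup>+y. k y \<partial>lborel) * indicator \<Omega> y"
      by (simp add: mult.commute)
  qed
  also have "(\<integral>\<^sup>+x. (\<integral>\<^sup>+y. k y \<partial>lborel) * indicator \<Omega> x \<partial>lborel) = (\<integral>\<^sup>+y. k y \<partial>lborel) * emeasure lborel \<Omega>"
    by (subst nn_integral_cmult_indicator) auto
  finally have "M \<phi> < \<infinity>"
    using k_fin dom_emeasure_finite by (simp add: order_le_less_trans ennreal_mult_less_top)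
  then show ?thesis using out by (simp add: W_def)
qed

end

section \<open>Regularised solutions and their order\<close>

context singular_problem
begin

definition is_sol :: "real \<Rightarrow> ('a \<Rightarrow> real) \<Rightarrow> bool" where
  "is_sol \<epsilon> u \<longleftrightarrow> u \<in> W \<and> (\<forall>x. 0 \<le> u x) \<and>
     (\<forall>\<phi>\<in>W. (\<integral>z. g (D u z) * D \<phi> z \<partial>\<kappa>) = (\<integral>x. f x * p \<epsilon> x (u x) * \<phi> x \<partial>lborel))"

lemma sol_exists:
  assumes "0 < \<epsilon>" "\<epsilon> \<le> 1"
  shows "\<exists>u. is_sol \<epsilon> u"
proof -
  obtain u where u: "u \<in> W" "\<And>v. v \<in> W \<Longrightarrow> J \<epsilon> u \<le> J \<epsilon> v" "\<And>x. 0 \<le> u x"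
    by (rule minimizer_exists[OF assms]) (rule that)
  then have "is_sol \<epsilon> u" unfolding is_sol_def using euler_lagrange[OF u(1,2) _ assms] by blast
  then show ?thesis by blast
qed

text \<open>If the positive part of v - u differs at two points, then v - u differs there in the
  same direction. So D\<phi> is either 0 or has the sign of Dv - Du, and strict monotonicity of g
  makes the product vanish only when D\<phi> does.\<close>

lemma pos_part_monotone:
  fixes v u :: "'a \<Rightarrow> real"
  defines "\<phi> \<equiv> \<lambda>x. max (v x - u x) 0"
  shows "0 \<le> (g (D v z) - g (D u z)) * D \<phi> z" "(g (D v z) - g (D u z)) * D \<phi> z = 0 \<Longrightarrow> D \<phi> z = 0"
proof -
  obtain x y where z: "z = (x, y)" by (cases z)
  have "D \<phi> z < 0 \<and> D v z < D u z \<or> D \<phi> z = 0 \<or> 0 < D \<phi> z \<and> D u z < D v z"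
  proof (cases "x = y")
    case False
    then have n: "0 < norm (x - y) powr s" by simp
    have "\<phi> x < \<phi> y \<and> v x - v y < u x - u y \<or> \<phi> x = \<phi> y \<or> \<phi> y < \<phi> x \<and> u x - u y < v x - v y"
      unfolding \<phi>_def by linarith
    then show ?thesis using n by (auto simp: diff_quot_def z divide_strict_right_mono divide_neg_pos)
  qed (simp add: diff_quot_def z)
  then have "D \<phi> z = 0 \<or> 0 < (g (D v z) - g (D u z)) * D \<phi> z"
    using g_strict[of "D v z" "D u z"] g_strict[of "D u z" "D v z"] by (auto intro: mult_neg_neg)
  then show "0 \<le> (g (D v z) - g (D u z)) * D \<phi> z" "(g (D v z) - g (D u z)) * D \<phi> z = 0 \<Longrightarrow> D \<phi> z = 0"
    by auto
qed

text \<open>Both equations are tested with the positive part of v - u. Where v > u, the larger value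
  and the larger shift \<epsilon>' make the right-hand side of v the smaller one, so the monotone
  left side is at most 0 and the test function has zero energy.\<close>

lemma comparison:
  assumes \<epsilon>: "0 < \<epsilon>" "\<epsilon> \<le> \<epsilon>'" "\<epsilon>' \<le> 1" and u: "is_sol \<epsilon> u" and v: "is_sol \<epsilon>' v"
  shows "AE x in lborel. v x \<le> u x"
proof -
  have uW: "u \<in> W" and vW: "v \<in> W" using u v by (auto simp: is_sol_def)
  note [measurable] = W_measurable[OF uW] W_measurable[OF vW]
  define \<phi> where "\<phi> x = max (v x - u x) 0" for x
  have \<phi>W: "\<phi> \<in> W" unfolding \<phi>_def by (intro W_pos W_diff uW vW)
  note [measurable] = W_measurable[OF \<phi>W]
  have e1: "0 < \<epsilon>'" "\<epsilon> \<le> 1" using \<epsilon> by auto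
  let ?G = "\<lambda>z. (g (D v z) - g (D u z)) * D \<phi> z"
  have int: "integrable \<kappa> ?G"
    using gD_integrable[OF vW \<phi>W] gD_integrable[OF uW \<phi>W] by (simp add: left_diff_distrib)
  have "(\<integral>z. ?G z \<partial>\<kappa>) = (\<integral>z. g (D v z) * D \<phi> z \<partial>\<kappa>) - (\<integral>z. g (D u z) * D \<phi> z \<partial>\<kappa>)"
    using gD_integrable[OF vW \<phi>W] gD_integrable[OF uW \<phi>W] by (simp add: left_diff_distrib)
  also have "\<dots> = (\<integral>x. f x * p \<epsilon>' x (v x) * \<phi> x \<partial>lborel) - (\<integral>x. f x * p \<epsilon> x (u x) * \<phi> x \<partial>lborel)"
    using u v \<phi>W by (simp add: is_sol_def)
  also have "\<dots> \<le> 0"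
  proof -
    have "(\<integral>x. f x * p \<epsilon>' x (v x) * \<phi> x \<partial>lborel) \<le> (\<integral>x. f x * p \<epsilon> x (u x) * \<phi> x \<partial>lborel)"
    proof (rule integral_mono)
      show "f x * p \<epsilon>' x (v x) * \<phi> x \<le> f x * p \<epsilon> x (u x) * \<phi> x" for x
      proof (cases "u x < v x")
        case True
        have "0 \<le> u x" using u by (simp add: is_sol_def)
        then have "p \<epsilon>' x (v x) \<le> p \<epsilon> x (u x)"
          unfolding p_def using True \<epsilon> q_nonneg[of x] by (intro powr_mono2') auto
        then show ?thesis using f_nonneg[of x] by (intro mult_right_mono mult_left_mono) (auto simp: \<phi>_def)
      qed (simp add: \<phi>_def)
    qed (use fp_integrable[OF _ \<phi>W] \<epsilon> e1 in auto)
    then show ?thesis by simp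
  qed
  finally have "(\<integral>z. ?G z \<partial>\<kappa>) \<le> 0" .
  moreover have G0: "0 \<le> ?G z" for z
    using pos_part_monotone(1)[where v = v and u = u] by (simp add: \<phi>_def[abs_def])
  ultimately have "(\<integral>z. ?G z \<partial>\<kappa>) = 0"
    using Bochner_Integration.integral_nonneg[of \<kappa> ?G] by (intro antisym) auto
  then have "AE z in \<kappa>. ?G z = 0"
    using int G0 by (subst (asm) integral_nonneg_eq_0_iff_AE) auto
  then have "AE z in \<kappa>. E (D \<phi> z) = 0"
  proof eventually_elim
    case (elim z)
    then have "D \<phi> z = 0" using pos_part_monotone(2)[where v = v and u = u and z = z] by (simp add: \<phi>_def[abs_def])
    then show ?case by simp
  qed
  then have "Mr \<phi> = 0" unfolding Mr_def by (intro integral_eq_zero_AE)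
  from Mr_0_imp[OF \<phi>W this] show ?thesis
    by eventually_elim (auto simp: \<phi>_def max_def split: if_splits)
qed

end

section \<open>Positivity on compact sets\<close>

lemma integral_lborel_translate:
  fixes h :: "'a::euclidean_space \<Rightarrow> real"
  assumes "h \<in> borel_measurable borel"
  shows "(\<integral>x. h (a + x) \<partial>lborel) = (\<integral>x. h x \<partial>lborel)"
    and "integrable lborel (\<lambda>x. h (a + x)) \<longleftrightarrow> integrable lborel h"
proof -
  show "(\<integral>x. h (a + x) \<partial>lborel) = (\<integral>x. h x \<partial>lborel)"
    using integral_distr[of "(+) a" lborel borel h] assms by (simp add: lborel_distr_plus)
  show "integrable lborel (\<lambda>x. h (a + x)) \<longleftrightarrow> integrable lborel h"
    using integrable_distr_eq[of "(+) a" lborel borel h] assms by (simp add: lborel_distr_plus)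
qed

context nonlocal_domain
begin

text \<open>Substituting \<open>y = x + z\<close> and translating in \<open>x\<close> for fixed \<open>z\<close> turns the energy form into a
  second difference of \<open>\<psi>\<close>, so no principal value is needed and only an upper bound on second
  differences enters.\<close>

lemma semiconvex_form_le:
  fixes \<psi> :: "'a \<Rightarrow> real"
  assumes \<psi>01: "\<And>x. 0 \<le> \<psi> x" "\<And>x. \<psi> x \<le> 1" and out: "\<And>x. x \<notin> \<Omega> \<Longrightarrow> \<psi> x = 0"
    and lip: "\<And>x y. \<bar>\<psi> x - \<psi> y\<bar> \<le> L * norm (x - y)" and L: "0 \<le> L"
    and semi: "\<And>x z. 2 * \<psi> x - \<psi> (x + z) - \<psi> (x - z) \<le> A * (norm z)\<^sup>2" and A: "0 \<le> A"
  obtains K where "0 \<le> K"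
    "\<And>c \<phi>. 0 < c \<Longrightarrow> c \<le> 1 \<Longrightarrow> \<phi> \<in> W \<Longrightarrow> (\<And>x. 0 \<le> \<phi> x) \<Longrightarrow> integrable lborel \<phi> \<Longrightarrow>
      (\<integral>z. g (D (\<lambda>x. c * \<psi> x) z) * D \<phi> z \<partial>\<kappa>) \<le> c * K * (\<integral>x. \<phi> x \<partial>lborel)"
proof -
  obtain Lg where Lg: "0 \<le> Lg" "\<And>a b. \<bar>a\<bar> \<le> L \<Longrightarrow> \<bar>b\<bar> \<le> L \<Longrightarrow> b \<le> a \<Longrightarrow> g a - g b \<le> Lg * (a - b)"
    using g_lipschitz[of L] by blast
  have [measurable]: "cball (0::'a) 1 \<in> sets borel" "- cball (0::'a) 1 \<in> sets borel" by auto
  define k1 where "k1 z = norm (z::'a) powr (2 * (1 - s) - DIM('a)) * indicator (cball 0 1) z" for z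
  define k2 where "k2 z = norm (z::'a) powr (- s - DIM('a)) * indicator (- cball 0 1) z" for z
  have k1: "integrable lborel k1"
    using near_kernel_finite[of "2 * (1 - s)", where 'a = 'a] s1 unfolding k1_def
    by (intro integrableI_nonneg) (auto simp: ennreal_mult ennreal_indicator)
  have k2: "integrable lborel k2"
    using far_kernel_finite[of s, where 'a = 'a] s unfolding k2_def
    by (intro integrableI_nonneg) (auto simp: ennreal_mult ennreal_indicator)
  \<comment> \<open>Near the origin the local Lipschitz constant of g meets the second-difference
    bound A; far away g is bounded by its values on [-1, 1]. Neither constant depends on c.\<close>
  define K3 where "K3 z = Lg * A * k1 z + 2 * g 1 * k2 z" for z
  have K3: "integrable lborel K3" unfolding K3_def using k1 k2 by simp
  have K3_nonneg: "0 \<le> K3 z" for z using Lg A g_nonneg[of 1] by (simp add: K3_def k1_def k2_def)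
  show thesis
  proof (rule that[of "\<integral>z. K3 z \<partial>lborel"])
    show "0 \<le> (\<integral>z. K3 z \<partial>lborel)" using K3_nonneg by simp
    fix c :: real and \<phi> :: "'a \<Rightarrow> real"
    assume c: "0 < c" "c \<le> 1" and \<phi>W: "\<phi> \<in> W" and \<phi>0: "\<And>x. 0 \<le> \<phi> x" and \<phi>i: "integrable lborel \<phi>"
    define \<Phi>' where "\<Phi>' x = c * \<psi> x" for x
    have \<Phi>W: "\<Phi>' \<in> W" unfolding \<Phi>'_def by (intro W_cmult W_lipschitz[OF lip out])
    note m [measurable] = W_measurable[OF \<phi>W] W_measurable[OF \<Phi>W]
    define F where "F w = 1 / norm (fst w - snd w) ^ DIM('a) * (g (D \<Phi>' w) * D \<phi> w)" for w
    have Fm [measurable]: "F \<in> borel_measurable borel" unfolding F_def by measurable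
    have gm: "(\<lambda>w. g (D \<Phi>' w) * D \<phi> w) \<in> borel_measurable lborel" by measurable
    have Fi: "integrable lborel F"
      using gD_integrable[OF \<Phi>W \<phi>W] gm unfolding sing_measure_def F_def
      by (subst (asm) integrable_density) auto
    have Fint: "(\<integral>z. g (D \<Phi>' z) * D \<phi> z \<partial>\<kappa>) = (\<integral>w. F w \<partial>lborel)"
      using gm unfolding sing_measure_def F_def by (subst integral_density) auto
    have Fpi: "integrable (lborel \<Otimes>\<^sub>M lborel) F" using Fi by (simp add: lborel_prod)
    have Fpm: "F \<in> borel_measurable (lborel \<Otimes>\<^sub>M lborel)" using Fm by (simp add: lborel_prod)
    \<comment> \<open>Pairs are described by base point and displacement z. Joint integrability is
      checked before the order of integration is exchanged.\<close>
    let ?T = "\<lambda>(x, z). F (x, x + z)"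
    have Tm: "?T \<in> borel_measurable (lborel \<Otimes>\<^sub>M lborel)"
    proof -
      have "(\<lambda>w. (fst w, fst w + snd w) :: 'a \<times> 'a) \<in> borel \<Otimes>\<^sub>M borel \<rightarrow>\<^sub>M borel \<Otimes>\<^sub>M borel"
        by measurable
      then have 1: "(\<lambda>w. F (fst w, fst w + snd w)) \<in> borel_measurable (borel \<Otimes>\<^sub>M borel)"
        using measurable_compose[OF _ Fm[unfolded borel_prod[symmetric]]] by blast
      have 2: "sets (lborel \<Otimes>\<^sub>M lborel) = sets (borel \<Otimes>\<^sub>M borel :: ('a \<times> 'a) measure)"
        by (intro sets_pair_measure_cong) auto
      show ?thesis
        using 1 unfolding split_beta' measurable_cong_sets[OF 2 refl] .
    qed
    have Ti: "integrable (lborel \<Otimes>\<^sub>M lborel) ?T"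
    proof (rule integrableI_bounded[OF Tm])
      have "(\<integral>\<^sup>+w. ennreal (norm (?T w)) \<partial>(lborel \<Otimes>\<^sub>M lborel)) = (\<integral>\<^sup>+x. \<integral>\<^sup>+z. ennreal (norm (F (x, x + z))) \<partial>lborel \<partial>lborel)"
        using Tm by (subst lborel.nn_integral_fst[symmetric]) auto
      also have "\<dots> = (\<integral>\<^sup>+x. \<integral>\<^sup>+y. ennreal (norm (F (x, y))) \<partial>lborel \<partial>lborel)"
      proof (rule nn_integral_cong)
        fix x
        have "(\<lambda>y. F (x, y)) \<in> borel_measurable borel"
          using measurable_Pair2[OF Fpm, of x] by simp
        then show "(\<integral>\<^sup>+z. ennreal (norm (F (x, x + z))) \<partial>lborel) = (\<integral>\<^sup>+y. ennreal (norm (F (x, y))) \<partial>lborel)"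
          using nn_integral_lborel_translate(1)[of "\<lambda>y. ennreal (norm (F (x, y)))" x] by simp
      qed
      also have "\<dots> = (\<integral>\<^sup>+w. ennreal (norm (F w)) \<partial>(lborel \<Otimes>\<^sub>M lborel))"
        using Fpm by (subst lborel.nn_integral_fst[symmetric]) auto
      also have "\<dots> < \<infinity>" using Fpi by (simp add: integrable_iff_bounded)
      finally show "(\<integral>\<^sup>+w. ennreal (norm (?T w)) \<partial>(lborel \<Otimes>\<^sub>M lborel)) < \<infinity>" .
    qed
    have "(\<integral>w. F w \<partial>lborel) = (\<integral>x. (\<integral>y. F (x, y) \<partial>lborel) \<partial>lborel)"
      using lborel_pair.integral_fst'[OF Fpi] by (simp add: lborel_prod)
    also have "\<dots> = (\<integral>x. (\<integral>z. F (x, x + z) \<partial>lborel) \<partial>lborel)"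
    proof (rule Bochner_Integration.integral_cong[OF refl])
      fix x
      have "(\<lambda>y. F (x, y)) \<in> borel_measurable borel"
        using measurable_Pair2[OF Fpm, of x] by simp
      then show "(\<integral>y. F (x, y) \<partial>lborel) = (\<integral>z. F (x, x + z) \<partial>lborel)"
        using integral_lborel_translate(1)[of "\<lambda>y. F (x, y)" x] by simp
    qed
    also have "\<dots> = (\<integral>z. (\<integral>x. F (x, x + z) \<partial>lborel) \<partial>lborel)"
      using lborel_pair.Fubini_integral[OF Ti] by simp
    also have "\<dots> \<le> (\<integral>z. c * K3 z * (\<integral>x. \<phi> x \<partial>lborel) \<partial>lborel)"
    proof (rule integral_mono_AE)
      show "integrable lborel (\<lambda>z. \<integral>x. F (x, x + z) \<partial>lborel)"
        using lborel_pair.integrable_snd[OF Ti] by simp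
      show "integrable lborel (\<lambda>z. c * K3 z * (\<integral>x. \<phi> x \<partial>lborel))" using K3 by simp
      show "AE z in lborel. (\<integral>x. F (x, x + z) \<partial>lborel) \<le> c * K3 z * (\<integral>x. \<phi> x \<partial>lborel)"
        using AE_lborel_singleton[of 0]
      proof eventually_elim
        case (elim z)
        then have n: "0 < norm z" by simp
        define G where "G x = g ((\<Phi>' x - \<Phi>' (x + z)) / norm z powr s)" for x
        have [measurable]: "G \<in> borel_measurable borel" unfolding G_def by measurable
        have \<Phi>d: "\<bar>\<Phi>' x - \<Phi>' y\<bar> \<le> c" for x y
          using \<psi>01[of x] \<psi>01[of y] c by (simp add: \<Phi>'_def right_diff_distrib[symmetric] abs_mult mult_left_le)
        have Gb: "\<bar>G x\<bar> \<le> g (c / norm z powr s)" for x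
          unfolding G_def g_abs[symmetric] using n \<Phi>d by (intro g_mono) (simp add: divide_right_mono)
        have Gb': "norm (G y * \<phi> x) \<le> norm (g (c / norm z powr s) * \<phi> x)" for x y
          unfolding real_norm_def abs_mult
          by (intro mult_right_mono order_trans[OF Gb abs_ge_self]) auto
        have i1: "integrable lborel (\<lambda>x. G x * \<phi> x)"
        proof (rule Bochner_Integration.integrable_bound[of _ "\<lambda>x. g (c / norm z powr s) * \<phi> x"])
          show "AE x in lborel. norm (G x * \<phi> x) \<le> norm (g (c / norm z powr s) * \<phi> x)"
            by (intro AE_I2 Gb')
        qed (use \<phi>i in auto)
        have i2: "integrable lborel (\<lambda>x. G (x - z) * \<phi> x)"
        proof (rule Bochner_Integration.integrable_bound[of _ "\<lambda>x. g (c / norm z powr s) * \<phi> x"])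
          show "AE x in lborel. norm (G (x - z) * \<phi> x) \<le> norm (g (c / norm z powr s) * \<phi> x)"
            by (intro AE_I2 Gb')
        qed (use \<phi>i in auto)
        \<comment> \<open>Translation by z turns the integral of G(x) \<phi>(x + z) into that of G(x
          - z) \<phi>(x). All difference operations now fall on G, and \<phi> enters
          undifferentiated.\<close>
        let ?h = "\<lambda>x. G (x - z) * \<phi> x"
        have hm: "?h \<in> borel_measurable borel" by measurable
        have i3: "integrable lborel (\<lambda>x. G x * \<phi> (x + z))"
          using integral_lborel_translate(2)[OF hm, of z] i2 by (simp add: add.commute)
        have e3: "(\<integral>x. G x * \<phi> (x + z) \<partial>lborel) = (\<integral>x. ?h x \<partial>lborel)"
          using integral_lborel_translate(1)[OF hm, of z] by (simp add: add.commute)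
        let ?k = "norm z powr (- s - DIM('a))"
        have kk: "?k = 1 / norm z ^ DIM('a) * (1 / norm z powr s)"
          using n by (simp add: powr_diff powr_minus powr_realpow divide_simps)
        have "(\<integral>x. F (x, x + z) \<partial>lborel) = (\<integral>x. ?k * (G x * \<phi> x - G x * \<phi> (x + z)) \<partial>lborel)"
          unfolding kk by (intro Bochner_Integration.integral_cong refl)
            (simp add: F_def diff_quot_def G_def right_diff_distrib diff_divide_distrib)
        also have "\<dots> = ?k * ((\<integral>x. G x * \<phi> x \<partial>lborel) - (\<integral>x. ?h x \<partial>lborel))"
          using i1 i3 by (simp add: e3)
        also have "\<dots> = (\<integral>x. ?k * (G x - G (x - z)) * \<phi> x \<partial>lborel)"
        proof -
          have "(\<lambda>x. ?k * (G x - G (x - z)) * \<phi> x) = (\<lambda>x. ?k * (G x * \<phi> x - ?h x))"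
            by (simp add: algebra_simps)
          then show ?thesis using i1 i2 by simp
        qed
        also have "\<dots> \<le> (\<integral>x. c * K3 z * \<phi> x \<partial>lborel)"
        proof (rule integral_mono)
          show "integrable lborel (\<lambda>x. ?k * (G x - G (x - z)) * \<phi> x)"
          proof -
            have "(\<lambda>x. ?k * (G x - G (x - z)) * \<phi> x) = (\<lambda>x. ?k * (G x * \<phi> x - ?h x))"
              by (simp add: algebra_simps)
            then show ?thesis using i1 i2 by simp
          qed
          show "integrable lborel (\<lambda>x. c * K3 z * \<phi> x)" using \<phi>i by simp
          fix x
          have "?k * (G x - G (x - z)) \<le> c * K3 z"
          proof (cases "norm z \<le> 1")
            case True
            let ?a = "(\<Phi>' x - \<Phi>' (x + z)) / norm z powr s" and ?b = "(\<Phi>' (x - z) - \<Phi>' x) / norm z powr s"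
            \<comment> \<open>For \<bar>z\<bar> \<le> 1 one has \<bar>z\<bar> \<le> \<bar>z\<bar>^s,
              so both quotients stay in [-L, L], where \<open>Lg\<close> is a Lipschitz constant of
              g.\<close>
            have small: "\<bar>(\<Phi>' x - \<Phi>' y) / norm z powr s\<bar> \<le> L" if "norm (x - y) = norm z" for x y
            proof -
              have "\<bar>\<Phi>' x - \<Phi>' y\<bar> \<le> 1 * (L * norm z)"
                unfolding \<Phi>'_def right_diff_distrib[symmetric] abs_mult
                using c lip[of x y] that by (intro mult_mono) auto
              also have "norm z \<le> norm z powr s"
                using n True s1 powr_mono'[of s 1 "norm z"] by simp
              then have "1 * (L * norm z) \<le> L * norm z powr s" using L by (simp add: mult_left_mono)
              finally show ?thesis using n by (simp add: divide_le_eq)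
            qed
            have "g ?a - g ?b \<le> Lg * (c * A * norm z powr (2 - s))"
            proof (cases "?b \<le> ?a")
              case True
              have "g ?a - g ?b \<le> Lg * (?a - ?b)"
                using True small[of x "x + z"] small[of "x - z" x] by (intro Lg(2)) auto
              also have "?a - ?b = c * (2 * \<psi> x - \<psi> (x + z) - \<psi> (x - z)) / norm z powr s"
                unfolding diff_divide_distrib[symmetric] by (simp add: \<Phi>'_def algebra_simps)
              also have "\<dots> \<le> c * (A * (norm z)\<^sup>2) / norm z powr s"
                using semi[of x z] c by (intro divide_right_mono mult_left_mono) auto
              also have "\<dots> = c * A * norm z powr (2 - s)"
                using n powr_realpow[of "norm z" 2] by (simp add: powr_diff)
              finally show ?thesis using Lg(1) by (simp add: mult_left_mono)
            next
              case False
              then have "g ?a - g ?b \<le> 0" using g_mono[of ?a ?b] by simp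
              also have "0 \<le> Lg * (c * A * norm z powr (2 - s))" using Lg A c by simp
              finally show ?thesis .
            qed
            moreover have "G (x - z) = g ?b" by (simp add: G_def)
            ultimately have "?k * (G x - G (x - z)) \<le> ?k * (Lg * (c * A * norm z powr (2 - s)))"
              by (intro mult_left_mono) (auto simp: G_def)
            also have "\<dots> = c * (Lg * A * (norm z powr (- s - DIM('a)) * norm z powr (2 - s)))" by simp
            also have "norm z powr (- s - DIM('a)) * norm z powr (2 - s) = norm z powr (2 * (1 - s) - DIM('a))"
              by (simp add: powr_add[symmetric] algebra_simps)
            finally show ?thesis using True by (simp add: K3_def k1_def k2_def)
          next
            case False
            have "1 \<le> norm z powr s" using False s by (intro ge_one_powr_ge_zero) auto
            then have "c / norm z powr s \<le> c / 1" using c by (intro divide_left_mono) auto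
            then have "g (c / norm z powr s) \<le> g c" by (intro g_mono) simp
            \<comment> \<open>This keeps the far contribution linear in c; positivity later relies
              on the whole bound vanishing with c.\<close>
            also have "g c \<le> c * g 1" using g_ratio[of c 1] c by (simp add: mult.commute)
            finally have "G x - G (x - z) \<le> 2 * (c * g 1)" using Gb[of x] Gb[of "x - z"] by linarith
            then have "?k * (G x - G (x - z)) \<le> ?k * (2 * (c * g 1))" by (intro mult_left_mono) auto
            also have "\<dots> = c * K3 z" using False by (simp add: K3_def k1_def k2_def)
            finally show ?thesis .
          qed
          then show "?k * (G x - G (x - z)) * \<phi> x \<le> c * K3 z * \<phi> x"
            using \<phi>0[of x] by (intro mult_right_mono)
        qed
        finally show ?case by simp
      qed
    qed
    also have "\<dots> = c * (\<integral>z. K3 z \<partial>lborel) * (\<integral>x. \<phi> x \<partial>lborel)" by simp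
    finally show "(\<integral>z. g (D (\<lambda>x. c * \<psi> x) z) * D \<phi> z \<partial>\<kappa>) \<le> c * (\<integral>z. K3 z \<partial>lborel) * (\<integral>x. \<phi> x \<partial>lborel)"
      using Fint by (simp add: \<Phi>'_def[abs_def])
  qed
qed

text \<open>A test function positive throughout \<Omega>.\<close>

lemma infdist_in_W: "(\<lambda>x. infdist x (- \<Omega>)) \<in> W"
proof (rule W_lipschitz[of _ 1])
  show "\<bar>infdist x (- \<Omega>) - infdist y (- \<Omega>)\<bar> \<le> 1 * norm (x - y)" for x y
    using infdist_triangle_abs[of x "- \<Omega>" y] by (simp add: dist_norm)
qed simp

text \<open>\<open>infdist\<close> to the empty set is 0, so a point outside \<Omega> is exhibited
  from boundedness before closedness of the complement is used.\<close>

lemma infdist_compl_pos: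
  assumes "x \<in> \<Omega>" shows "0 < infdist x (- \<Omega>)"
proof -
  obtain R where R: "\<And>x. x \<in> \<Omega> \<Longrightarrow> norm x < R" "0 < R"
    using bounded_dom by (meson bounded_pos_less)
  obtain b :: 'a where "b \<in> Basis" using nonempty_Basis by blast
  then have "R *\<^sub>R b \<notin> \<Omega>" using R(1)[of "R *\<^sub>R b"] R(2) by auto
  then have "- \<Omega> \<noteq> {}" by auto
  moreover have "closed (- \<Omega>)" using open_dom by (simp add: closed_Compl)
  ultimately show ?thesis
    using assms in_closed_iff_infdist_zero[of "- \<Omega>" x] infdist_nonneg[of x "- \<Omega>"] by (auto simp: less_le)
qed

text \<open>A paraboloid cut off at 0. As a maximum of functions whose second differences are
  bounded below it is semiconvex with the explicit constant 2 / R^2, and the kink at the sphere of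
  radius R bends in the harmless direction.\<close>

definition bump :: "'a \<Rightarrow> real \<Rightarrow> 'a \<Rightarrow> real" where
  "bump x0 R x = max 0 (1 - (norm (x - x0))\<^sup>2 / R\<^sup>2)"

lemma bump_props:
  assumes R: "0 < R"
  shows "0 \<le> bump x0 R x" "bump x0 R x \<le> 1"
    "x \<notin> ball x0 R \<Longrightarrow> bump x0 R x = 0"
    "\<bar>bump x0 R x - bump x0 R y\<bar> \<le> 2 / R * norm (x - y)"
    "2 * bump x0 R x - bump x0 R (x + z) - bump x0 R (x - z) \<le> 2 / R\<^sup>2 * (norm z)\<^sup>2"
    "x \<in> ball x0 (R / 2) \<Longrightarrow> 3 / 4 \<le> bump x0 R x"
proof -
  let ?d = "\<lambda>x. norm (x - x0)"
  show "0 \<le> bump x0 R x" "bump x0 R x \<le> 1" using R by (auto simp: bump_def)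
  show "bump x0 R x = 0" if "x \<notin> ball x0 R"
  proof -
    have "R \<le> ?d x" using that by (simp add: dist_norm norm_minus_commute)
    then have "R\<^sup>2 \<le> (?d x)\<^sup>2" using R by (intro power_mono) auto
    then show ?thesis using R by (simp add: bump_def)
  qed
  have *: "bump x0 R x - bump x0 R y \<le> 2 / R * norm (x - y)" for x y
  proof (cases "?d x < R")
    case False
    then have "R\<^sup>2 \<le> (?d x)\<^sup>2" using R by (intro power_mono) auto
    then have "bump x0 R x = 0" using R by (simp add: bump_def)
    moreover have "0 \<le> bump x0 R y" by (simp add: bump_def)
    moreover have "0 \<le> 2 / R * norm (x - y)" using R by simp
    ultimately show ?thesis by linarith
  next
    case True
    let ?m = "min R (?d y)"
    have m: "bump x0 R y = 1 - ?m\<^sup>2 / R\<^sup>2"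
    proof (cases "?d y \<le> R")
      case True
      then have "(?d y)\<^sup>2 \<le> R\<^sup>2" by (intro power_mono) auto
      then show ?thesis using R True by (simp add: bump_def min_def)
    next
      case False
      then have "R\<^sup>2 \<le> (?d y)\<^sup>2" using R by (intro power_mono) auto
      then show ?thesis using R False by (simp add: bump_def min_def)
    qed
    have "(?d x)\<^sup>2 \<le> R\<^sup>2" using True by (intro power_mono) auto
    then have "bump x0 R x = 1 - (?d x)\<^sup>2 / R\<^sup>2" using R by (simp add: bump_def)
    then have "bump x0 R x - bump x0 R y = (?m\<^sup>2 - (?d x)\<^sup>2) / R\<^sup>2" by (simp add: m diff_divide_distrib)
    also have "?m\<^sup>2 - (?d x)\<^sup>2 = (?m - ?d x) * (?m + ?d x)" by (simp add: power2_eq_square algebra_simps)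
    also have "\<dots> / R\<^sup>2 \<le> (norm (x - y) * (2 * R)) / R\<^sup>2"
    proof (rule divide_right_mono)
      have "?m - ?d x \<le> norm (x - y)"
        using norm_triangle_ineq2[of "y - x0" "x - x0"] by (auto simp: norm_minus_commute)
      moreover have "0 \<le> ?m + ?d x" "?m + ?d x \<le> 2 * R" using R True by auto
      ultimately show "(?m - ?d x) * (?m + ?d x) \<le> norm (x - y) * (2 * R)"
        by (intro mult_mono) auto
    qed simp
    also have "\<dots> = 2 / R * norm (x - y)" using R by (simp add: power2_eq_square)
    finally show ?thesis .
  qed
  show "\<bar>bump x0 R x - bump x0 R y\<bar> \<le> 2 / R * norm (x - y)"
    using *[of x y] *[of y x] by (simp add: norm_minus_commute abs_le_iff)
  show "2 * bump x0 R x - bump x0 R (x + z) - bump x0 R (x - z) \<le> 2 / R\<^sup>2 * (norm z)\<^sup>2"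
  proof (cases "bump x0 R x = 0")
    case True
    have "0 \<le> bump x0 R (x + z)" "0 \<le> bump x0 R (x - z)" "0 \<le> 2 / R\<^sup>2 * (norm z)\<^sup>2" by (simp_all add: bump_def)
    with True show ?thesis by linarith
  next
    case False
    then have "bump x0 R x = 1 - (?d x)\<^sup>2 / R\<^sup>2" by (auto simp: bump_def max_def split: if_splits)
    moreover have "1 - (?d (x + z))\<^sup>2 / R\<^sup>2 \<le> bump x0 R (x + z)" "1 - (?d (x - z))\<^sup>2 / R\<^sup>2 \<le> bump x0 R (x - z)"
      by (auto simp: bump_def)
    ultimately have "2 * bump x0 R x - bump x0 R (x + z) - bump x0 R (x - z)
        \<le> ((?d (x + z))\<^sup>2 + (?d (x - z))\<^sup>2 - 2 * (?d x)\<^sup>2) / R\<^sup>2"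
      by (simp add: add_divide_distrib diff_divide_distrib)
    also have "(?d (x + z))\<^sup>2 + (?d (x - z))\<^sup>2 - 2 * (?d x)\<^sup>2 = 2 * (norm z)\<^sup>2"
      by (simp add: power2_norm_eq_inner inner_simps inner_commute algebra_simps)
    finally show ?thesis by simp
  qed
  show "3 / 4 \<le> bump x0 R x" if "x \<in> ball x0 (R / 2)"
  proof -
    have "?d x \<le> R / 2" using that by (simp add: dist_norm norm_minus_commute)
    then have "(?d x)\<^sup>2 \<le> (R / 2)\<^sup>2" by (intro power_mono) auto
    then have "(?d x)\<^sup>2 / R\<^sup>2 \<le> 1 / 4" using R by (simp add: power_divide divide_le_eq)
    then have "3 / 4 \<le> 1 - (?d x)\<^sup>2 / R\<^sup>2" by linarith
    also have "\<dots> \<le> bump x0 R x" by (simp add: bump_def)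
    finally show ?thesis .
  qed
qed

end

section \<open>Strict positivity of the regularised solutions\<close>

context singular_problem
begin

text \<open>If u vanished, the left side of its equation would be 0, and the test function
  \<open>infdist x (- \<Omega>)\<close> together with p > 0 would force f = 0 almost everywhere in
  \<Omega>.\<close>

lemma sol_not_zero:
  assumes u: "is_sol \<epsilon> u" and \<epsilon>: "0 < \<epsilon>" "\<epsilon> \<le> 1" and nz: "\<not> (AE x in lborel. x \<in> \<Omega> \<longrightarrow> f x = 0)"
  shows "\<not> (AE x in lborel. u x = 0)"
proof
  assume 0: "AE x in lborel. u x = 0"
  have uW: "u \<in> W" using u by (simp add: is_sol_def)
  note [measurable] = W_measurable[OF uW]
  let ?\<phi> = "\<lambda>x. infdist x (- \<Omega>)"
  have "AE z in \<kappa>. g (D u z) * D ?\<phi> z = 0"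
    using AE_sing_measure_pair[OF 0] by eventually_elim (simp add: diff_quot_def)
  then have "(\<integral>z. g (D u z) * D ?\<phi> z \<partial>\<kappa>) = 0" by (rule integral_eq_zero_AE)
  then have "(\<integral>x. f x * p \<epsilon> x (u x) * ?\<phi> x \<partial>lborel) = 0"
    using u infdist_in_W by (simp add: is_sol_def)
  moreover have "0 \<le> f x * p \<epsilon> x (u x) * ?\<phi> x" for x
    using f_nonneg[of x] p_pos[OF \<epsilon>(1), of x "u x"] infdist_nonneg[of x "- \<Omega>"] by simp
  ultimately have "AE x in lborel. f x * p \<epsilon> x (u x) * ?\<phi> x = 0"
    using fp_integrable[OF _ infdist_in_W \<epsilon>, of u] by (subst (asm) integral_nonneg_eq_0_iff_AE) auto
  then have "AE x in lborel. x \<in> \<Omega> \<longrightarrow> f x = 0"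
  proof eventually_elim
    case (elim x)
    then show ?case using p_pos[OF \<epsilon>(1), of x "u x"] infdist_compl_pos[of x] by auto
  qed
  with nz show False by blast
qed

text \<open>Let A be a set of positive measure off a small ball about x0 on which u \<ge> \<eta>.
  The test function is the positive part of c \<psi> - u, with \<psi> the bump on the ball. Wherever
  it is positive, u lies below u on A by at least \<eta>/2, so pairs with second point in A
  contribute at least a fixed multiple of the integral of \<phi>, independent of c. The form of c
  \<psi> against \<phi> is at most c K times that integral. For small c the integral must vanish,
  that is, u \<ge> c \<psi>.\<close>

lemma sol_positive_ball:
  assumes u: "is_sol \<epsilon> u" and \<epsilon>: "0 < \<epsilon>" "\<epsilon> \<le> 1" and nz: "\<not> (AE x in lborel. u x = 0)" and x0: "x0 \<in> \<Omega>"
  obtains r c where "0 < r" "0 < c" "AE x in lborel. x \<in> ball x0 r \<longrightarrow> c \<le> u x"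
proof -
  have uW: "u \<in> W" and u0: "\<And>x. 0 \<le> u x" using u by (auto simp: is_sol_def)
  note [measurable] = W_measurable[OF uW]
  obtain \<eta> where \<eta>: "0 < \<eta>" and eta_pos: "emeasure lborel {x. \<eta> \<le> u x} \<noteq> 0"
  proof (rule ccontr)
    assume "\<not> thesis"
    then have z: "emeasure lborel {x. \<eta> \<le> u x} = 0" if "0 < \<eta>" for \<eta> using that \<open>\<And>\<eta>. 0 < \<eta> \<Longrightarrow> emeasure lborel {x. \<eta> \<le> u x} \<noteq> 0 \<Longrightarrow> thesis\<close> by blast
    have "AE x in lborel. \<forall>n. x \<notin> {x. 1 / real (Suc n) \<le> u x}"
      unfolding AE_all_countable by (intro allI AE_not_in null_setsI z) auto
    then have "AE x in lborel. u x = 0"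
    proof eventually_elim
      case (elim x)
      show ?case
      proof (rule ccontr)
        assume "u x \<noteq> 0"
        then have "0 < u x" using u0[of x] by simp
        then obtain n where "1 / real (Suc n) < u x" using nat_approx_posE by blast
        with elim show False by (auto simp: not_le dest: spec[of _ n])
      qed
    qed
    with nz show False by blast
  qed
  have sub: "{x. \<eta> \<le> u x} \<subseteq> \<Omega>" using W_outside[OF uW] \<eta> by force
  obtain r0 where r0: "0 < r0" "ball x0 r0 \<subseteq> \<Omega>" using open_dom x0 by (meson openE)
  \<comment> \<open>Shrinking the ball to the point x0 removes only a null set in the limit, so for
    some radius a part of {\<eta> \<le> u} of positive measure stays outside.\<close>
  obtain R where R: "0 < R" "R \<le> r0" and posD: "emeasure lborel ({x. \<eta> \<le> u x} - ball x0 R) \<noteq> 0"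
  proof (rule ccontr)
    assume neg: "\<not> thesis"
    have z: "emeasure lborel ({x. \<eta> \<le> u x} - ball x0 (r0 / real (Suc n))) = 0" for n
    proof (rule ccontr)
      assume "emeasure lborel ({x. \<eta> \<le> u x} - ball x0 (r0 / real (Suc n))) \<noteq> 0"
      moreover have "0 < r0 / real (Suc n)" "r0 / real (Suc n) \<le> r0" using r0 by (auto simp: divide_le_eq)
      ultimately show False using neg that by blast
    qed
    have "AE x in lborel. \<forall>n. x \<notin> {x. \<eta> \<le> u x} - ball x0 (r0 / real (Suc n))"
      unfolding AE_all_countable by (intro allI AE_not_in null_setsI z) auto
    then have "AE x in lborel. x \<notin> {x. \<eta> \<le> u x}"
      using AE_lborel_singleton[of x0]
    proof eventually_elim
      case (elim x)
      then have "0 < dist x0 x / r0" using r0 by simp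
      then obtain n where "1 / real (Suc n) < dist x0 x / r0" using nat_approx_posE by blast
      then have "r0 / real (Suc n) \<le> dist x0 x" using r0 by (simp add: field_simps)
      then show ?case using elim(1) by (auto dest: spec[of _ n])
    qed
    then have "emeasure lborel {x. \<eta> \<le> u x} = 0" by (subst (asm) AE_iff_measurable[OF _ refl]) auto
    with eta_pos show False by simp
  qed
  define A where "A = {x. \<eta> \<le> u x} - ball x0 R"
  have [measurable]: "A \<in> sets borel" unfolding A_def by measurable
  have A: "A \<subseteq> \<Omega>" "A \<inter> ball x0 R = {}" using sub by (auto simp: A_def)
  have Afin: "emeasure lborel A < \<infinity>"
    using emeasure_mono[of A \<Omega> lborel] A(1) dom_emeasure_finite by (simp add: order_le_less_trans)
  define m0 where "m0 = measure lborel A"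
  have m0: "0 < m0" "emeasure lborel A = ennreal m0"
    using posD Afin by (auto simp: m0_def A_def[symmetric] zero_less_measure_iff emeasure_eq_ennreal_measure)
  obtain B where B: "0 < B" "\<And>x. x \<in> \<Omega> \<Longrightarrow> norm x \<le> B" using bounded_dom unfolding bounded_pos by blast
  define d where "d = 2 * B"
  have d: "norm (x - y) \<le> d" if "x \<in> \<Omega>" "y \<in> \<Omega>" for x y
    using B(2)[OF that(1)] B(2)[OF that(2)] norm_triangle_ineq4[of x y] by (simp add: d_def)
  have d0: "0 < d" using B by (simp add: d_def)
  have ball\<Omega>: "ball x0 R \<subseteq> \<Omega>" using r0 R by auto
  let ?\<psi> = "bump x0 R"
  note bp = bump_props[OF R(1)]
  have \<psi>out: "?\<psi> x = 0" if "x \<notin> \<Omega>" for x using bp(3) that ball\<Omega> by blast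
  obtain K where K: "0 \<le> K"
    "\<And>c \<phi>. 0 < c \<Longrightarrow> c \<le> 1 \<Longrightarrow> \<phi> \<in> W \<Longrightarrow> (\<And>x. 0 \<le> \<phi> x) \<Longrightarrow> integrable lborel \<phi> \<Longrightarrow>
      (\<integral>z. g (D (\<lambda>x. c * ?\<psi> x) z) * D \<phi> z \<partial>\<kappa>) \<le> c * K * (\<integral>x. \<phi> x \<partial>lborel)"
    by (rule semiconvex_form_le[OF bp(1) bp(2) \<psi>out bp(4) _ bp(5)]) (use R in \<open>auto intro: that\<close>)
  \<comment> \<open>The jump of at least \<eta>/2 over a distance of at most d, inserted in g, times
    the smallest possible factor 1 / \<bar>x - y\<bar>^s in D\<phi>.\<close>
  define \<gamma> where "\<gamma> = g (\<eta> / (2 * d powr s)) * (1 / d powr s)"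
  have \<gamma>: "0 < \<gamma>" using \<eta> d0 by (simp add: \<gamma>_def pos)
  define t where "t = \<gamma> * m0 / d ^ DIM('a)"
  have t: "0 < t" using \<gamma> m0 d0 by (simp add: t_def)
  define k where "k = K + 1"
  have k: "0 < k" "K \<le> k" using K(1) by (auto simp: k_def)
  \<comment> \<open>The bound 1 admits \<open>semiconvex_form_le\<close>, \<eta>/2 leaves the gap
    between u on A and c \<psi>, and t / k / 2 makes c K strictly smaller than the jump constant t;
    k = K + 1 avoids division by 0.\<close>
  define c where "c = min (min 1 (\<eta> / 2)) (t / k / 2)"
  have t': "0 < t / k / 2" using t k by simp
  have c: "0 < c" "c \<le> 1" "c \<le> \<eta> / 2" "c \<le> t / k / 2"
    using \<eta> t' by (simp_all only: c_def min_less_iff_conj) (simp_all add: min.coboundedI1)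
  have cK: "c * K < \<gamma> * m0 / d ^ DIM('a)"
  proof -
    have "c * K \<le> t / k / 2 * k"
      using K(1) t' c(4) k by (intro mult_mono) simp_all
    also have "\<dots> = t / 2" using k by simp
    also have "\<dots> < t" using t by simp
    finally show ?thesis by (simp add: t_def)
  qed
  define \<Psi> where "\<Psi> x = c * ?\<psi> x" for x
  have \<Psi>W: "\<Psi> \<in> W" unfolding \<Psi>_def by (intro W_cmult W_lipschitz[OF bp(4) \<psi>out])
  define \<phi> where "\<phi> x = max (\<Psi> x - u x) 0" for x
  have \<phi>W: "\<phi> \<in> W" unfolding \<phi>_def by (intro W_pos W_diff \<Psi>W uW)
  note [measurable] = W_measurable[OF \<phi>W] W_measurable[OF \<Psi>W]
  have \<phi>0: "0 \<le> \<phi> x" for x by (simp add: \<phi>_def)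
  have \<phi>i: "integrable lborel \<phi>" by (rule I_AE_L1(2)[OF \<phi>W])
  have \<phi>ball: "\<phi> x = 0" if "x \<notin> ball x0 R" for x
    using bp(3)[OF that] u0[of x] by (simp add: \<phi>_def \<Psi>_def)
  let ?h = "\<lambda>z. \<gamma> * (\<phi> (fst z) * indicator A (snd z))"
  have pw: "g (D u z) * D \<phi> z + ?h z \<le> g (D \<Psi> z) * D \<phi> z" for z
  proof (cases "snd z \<in> A \<and> \<phi> (fst z) \<noteq> 0")
    case False
    then have e: "?h z = 0" by (auto simp: indicator_def)
    have "0 \<le> (g (D \<Psi> z) - g (D u z)) * D \<phi> z"
      using pos_part_monotone(1)[where v = \<Psi> and u = u and z = z] by (simp add: \<phi>_def[abs_def])
    then show ?thesis unfolding e left_diff_distrib by simp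
  next
    case True
    obtain x y where z: "z = (x, y)" by (cases z)
    have y: "y \<in> A" and x: "\<phi> x \<noteq> 0" using True z by auto
    then have xb: "x \<in> ball x0 R" using \<phi>ball by blast
    have x\<Omega>: "x \<in> \<Omega>" and y\<Omega>: "y \<in> \<Omega>" using xb ball\<Omega> y A by auto
    have "x \<noteq> y" using xb y A(2) by blast
    then have n: "0 < norm (x - y)" "norm (x - y) \<le> d" using d[OF x\<Omega> y\<Omega>] by auto
    have yb: "y \<notin> ball x0 R" using y A(2) by blast
    let ?n = "norm (x - y) powr s"
    have np: "0 < ?n" "?n \<le> d powr s" using n s by (auto intro: powr_mono2)
    have ux: "u x < \<Psi> x" using x by (auto simp: \<phi>_def max_def split: if_splits)
    have \<Psi>c: "\<Psi> x \<le> c" using bp(2)[of x0 x] c by (simp add: \<Psi>_def mult_left_le)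
    have "u x - u y \<le> - (\<eta> / 2)" using ux \<Psi>c c y by (simp add: A_def)
    then have "(u x - u y) / ?n \<le> - (\<eta> / 2) / ?n" using np(1) by (intro divide_right_mono) auto
    then have "D u z \<le> - (\<eta> / 2) / ?n" by (simp only: diff_quot_def z fst_conv snd_conv)
    also have "\<dots> \<le> - (\<eta> / (2 * d powr s))"
    proof -
      have "\<eta> / (2 * d powr s) \<le> \<eta> / (2 * ?n)"
        using np \<eta> d0 by (intro divide_left_mono) auto
      then show ?thesis by simp
    qed
    finally have "g (D u z) \<le> g (- (\<eta> / (2 * d powr s)))" by (rule g_mono)
    then have gu: "g (D u z) \<le> - g (\<eta> / (2 * d powr s))" by (simp only: odd)
    have D\<phi>: "D \<phi> z = \<phi> x / ?n" using \<phi>ball[OF yb] by (simp add: diff_quot_def z)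
    have D\<phi>0: "0 \<le> D \<phi> z" unfolding D\<phi> using \<phi>0 np by simp
    have "g (D u z) * D \<phi> z \<le> - g (\<eta> / (2 * d powr s)) * D \<phi> z" using gu D\<phi>0 by (rule mult_right_mono)
    also have "\<dots> \<le> - g (\<eta> / (2 * d powr s)) * (\<phi> x / d powr s)"
    proof -
      have "\<phi> x / d powr s \<le> D \<phi> z" unfolding D\<phi> using np d0 \<phi>0[of x] by (intro divide_left_mono) auto
      moreover have "0 \<le> g (\<eta> / (2 * d powr s))" using \<eta> by (intro g_nonneg) simp
      ultimately have "g (\<eta> / (2 * d powr s)) * (\<phi> x / d powr s) \<le> g (\<eta> / (2 * d powr s)) * D \<phi> z"
        by (intro mult_left_mono)
      then show ?thesis by (simp only: mult_minus_left neg_le_iff_le)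
    qed
    also have "\<dots> = - ?h z" using y by (simp add: z \<gamma>_def)
    finally have "g (D u z) * D \<phi> z + ?h z \<le> 0" by simp
    also have "0 \<le> g (D \<Psi> z) * D \<phi> z"
    proof -
      have "0 \<le> D \<Psi> z" using bp(3)[OF yb] bp(1)[of x0 x] c by (simp add: diff_quot_def z \<Psi>_def)
      then show ?thesis using D\<phi>0 g_nonneg by simp
    qed
    finally show ?thesis .
  qed
  have hm: "?h \<in> borel_measurable borel" unfolding borel_prod[symmetric] by measurable
  have h0: "0 \<le> ?h z" for z using \<gamma> \<phi>0 by simp
  let ?G = "\<lambda>z. g (D \<Psi> z) * D \<phi> z - g (D u z) * D \<phi> z"
  have Gi: "integrable \<kappa> ?G" using gD_integrable[OF \<Psi>W \<phi>W] gD_integrable[OF uW \<phi>W] by simp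
  have hG: "?h z \<le> ?G z" for z using pw[of z] by simp
  have hi: "integrable \<kappa> ?h"
  proof (rule Bochner_Integration.integrable_bound[OF Gi])
    show "AE z in \<kappa>. norm (?h z) \<le> norm (?G z)"
    proof (rule AE_I2)
      fix z show "norm (?h z) \<le> norm (?G z)" using h0[of z] hG[of z] by simp
    qed
  qed (use hm in simp)
  let ?S = "\<integral>x. \<phi> x \<partial>lborel"
  have low: "\<gamma> * m0 / d ^ DIM('a) * ?S \<le> (\<integral>z. ?h z \<partial>\<kappa>)"
  proof -
    have S0: "0 \<le> ?S" using \<phi>0 by simp
    have "ennreal (\<gamma> * m0 / d ^ DIM('a) * ?S) = ennreal (\<gamma> * m0 / d ^ DIM('a)) * (\<integral>\<^sup>+x. ennreal (\<phi> x) \<partial>lborel)"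
      using \<gamma> m0 d0 S0 \<phi>0 by (subst nn_integral_eq_integral[OF \<phi>i]) (auto simp: ennreal_mult[symmetric])
    also have "\<dots> = (\<integral>\<^sup>+x. ennreal (\<gamma> / d ^ DIM('a) * \<phi> x) * ennreal m0 \<partial>lborel)"
      using \<gamma> m0 d0 \<phi>0 by (subst nn_integral_cmult[symmetric])
        (auto intro!: nn_integral_cong simp: ennreal_mult[symmetric] mult_ac)
    also have "\<dots> \<le> (\<integral>\<^sup>+x. \<integral>\<^sup>+y. ennreal (1 / norm (x - y) ^ DIM('a)) * ennreal (?h (x, y)) \<partial>lborel \<partial>lborel)"
    proof (rule nn_integral_mono)
      fix x
      have "ennreal (\<gamma> / d ^ DIM('a) * \<phi> x) * ennreal m0 = (\<integral>\<^sup>+y. ennreal (\<gamma> / d ^ DIM('a) * \<phi> x) * indicator A y \<partial>lborel)"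
        unfolding m0(2)[symmetric] by (rule nn_integral_cmult_indicator[symmetric]) simp
      also have "\<dots> \<le> (\<integral>\<^sup>+y. ennreal (1 / norm (x - y) ^ DIM('a)) * ennreal (?h (x, y)) \<partial>lborel)"
      proof (rule nn_integral_mono)
        fix y
        show "ennreal (\<gamma> / d ^ DIM('a) * \<phi> x) * indicator A y \<le> ennreal (1 / norm (x - y) ^ DIM('a)) * ennreal (?h (x, y))"
        proof (cases "y \<in> A \<and> \<phi> x \<noteq> 0")
          case True
          then have xb: "x \<in> ball x0 R" using \<phi>ball by blast
          then have "x \<noteq> y" "x \<in> \<Omega>" "y \<in> \<Omega>" using True A ball\<Omega> by auto
          then have n: "0 < norm (x - y)" "norm (x - y) \<le> d" using d by auto
          have "1 / d ^ DIM('a) \<le> 1 / norm (x - y) ^ DIM('a)"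
            using n d0 by (intro divide_left_mono power_mono) auto
          then have "1 / d ^ DIM('a) * (\<gamma> * \<phi> x) \<le> 1 / norm (x - y) ^ DIM('a) * (\<gamma> * \<phi> x)"
            using \<gamma> \<phi>0[of x] by (intro mult_right_mono) auto
          then show ?thesis using True \<gamma> \<phi>0[of x] by (simp add: ennreal_mult[symmetric] ennreal_leI)
        qed auto
      qed
      finally show "ennreal (\<gamma> / d ^ DIM('a) * \<phi> x) * ennreal m0
        \<le> (\<integral>\<^sup>+y. ennreal (1 / norm (x - y) ^ DIM('a)) * ennreal (?h (x, y)) \<partial>lborel)" .
    qed
    also have "\<dots> = (\<integral>\<^sup>+z. ennreal (?h z) \<partial>\<kappa>)"
      using hm by (subst nn_integral_sing(2)) auto
    also have "\<dots> = ennreal (\<integral>z. ?h z \<partial>\<kappa>)"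
      by (rule nn_integral_eq_integral[OF hi]) (use h0 in auto)
    finally have le: "ennreal (\<gamma> * m0 / d ^ DIM('a) * ?S) \<le> ennreal (\<integral>z. ?h z \<partial>\<kappa>)" .
    have "0 \<le> (\<integral>z. ?h z \<partial>\<kappa>)" by (rule Bochner_Integration.integral_nonneg) (rule h0)
    from le[unfolded ennreal_le_iff[OF this]] show ?thesis .
  qed
  have "0 \<le> (\<integral>x. f x * p \<epsilon> x (u x) * \<phi> x \<partial>lborel)"
  proof (rule Bochner_Integration.integral_nonneg)
    fix x show "0 \<le> f x * p \<epsilon> x (u x) * \<phi> x"
      using f_nonneg[of x] p_pos[OF \<epsilon>(1), of x "u x"] \<phi>0[of x] by simp
  qed
  then have "0 \<le> (\<integral>z. g (D u z) * D \<phi> z \<partial>\<kappa>)" using u \<phi>W by (simp add: is_sol_def)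
  moreover have "(\<integral>z. ?h z \<partial>\<kappa>) \<le> (\<integral>z. ?G z \<partial>\<kappa>)" by (intro integral_mono hi Gi hG)
  moreover have "(\<integral>z. ?G z \<partial>\<kappa>) = (\<integral>z. g (D \<Psi> z) * D \<phi> z \<partial>\<kappa>) - (\<integral>z. g (D u z) * D \<phi> z \<partial>\<kappa>)"
    using gD_integrable[OF \<Psi>W \<phi>W] gD_integrable[OF uW \<phi>W] by simp
  moreover have "(\<integral>z. g (D \<Psi> z) * D \<phi> z \<partial>\<kappa>) \<le> c * K * ?S"
    using K(2)[OF c(1,2) \<phi>W \<phi>0 \<phi>i] by (simp add: \<Psi>_def[abs_def])
  ultimately have "\<gamma> * m0 / d ^ DIM('a) * ?S \<le> c * K * ?S" using low by linarith
  then have "\<not> 0 < ?S" using mult_strict_right_mono[OF cK, of ?S] by linarith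
  moreover have "0 \<le> ?S" using \<phi>0 by simp
  ultimately have "?S = 0" by linarith
  then have "AE x in lborel. \<phi> x = 0"
    using \<phi>i \<phi>0 by (subst (asm) integral_nonneg_eq_0_iff_AE) auto
  then have "AE x in lborel. x \<in> ball x0 (R / 2) \<longrightarrow> 3 / 4 * c \<le> u x"
  proof eventually_elim
    case (elim x)
    show ?case
    proof
      assume "x \<in> ball x0 (R / 2)"
      then have "3 / 4 * c \<le> \<Psi> x" using bp(6)[of x x0] c by (simp add: \<Psi>_def)
      with elim show "3 / 4 * c \<le> u x" by (simp add: \<phi>_def max_def split: if_splits)
    qed
  qed
  then show thesis using that[of "R / 2" "3 / 4 * c"] R c by simp
qed

lemma sol_positive_compact:
  assumes u: "is_sol \<epsilon> u" and \<epsilon>: "0 < \<epsilon>" "\<epsilon> \<le> 1" and nz: "\<not> (AE x in lborel. u x = 0)"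
    and K: "compact K" "K \<subseteq> \<Omega>"
  obtains c where "0 < c" "c \<le> 1" "AE x in lborel. x \<in> K \<longrightarrow> c \<le> u x"
proof -
  have "\<forall>x\<in>\<Omega>. \<exists>w. 0 < fst w \<and> 0 < snd w \<and> (AE y in lborel. y \<in> ball x (fst w) \<longrightarrow> snd w \<le> u y)"
  proof
    fix x assume "x \<in> \<Omega>"
    then obtain r c where "0 < r" "0 < c" "AE y in lborel. y \<in> ball x r \<longrightarrow> c \<le> u y"
      by (rule sol_positive_ball[OF u \<epsilon> nz]) (rule that)
    then show "\<exists>w. 0 < fst w \<and> 0 < snd w \<and> (AE y in lborel. y \<in> ball x (fst w) \<longrightarrow> snd w \<le> u y)"
      by (intro exI[of _ "(r, c)"]) simp
  qed
  then obtain w where w: "\<forall>x\<in>\<Omega>. 0 < fst (w x) \<and> 0 < snd (w x) \<and> (AE y in lborel. y \<in> ball x (fst (w x)) \<longrightarrow> snd (w x) \<le> u y)"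
    by (rule bchoice[THEN exE])
  define r c where "r x = fst (w x)" and "c x = snd (w x)" for x
  have rc: "0 < r x" "0 < c x" "AE y in lborel. y \<in> ball x (r x) \<longrightarrow> c x \<le> u y" if "x \<in> \<Omega>" for x
    using w that by (auto simp: r_def c_def)
  have cover: "K \<subseteq> (\<Union>x\<in>K. ball x (r x))"
  proof
    fix x assume "x \<in> K"
    then have "x \<in> ball x (r x)" using rc(1)[of x] K(2) by auto
    with \<open>x \<in> K\<close> show "x \<in> (\<Union>x\<in>K. ball x (r x))" by blast
  qed
  obtain F where F: "F \<subseteq> K" "finite F" "K \<subseteq> (\<Union>x\<in>F. ball x (r x))"
    by (rule compactE_image[OF K(1) open_ball cover]) (rule that)
  \<comment> \<open>The value 1 is inserted so that m \<le> 1, which lets m^(-q) be bounded by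
    m^(-Q) later.\<close>
  define m where "m = Min (insert 1 (c ` F))"
  have m: "0 < m" "m \<le> 1" "\<And>x. x \<in> F \<Longrightarrow> m \<le> c x" using F K rc(2) by (auto simp: m_def)
  have "AE y in lborel. \<forall>x\<in>F. y \<in> ball x (r x) \<longrightarrow> c x \<le> u y"
    using F K rc(3) by (intro AE_finite_allI) auto
  then have "AE y in lborel. y \<in> K \<longrightarrow> m \<le> u y"
  proof eventually_elim
    case (elim y)
    show ?case
    proof
      assume "y \<in> K"
      then obtain x where "x \<in> F" "y \<in> ball x (r x)" using F by blast
      then show "m \<le> u y" using elim m(3)[of x] by force
    qed
  qed
  then show thesis using that m by blast
qed

end

section \<open>The limit of the regularised solutions\<close>

text \<open>Vitali-type convergence: the domination may involve a sequence that is merely bounded in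
  \<open>L\<^sup>1\<close>, as long as its coefficient can be made arbitrarily small.\<close>

lemma integral_tendsto_split_domination:
  fixes F :: "nat \<Rightarrow> 'b \<Rightarrow> real"
  assumes F: "\<And>n. integrable N (F n)" and G: "integrable N G"
    and lim: "AE x in N. (\<lambda>n. F n x) \<longlonglongrightarrow> G x"
    and P: "\<And>n. integrable N (P n)" "\<And>n x. 0 \<le> P n x" "\<And>n. (\<integral>x. P n x \<partial>N) \<le> B"
    and dom: "\<And>\<eta>. 0 < \<eta> \<Longrightarrow> \<exists>R. integrable N R \<and> (\<forall>n x. \<bar>F n x\<bar> \<le> \<eta> * P n x + R x)"
  shows "(\<lambda>n. \<integral>x. F n x \<partial>N) \<longlonglongrightarrow> (\<integral>x. G x \<partial>N)"
proof (rule LIMSEQ_I)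
  fix e :: real assume e: "0 < e"
  have B: "0 \<le> B" using P(3)[of 0] Bochner_Integration.integral_nonneg[of N "P 0"] P(2) by (meson order_trans)
  define \<eta> where "\<eta> = e / 2 / (B + 1)"
  have \<eta>: "0 < \<eta>" using e B by (simp add: \<eta>_def)
  have \<eta>B: "\<eta> * B \<le> e / 2"
  proof -
    have "\<eta> * B \<le> \<eta> * (B + 1)" using \<eta> by (intro mult_left_mono) auto
    also have "\<dots> = e / 2" using B unfolding \<eta>_def by (intro nonzero_eq_divide_eq[THEN iffD1]) auto
    finally show ?thesis .
  qed
  obtain R where R: "integrable N R" "\<And>n x. \<bar>F n x\<bar> \<le> \<eta> * P n x + R x" using dom[OF \<eta>] by blast
  \<comment> \<open>The part of \<bar>F n - G\<bar> not covered by \<eta> P n. It tends to 0 and is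
    dominated by \<bar>R\<bar> + \<bar>G\<bar>, while the covered part has integral at most \<eta>
    B.\<close>
  define H where "H n x = max (\<bar>F n x - G x\<bar> - \<eta> * P n x) 0" for n x
  note [measurable] = borel_measurable_integrable[OF F] borel_measurable_integrable[OF G]
    borel_measurable_integrable[OF P(1)] borel_measurable_integrable[OF R(1)]
  have Hle: "\<bar>H n x\<bar> \<le> \<bar>R x\<bar> + \<bar>G x\<bar>" for n x
    unfolding H_def using R(2)[of n x] by linarith
  have lim0: "(\<lambda>n. \<integral>x. H n x \<partial>N) \<longlonglongrightarrow> (\<integral>x. 0 \<partial>N)"
  proof (rule integral_dominated_convergence[where w = "\<lambda>x. \<bar>R x\<bar> + \<bar>G x\<bar>"])
    show "integrable N (\<lambda>x. \<bar>R x\<bar> + \<bar>G x\<bar>)" using R(1) G by simp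
    show "AE x in N. (\<lambda>n. H n x) \<longlonglongrightarrow> 0"
      using lim
    proof eventually_elim
      case (elim x)
      have l: "(\<lambda>n. \<bar>F n x - G x\<bar>) \<longlonglongrightarrow> 0"
        using elim by (simp add: LIM_zero tendsto_rabs_zero)
      show ?case
      proof (rule tendsto_sandwich[OF _ _ tendsto_const l])
        show "eventually (\<lambda>n. 0 \<le> H n x) sequentially" by (simp add: H_def)
        show "eventually (\<lambda>n. H n x \<le> \<bar>F n x - G x\<bar>) sequentially"
          using P(2) \<eta> by (intro always_eventually allI) (simp add: H_def)
      qed
    qed
    show "AE x in N. norm (H n x) \<le> \<bar>R x\<bar> + \<bar>G x\<bar>" for n using Hle by simp
    show "H n \<in> borel_measurable N" for n unfolding H_def by measurable
  qed simp
  have Hi: "integrable N (H n)" for n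
  proof (rule Bochner_Integration.integrable_bound)
    show "integrable N (\<lambda>x. \<bar>R x\<bar> + \<bar>G x\<bar>)" using R(1) G by simp
    show "AE x in N. norm (H n x) \<le> norm (\<bar>R x\<bar> + \<bar>G x\<bar>)"
      using Hle[of n] by (intro AE_I2) auto
    show "H n \<in> borel_measurable N" unfolding H_def by measurable
  qed
  have "eventually (\<lambda>n. (\<integral>x. H n x \<partial>N) < e / 2) sequentially"
    using lim0 e by (intro order_tendstoD) auto
  then obtain N0 where N0: "\<And>n. N0 \<le> n \<Longrightarrow> (\<integral>x. H n x \<partial>N) < e / 2"
    by (auto simp: eventually_sequentially)
  show "\<exists>no. \<forall>n\<ge>no. norm ((\<integral>x. F n x \<partial>N) - (\<integral>x. G x \<partial>N)) < e"
  proof (intro exI[of _ N0] allI impI)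
    fix n assume n: "N0 \<le> n"
    have "norm ((\<integral>x. F n x \<partial>N) - (\<integral>x. G x \<partial>N)) = norm (\<integral>x. F n x - G x \<partial>N)"
      using F G by simp
    also have "\<dots> \<le> (\<integral>x. norm (F n x - G x) \<partial>N)" by (rule integral_norm_bound)
    also have "\<dots> \<le> (\<integral>x. H n x + \<eta> * P n x \<partial>N)"
      by (rule integral_mono) (use F G P(1) Hi in \<open>auto simp: H_def\<close>)
    also have "\<dots> = (\<integral>x. H n x \<partial>N) + \<eta> * (\<integral>x. P n x \<partial>N)" using Hi P(1) by simp
    also have "\<dots> < e / 2 + e / 2"
      using N0[OF n] mult_left_mono[OF P(3)[of n], of \<eta>] \<eta> \<eta>B by linarith
    finally show "norm ((\<integral>x. F n x \<partial>N) - (\<integral>x. G x \<partial>N)) < e" by simp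
  qed
qed

context nonlocal_domain
begin

text \<open>The sequence bounded in L^1 is the energy density E(Du n), and
  \<open>young_split\<close> puts an arbitrarily small coefficient in front of it.\<close>

lemma gD_integral_tendsto:
  assumes u: "\<And>n. u n \<in> W" and le: "\<And>n. Mr (u n) \<le> B" and v: "v \<in> W"
    and lim: "AE x in lborel. (\<lambda>n. u n x) \<longlonglongrightarrow> v x" and \<phi>: "\<phi> \<in> W"
  shows "(\<lambda>n. \<integral>z. g (D (u n) z) * D \<phi> z \<partial>\<kappa>) \<longlonglongrightarrow> (\<integral>z. g (D v z) * D \<phi> z \<partial>\<kappa>)"
proof (rule integral_tendsto_split_domination[where P = "\<lambda>n z. E (D (u n) z)" and B = B])
  show "AE z in \<kappa>. (\<lambda>n. g (D (u n) z) * D \<phi> z) \<longlonglongrightarrow> g (D v z) * D \<phi> z"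
    using AE_diff_quot_tendsto[OF lim]
  proof eventually_elim
    case (elim z)
    from isCont_tendsto_compose[OF cont elim] show ?case by (intro tendsto_intros)
  qed
  fix \<eta> :: real assume "0 < \<eta>"
  then obtain K where "0 < K" and K: "\<And>a b. \<bar>g a * b\<bar> \<le> \<eta> * E a + K * E b"
    by (rule young_split) (rule that)
  show "\<exists>R. integrable \<kappa> R \<and> (\<forall>n z. \<bar>g (D (u n) z) * D \<phi> z\<bar> \<le> \<eta> * E (D (u n) z) + R z)"
    using K W_integrable[OF \<phi>] by (intro exI[of _ "\<lambda>z. K * E (D \<phi> z)"]) auto
qed (use gD_integrable[OF u \<phi>] gD_integrable[OF v \<phi>] W_integrable[OF u] E_nonneg le in \<open>auto simp: Mr_def\<close>)

end

section \<open>The uniform energy bound and the passage to the limit\<close>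

context singular_problem
begin

text \<open>\<open>sobolev_young\<close> with b = 1 bounds f / \<tau> by a multiple of 1 plus its
  conjugate function, and \<Omega> has finite measure.\<close>

lemma f_integrable: "integrable lborel (\<lambda>x. f x * indicator \<Omega> x)"
proof (rule integrableI_bounded)
  have \<Phi>1: "0 < \<Phi> 1" using \<Phi>_strict[of 0 1] by (simp add: \<Phi>_0)
  define k where "k = \<tau> / \<Phi> 1"
  have k: "0 < k" using \<tau> \<Phi>1 by (simp add: k_def)
  have N0: "0 \<le> N_conjugate Gs (f x / \<tau>)" for x
    using f_nonneg[of x] \<tau> by (intro N_conjugate_Gs_nonneg) auto
  have [measurable]: "(\<lambda>x. N_conjugate Gs (f x / \<tau>)) \<in> borel_measurable borel"
    using f_nonneg \<tau> by (intro N_conjugate_measurable) auto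
  have "(\<integral>\<^sup>+x. ennreal (norm (f x * indicator \<Omega> x)) \<partial>lborel)
      \<le> (\<integral>\<^sup>+x. ennreal k * (indicator \<Omega> x + ennreal (N_conjugate Gs (f x / \<tau>)) * indicator \<Omega> x) \<partial>lborel)"
  proof (intro nn_integral_mono)
    fix x
    have "f x / \<tau> * \<Phi> 1 \<le> 1 + N_conjugate Gs (f x / \<tau>)"
      using f_nonneg[of x] \<tau> by (intro sobolev_young) auto
    then have "k * (f x / \<tau> * \<Phi> 1) \<le> k * (1 + N_conjugate Gs (f x / \<tau>))" using k by (intro mult_left_mono) auto
    then have "f x \<le> k * (1 + N_conjugate Gs (f x / \<tau>))" using \<tau> \<Phi>1 by (simp add: k_def)
    then have "ennreal (f x) \<le> ennreal (k * (1 + N_conjugate Gs (f x / \<tau>)))" by (rule ennreal_leI)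
    also have "\<dots> = ennreal k * (1 + ennreal (N_conjugate Gs (f x / \<tau>)))"
      using k N0[of x] by (simp add: ennreal_mult ennreal_plus)
    finally show "ennreal (norm (f x * indicator \<Omega> x))
        \<le> ennreal k * (indicator \<Omega> x + ennreal (N_conjugate Gs (f x / \<tau>)) * indicator \<Omega> x)"
      using f_nonneg[of x] by (simp add: indicator_def)
  qed
  also have "\<dots> = ennreal k * (emeasure lborel \<Omega> + (\<integral>\<^sup>+x. ennreal (N_conjugate Gs (f x / \<tau>)) * indicator \<Omega> x \<partial>lborel))"
    by (simp add: nn_integral_cmult nn_integral_add)
  also have "\<dots> < \<infinity>" using f_conj dom_emeasure_finite by (simp add: ennreal_mult_less_top)
  finally show "(\<integral>\<^sup>+x. ennreal (norm (f x * indicator \<Omega> x)) \<partial>lborel) < \<infinity>" .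
qed measurable

text \<open>Above c the singular factor is at most c^(-Q). Below c one has q \<le> 1, and t (t +
  \<epsilon>)^(-q) \<le> (t + \<epsilon>)^(1 - q) is at most linear. Both bounds are free of
  \<epsilon>.\<close>

lemma p_mult_le:
  assumes \<epsilon>: "0 < \<epsilon>" "\<epsilon> \<le> 1" and t: "0 \<le> t" and c: "0 < c" "c \<le> 1" and "q x \<le> 1 \<or> c \<le> t"
  shows "p \<epsilon> x t * t \<le> c powr (- Q) * (2 + t)"
proof -
  have cQ: "1 \<le> c powr (- Q)" using c q_nonneg[of x] q_le[of x] powr_mono'[of "- Q" 0 c] by simp
  have pe: "p \<epsilon> x t = (t + \<epsilon>) powr (- q x)" using t by (simp add: p_def)
  show ?thesis
  proof (cases "c \<le> t")
    case True
    have "p \<epsilon> x t \<le> c powr (- q x)" unfolding pe using True c \<epsilon> q_nonneg[of x] by (intro powr_mono2') auto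
    also have "\<dots> \<le> c powr (- Q)" using c q_le[of x] by (intro powr_mono') auto
    finally show ?thesis using t cQ by (intro mult_mono) auto
  next
    case False
    then have q1: "q x \<le> 1" using assms by simp
    have "p \<epsilon> x t * t \<le> (t + \<epsilon>) powr (- q x) * (t + \<epsilon>)"
      unfolding pe using t \<epsilon> by (intro mult_left_mono) auto
    also have "\<dots> = (t + \<epsilon>) powr (1 - q x)"
      using t \<epsilon> by (simp add: powr_diff powr_minus_divide)
    also have "\<dots> \<le> (1 + (t + \<epsilon>)) powr (1 - q x)" using t \<epsilon> q1 by (intro powr_mono2) auto
    also have "\<dots> \<le> (1 + (t + \<epsilon>)) powr 1" using t \<epsilon> q_nonneg[of x] by (intro powr_mono) auto
    also have "\<dots> \<le> 2 + t" using t \<epsilon> by simp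
    also have "\<dots> \<le> c powr (- Q) * (2 + t)" using cQ t mult_right_mono[of 1 "c powr (- Q)" "2 + t"] by simp
    finally show ?thesis .
  qed
qed

text \<open>The solution is its own test function. \<open>p_mult_le\<close> makes the right side
  linear in u, \<open>I_coercive\<close> bounds it by the square root of the energy, and that is
  absorbed. The resulting bound depends on \<epsilon> in no way; only c enters.\<close>

lemma energy_bound:
  assumes u: "is_sol \<epsilon> u" and \<epsilon>: "0 < \<epsilon>" "\<epsilon> \<le> 1" and c: "0 < c" "c \<le> 1"
    and K0: "AE x in lborel. x \<in> K0 \<longrightarrow> c \<le> u x" and strip: "\<And>x. x \<in> \<Omega> \<Longrightarrow> x \<notin> K0 \<Longrightarrow> q x \<le> 1"
  defines "b \<equiv> c powr (- Q)"
  shows "Mr u \<le> 2 * (b * (2 * (\<integral>x. f x * indicator \<Omega> x \<partial>lborel) + c_emb)) + (b * c_emb)\<^sup>2"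
proof -
  let ?F = "\<integral>x. f x * indicator \<Omega> x \<partial>lborel" and ?m = "sqrt (Mr u)"
  have uW: "u \<in> W" and u0: "\<And>x. 0 \<le> u x" using u by (auto simp: is_sol_def)
  note [measurable] = W_measurable[OF uW]
  have b: "0 < b" using c by (simp add: b_def)
  have "Mr u \<le> (\<integral>z. g (D u z) * D u z \<partial>\<kappa>)"
    unfolding Mr_def using E_le by (intro integral_mono W_integrable gD_integrable uW) (simp add: mult.commute)
  also have "\<dots> = (\<integral>x. f x * p \<epsilon> x (u x) * u x \<partial>lborel)" using u by (simp add: is_sol_def)
  also have "\<dots> \<le> (\<integral>x. b * (2 * (f x * indicator \<Omega> x) + f x * u x) \<partial>lborel)"
  proof (rule integral_mono_AE)
    show "AE x in lborel. f x * p \<epsilon> x (u x) * u x \<le> b * (2 * (f x * indicator \<Omega> x) + f x * u x)"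
      using K0
    proof eventually_elim
      case (elim x)
      show ?case
      proof (cases "x \<in> \<Omega>")
        case True
        then have "p \<epsilon> x (u x) * u x \<le> b * (2 + u x)"
          unfolding b_def using elim strip[of x] by (intro p_mult_le \<epsilon> u0 c) auto
        then have "f x * (p \<epsilon> x (u x) * u x) \<le> f x * (b * (2 + u x))" using f_nonneg[of x] by (intro mult_left_mono)
        also have "\<dots> = b * (2 * (f x * indicator \<Omega> x) + f x * u x)" using True by (simp add: algebra_simps)
        finally show ?thesis by (simp add: mult.assoc)
      qed (simp add: W_outside[OF uW])
    qed
    show "integrable lborel (\<lambda>x. f x * p \<epsilon> x (u x) * u x)" by (rule fp_integrable[OF _ uW \<epsilon>]) simp
    show "integrable lborel (\<lambda>x. b * (2 * (f x * indicator \<Omega> x) + f x * u x))"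
      using f_integrable I_AE_L1(3)[OF uW] by simp
  qed
  also have "\<dots> = b * (2 * ?F + (\<integral>x. f x * u x \<partial>lborel))"
    using f_integrable I_AE_L1(3)[OF uW] by simp
  also have "(\<integral>x. f x * u x \<partial>lborel) \<le> c_emb * (1 + ?m)"
  proof -
    have "ennreal (\<integral>x. f x * u x \<partial>lborel) = (\<integral>\<^sup>+x. ennreal (f x * u x) \<partial>lborel)"
      using I_AE_L1(3)[OF uW] f_nonneg u0 by (intro nn_integral_eq_integral[symmetric]) auto
    also have "\<dots> \<le> I u"
      unfolding I_def using f_nonneg u0 by (intro nn_integral_mono ennreal_leI) (auto intro!: mult_right_mono)
    also have "\<dots> \<le> ennreal (c_emb * (1 + ?m))" by (rule I_coercive[OF uW])
    finally show ?thesis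
      using c_emb(1) Mr_nonneg[of u] by (subst (asm) ennreal_le_iff) auto
  qed
  finally have "Mr u \<le> b * (2 * ?F + c_emb * (1 + ?m))" using b by (simp add: mult_left_mono)
  also have "\<dots> = b * (2 * ?F + c_emb) + (b * c_emb) * ?m" by (simp add: algebra_simps)
  finally have 1: "Mr u \<le> b * (2 * ?F + c_emb) + (b * c_emb) * ?m" .
  have "2 * (b * c_emb) * ?m \<le> (b * c_emb)\<^sup>2 + ?m\<^sup>2" by (rule sum_squares_bound)
  moreover have "?m\<^sup>2 = Mr u" using Mr_nonneg[of u] by simp
  ultimately have "2 * ((b * c_emb) * ?m) \<le> (b * c_emb)\<^sup>2 + Mr u" by (simp only: mult.assoc)
  with 1 show ?thesis by linarith
qed

lemma limit_solution:
  assumes K0: "compact K0" "K0 \<subseteq> \<Omega>" and strip: "\<And>x. x \<in> \<Omega> \<Longrightarrow> x \<notin> K0 \<Longrightarrow> q x \<le> 1"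
    and nz: "\<not> (AE x in lborel. x \<in> \<Omega> \<longrightarrow> f x = 0)"
  obtains u where "u \<in> W" "\<And>x. x \<in> \<Omega> \<Longrightarrow> 0 < u x"
    "\<And>K. compact K \<Longrightarrow> K \<subseteq> \<Omega> \<Longrightarrow> \<exists>c>0. c \<le> 1 \<and> (AE x in lborel. x \<in> K \<longrightarrow> c \<le> u x)"
    "\<And>\<phi> K. \<phi> \<in> W \<Longrightarrow> compact K \<Longrightarrow> K \<subseteq> \<Omega> \<Longrightarrow> (\<And>x. x \<notin> K \<Longrightarrow> \<phi> x = 0) \<Longrightarrow>
      (\<integral>z. g (D u z) * D \<phi> z \<partial>\<kappa>) = (\<integral>x. f x * u x powr (- q x) * \<phi> x \<partial>lborel)"
proof -
  \<comment> \<open>The index 0 corresponds to \<epsilon> = 1. By comparison w 0 lies below every w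
    n almost everywhere, so its lower bounds on compact sets serve all n.\<close>
  define \<epsilon> where "\<epsilon> n = 1 / real (Suc n)" for n
  have \<epsilon>: "0 < \<epsilon> n" "\<epsilon> n \<le> 1" "\<epsilon> (Suc n) \<le> \<epsilon> n" "\<epsilon> n \<le> \<epsilon> 0" for n by (auto simp: \<epsilon>_def divide_simps)
  have "\<forall>n. \<exists>u. is_sol (\<epsilon> n) u" using sol_exists[OF \<epsilon>(1,2)] by blast
  then obtain w where w: "\<And>n. is_sol (\<epsilon> n) (w n)" by metis
  have wW: "w n \<in> W" and w0: "0 \<le> w n x" for n x using w[of n] by (auto simp: is_sol_def)
  note [measurable] = W_measurable[OF wW]
  have nz0: "\<not> (AE x in lborel. w 0 x = 0)" by (rule sol_not_zero[OF w \<epsilon>(1,2) nz])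
  have inc: "AE x in lborel. \<forall>n. w n x \<le> w (Suc n) x"
    unfolding AE_all_countable by (intro allI comparison[OF \<epsilon>(1) \<epsilon>(3) \<epsilon>(2) w w])
  have ge0: "w 0 x \<le> w n x" if "\<forall>n. w n x \<le> w (Suc n) x" for n x
    using that by (induction n) (auto intro: order_trans)
  have lower: "\<exists>c. 0 < c \<and> c \<le> 1 \<and> (AE x in lborel. x \<in> K \<longrightarrow> c \<le> w 0 x)" if K: "compact K" "K \<subseteq> \<Omega>" for K
  proof -
    obtain c where "0 < c" "c \<le> 1" "AE x in lborel. x \<in> K \<longrightarrow> c \<le> w 0 x"
      by (rule sol_positive_compact[OF w \<epsilon>(1,2) nz0 K]) (rule that)
    then show ?thesis by blast
  qed
  obtain c where c: "0 < c" "c \<le> 1" "AE x in lborel. x \<in> K0 \<longrightarrow> c \<le> w 0 x" using lower[OF K0] by (elim exE conjE) (rule that)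
  define B where "B = 2 * (c powr (- Q) * (2 * (\<integral>x. f x * indicator \<Omega> x \<partial>lborel) + c_emb)) + (c powr (- Q) * c_emb)\<^sup>2"
  have MB: "Mr (w n) \<le> B" for n
    unfolding B_def
  proof (rule energy_bound[OF w \<epsilon>(1,2) c(1,2) _ strip])
    show "AE x in lborel. x \<in> K0 \<longrightarrow> c \<le> w n x"
      using c(3) inc
    proof eventually_elim
      case (elim x)
      then show ?case using ge0[OF elim(2), of n] by linarith
    qed
  qed
  have IB: "I (w n) \<le> ennreal (c_emb * (1 + sqrt B))" for n
    by (rule order_trans[OF I_coercive[OF wW]]) (use MB c_emb(1) in \<open>auto intro!: ennreal_leI mult_left_mono\<close>)
  have conv: "AE x in lborel. convergent (\<lambda>n. w n x)"
  proof -
    \<comment> \<open>Monotone convergence with the uniform L^1 bound: the supremum is integrable,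
      hence finite almost everywhere, and the increasing sequence converges there.\<close>
    have "(\<integral>\<^sup>+x. (SUP n. ennreal (w n x)) \<partial>lborel) = (SUP n. \<integral>\<^sup>+x. ennreal (w n x) \<partial>lborel)"
    proof (rule nn_integral_monotone_convergence_SUP_AE)
      show "AE x in lborel. ennreal (w n x) \<le> ennreal (w (Suc n) x)" for n
        using inc by eventually_elim (auto intro: ennreal_leI)
    qed measurable
    also have "\<dots> \<le> ennreal (c_emb * (1 + sqrt B))"
    proof (rule SUP_least)
      fix n
      have "(\<integral>\<^sup>+x. ennreal (w n x) \<partial>lborel) \<le> I (w n)"
        unfolding I_def
      proof (intro nn_integral_mono ennreal_leI)
        fix x
        show "w n x \<le> (1 + f x) * \<bar>w n x\<bar>"
          using mult_right_mono[of 1 "1 + f x" "w n x"] f_nonneg[of x] w0[of n x] by simp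
      qed
      then show "(\<integral>\<^sup>+x. ennreal (w n x) \<partial>lborel) \<le> ennreal (c_emb * (1 + sqrt B))"
        by (rule order_trans[OF _ IB])
    qed
    finally have "(\<integral>\<^sup>+x. (SUP n. ennreal (w n x)) \<partial>lborel) \<noteq> \<infinity>" by (auto simp: top_unique)
    then have "AE x in lborel. (SUP n. ennreal (w n x)) \<noteq> \<infinity>"
      by (intro nn_integral_noteq_infinite) auto
    with inc show ?thesis
    proof eventually_elim
      case (elim x)
      from elim(2) obtain r where r: "(SUP n. ennreal (w n x)) = ennreal r" "0 \<le> r"
        by (cases "SUP n. ennreal (w n x)") auto
      have "w n x \<le> r" for n
      proof -
        have "ennreal (w n x) \<le> ennreal r" unfolding r(1)[symmetric] by (rule SUP_upper) simp
        then show ?thesis using r(2) by (simp add: ennreal_le_iff)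
      qed
      then have "Bseq (\<lambda>n. w n x)" using w0 by (intro BseqI'[of _ r]) simp
      moreover have "monoseq (\<lambda>n. w n x)" using elim(1) by (simp add: monoseq_Suc)
      ultimately show ?case by (rule Bseq_monoseq_convergent)
    qed
  qed
  define v where "v x = lim (\<lambda>n. w n x)" for x
  have [measurable]: "v \<in> borel_measurable borel" unfolding v_def by measurable
  have v_lim: "AE x in lborel. (\<lambda>n. w n x) \<longlonglongrightarrow> v x"
    using conv by eventually_elim (simp add: v_def convergent_LIMSEQ_iff)
  have v_ge: "AE x in lborel. w 0 x \<le> v x"
    using v_lim inc
  proof eventually_elim
    case (elim x)
    show ?case by (rule LIMSEQ_le_const[OF elim(1)]) (use ge0[OF elim(2)] in blast)
  qed
  have v_out: "v x = 0" if "x \<notin> \<Omega>" for x using W_outside[OF wW that] by (simp add: v_def)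
  \<comment> \<open>The limit is known to be positive only almost everywhere, whereas a weak
    solution has to be positive at every point of \<Omega>; the value 1 repairs the exceptional null
    set.\<close>
  define u where "u x = (if x \<in> \<Omega> \<and> v x \<le> 0 then 1 else v x)" for x
  have [measurable]: "u \<in> borel_measurable borel" unfolding u_def by measurable
  have pos_ae: "AE x in lborel. x \<in> \<Omega> \<longrightarrow> 0 < v x"
  proof -
    obtain S :: "nat \<Rightarrow> 'a set" where S: "\<And>n. compact (S n)" "\<And>n. S n \<subseteq> \<Omega>" "(\<Union>n. S n) = \<Omega>"
      by (rule open_Union_compact_subsets[OF open_dom]) (rule that)
    have "AE x in lborel. \<forall>n. x \<in> S n \<longrightarrow> 0 < w 0 x"
      unfolding AE_all_countable
    proof
      fix n
      obtain c where c: "0 < c" "c \<le> 1" "AE x in lborel. x \<in> S n \<longrightarrow> c \<le> w 0 x"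
        using lower[OF S(1,2), of n] by (elim exE conjE) (rule that)
      from c(3) show "AE x in lborel. x \<in> S n \<longrightarrow> 0 < w 0 x" by eventually_elim (use c(1) in auto)
    qed
    with v_ge show ?thesis
    proof eventually_elim
      case (elim x)
      then show ?case using S(3) by (auto intro: less_le_trans)
    qed
  qed
  have uv: "AE x in lborel. v x = u x" using pos_ae by eventually_elim (auto simp: u_def)
  have lim: "AE x in lborel. (\<lambda>n. w n x) \<longlonglongrightarrow> u x" using v_lim uv by eventually_elim simp
  have u_out: "u x = 0" if "x \<notin> \<Omega>" for x using v_out[OF that] that by (simp add: u_def)
  have uW: "u \<in> W" by (rule W_limit(1)[OF wW MB _ u_out lim]) simp
  have u_ge: "AE x in lborel. w 0 x \<le> u x" using v_ge uv by eventually_elim simp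
  show thesis
  proof (rule that[OF uW])
    show "0 < u x" if "x \<in> \<Omega>" for x using that by (simp add: u_def)
    show "\<exists>c>0. c \<le> 1 \<and> (AE x in lborel. x \<in> K \<longrightarrow> c \<le> u x)" if K: "compact K" "K \<subseteq> \<Omega>" for K
    proof -
      obtain c where c: "0 < c" "c \<le> 1" "AE x in lborel. x \<in> K \<longrightarrow> c \<le> w 0 x" using lower[OF K] by (elim exE conjE) (rule that)
      have "AE x in lborel. x \<in> K \<longrightarrow> c \<le> u x" using c(3) u_ge by eventually_elim (auto intro: order_trans)
      with c(1,2) show ?thesis by (intro exI[of _ c] conjI)
    qed
    fix \<phi> K assume \<phi>: "\<phi> \<in> W" and K: "compact K" "K \<subseteq> \<Omega>" and out: "\<And>x. x \<notin> K \<Longrightarrow> \<phi> x = 0"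
    note [measurable] = W_measurable[OF \<phi>]
    obtain c where c: "0 < c" "c \<le> 1" "AE x in lborel. x \<in> K \<longrightarrow> c \<le> w 0 x" using lower[OF K] by (elim exE conjE) (rule that)
    have "(\<lambda>n. \<integral>z. g (D (w n) z) * D \<phi> z \<partial>\<kappa>) \<longlonglongrightarrow> (\<integral>z. g (D u z) * D \<phi> z \<partial>\<kappa>)"
      by (rule gD_integral_tendsto[OF wW MB uW lim \<phi>])
    moreover have "(\<integral>z. g (D (w n) z) * D \<phi> z \<partial>\<kappa>) = (\<integral>x. f x * p (\<epsilon> n) x (w n x) * \<phi> x \<partial>lborel)" for n
      using w[of n] \<phi> by (simp add: is_sol_def)
    moreover have "(\<lambda>n. \<integral>x. f x * p (\<epsilon> n) x (w n x) * \<phi> x \<partial>lborel) \<longlonglongrightarrow> (\<integral>x. f x * u x powr (- q x) * \<phi> x \<partial>lborel)"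
    \<comment> \<open>On K all w n are at least c, so the singular factor is at most c^(-Q); off K
      the test function vanishes.\<close>
    proof (rule integral_dominated_convergence[where w = "\<lambda>x. c powr (- Q) * (f x * \<bar>\<phi> x\<bar>)"])
      show "integrable lborel (\<lambda>x. c powr (- Q) * (f x * \<bar>\<phi> x\<bar>))" using I_AE_L1(3)[OF W_abs[OF \<phi>]] by simp
      show "AE x in lborel. (\<lambda>n. f x * p (\<epsilon> n) x (w n x) * \<phi> x) \<longlonglongrightarrow> f x * u x powr (- q x) * \<phi> x"
        using lim
      proof eventually_elim
        case (elim x)
        show ?case
        proof (cases "x \<in> \<Omega>")
          case True
          then have ux: "0 < u x" by (simp add: u_def)
          have "\<epsilon> \<longlonglongrightarrow> 0" unfolding \<epsilon>_def by (intro LIMSEQ_Suc lim_1_over_n)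
          then have "(\<lambda>n. max (w n x) 0 + \<epsilon> n) \<longlonglongrightarrow> max (u x) 0 + 0"
            using elim by (intro tendsto_intros)
          then have "(\<lambda>n. max (w n x) 0 + \<epsilon> n) \<longlonglongrightarrow> u x" using ux by (simp add: max_def)
          then have "(\<lambda>n. p (\<epsilon> n) x (w n x)) \<longlonglongrightarrow> u x powr (- q x)"
            unfolding p_def using ux by (intro tendsto_powr tendsto_const) auto
          then show ?thesis by (intro tendsto_intros)
        next
          case False
          then have "\<phi> x = 0" using W_outside[OF \<phi>] by blast
          then show ?thesis by simp
        qed
      qed
      show "AE x in lborel. norm (f x * p (\<epsilon> n) x (w n x) * \<phi> x) \<le> c powr (- Q) * (f x * \<bar>\<phi> x\<bar>)" for n
        using c(3) inc
      proof eventually_elim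
        case (elim x)
        show ?case
        proof (cases "x \<in> K")
          case True
          then have "c \<le> w n x" using elim ge0[of x n] by (auto intro: order_trans)
          then have "p (\<epsilon> n) x (w n x) \<le> c powr (- q x)"
            unfolding p_def using c \<epsilon>(1)[of n] q_nonneg[of x] by (intro powr_mono2') auto
          also have "\<dots> \<le> c powr (- Q)" using c q_le[of x] by (intro powr_mono') auto
          finally have "p (\<epsilon> n) x (w n x) * (f x * \<bar>\<phi> x\<bar>) \<le> c powr (- Q) * (f x * \<bar>\<phi> x\<bar>)"
            using f_nonneg[of x] by (intro mult_right_mono) auto
          then show ?thesis
            using f_nonneg[of x] p_pos[OF \<epsilon>(1), of n x "w n x"] by (simp add: abs_mult algebra_simps)
        qed (simp add: out)
      qed
    qed measurable
    ultimately show "(\<integral>z. g (D u z) * D \<phi> z \<partial>\<kappa>) = (\<integral>x. f x * u x powr (- q x) * \<phi> x \<partial>lborel)"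
      by (simp add: LIMSEQ_unique)
  qed
qed

end

section \<open>The spaces and test functions of the weak formulation\<close>

lemma borel_measurable_lebesgue_on:
  fixes u :: "'a::euclidean_space \<Rightarrow> real"
  assumes "u \<in> borel_measurable borel" shows "u \<in> borel_measurable (lebesgue_on U)"
  using assms by (intro measurable_restrict_space1 measurable_completion) simp

context nonlocal_domain
begin

text \<open>A Poincare-type inequality from the exterior values. The ball of radius R about a, with
  \<bar>a\<bar> = 2 R, misses \<Omega> and lies within distance 4 R of it, and u = 0 there; so pairs
  of a point x and a point of this ball alone contribute a multiple of E(c u(x)) to the
  energy.\<close>

lemma W_modular_finite:
  assumes u: "u \<in> W"
  shows "(\<integral>\<^sup>+x. ennreal (E (u x)) \<partial>lborel) < \<infinity>"
proof -
  note [measurable] = W_measurable[OF u]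
  obtain R where R: "0 < R" "\<Omega> \<subseteq> ball 0 R" using bounded_subset_ballD[OF bounded_dom, of 0] by blast
  obtain e :: 'a where e: "e \<in> Basis" using nonempty_Basis by blast
  define a where "a = (2 * R) *\<^sub>R e"
  have na: "norm a = 2 * R" using R e by (simp add: a_def)
  define k where "k = 1 / (4 * R) ^ DIM('a)"
  have k: "0 < k" using R by (simp add: k_def)
  define c where "c = 1 / (4 * R) powr s"
  have c: "0 < c" using R by (simp add: c_def)
  obtain K where K: "0 < K" "\<And>t. E (1 / c * t) \<le> K * E t" using E_mult_bound[of "1 / c"] by blast
  have E_le: "E t \<le> K * E (c * t)" for t using K(2)[of "c * t"] c by (simp add: field_simps)
  define b where "b = measure lborel (ball a R)"
  have b: "0 < b" using R by (simp add: b_def content_ball_pos)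
  have eb: "emeasure lborel (ball a R) = ennreal b"
    unfolding b_def using emeasure_lborel_ball_finite[of a R] by (intro emeasure_eq_ennreal_measure) auto
  have pair: "k * E (c * u x) \<le> 1 / norm (x - y) ^ DIM('a) * E (D u (x, y))" if y: "y \<in> ball a R" for x y
  proof (cases "x \<in> \<Omega>")
    case True
    have nx: "norm x < R" using True R by auto
    have ny: "R < norm y" "norm y < 3 * R"
      using y na norm_triangle_ineq2[of a y] norm_triangle_ineq[of a "y - a"] by (auto simp: dist_norm norm_minus_commute)
    then have "y \<notin> \<Omega>" using R by auto
    have xy: "x \<noteq> y" using nx ny by auto
    have d: "0 < norm (x - y)" "norm (x - y) \<le> 4 * R"
      using xy nx ny norm_triangle_ineq4[of x y] by auto
    have "c * \<bar>u x\<bar> \<le> \<bar>D u (x, y)\<bar>"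
      unfolding c_def diff_quot_def using d s R W_outside[OF u \<open>y \<notin> \<Omega>\<close>]
      by (auto simp: abs_mult intro!: divide_left_mono powr_mono2 mult_pos_pos)
    then have "E (c * u x) \<le> E (D u (x, y))" using c by (intro E_mono) (simp add: abs_mult)
    moreover have "k \<le> 1 / norm (x - y) ^ DIM('a)"
      unfolding k_def using d R by (intro divide_left_mono power_mono mult_pos_pos zero_less_power) auto
    ultimately show ?thesis using k E_nonneg by (intro mult_mono) auto
  qed (use E_nonneg in \<open>simp add: W_outside[OF u]\<close>)
  have "ennreal (k * b) * (\<integral>\<^sup>+x. ennreal (E (c * u x)) \<partial>lborel)
      = (\<integral>\<^sup>+x. ennreal (k * b) * ennreal (E (c * u x)) \<partial>lborel)"
    by (rule nn_integral_cmult[symmetric]) measurable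
  also have "\<dots> = (\<integral>\<^sup>+x. \<integral>\<^sup>+y. ennreal (k * E (c * u x)) * indicator (ball a R) y \<partial>lborel \<partial>lborel)"
  proof (rule nn_integral_cong)
    fix x
    have "(\<integral>\<^sup>+y. ennreal (k * E (c * u x)) * indicator (ball a R) y \<partial>lborel) = ennreal (k * E (c * u x)) * ennreal b"
      by (subst nn_integral_cmult_indicator) (simp_all only: eb, simp)
    also have "\<dots> = ennreal (k * b) * ennreal (E (c * u x))"
      using k b E_nonneg by (simp add: ennreal_mult[symmetric] mult_ac)
    finally show "ennreal (k * b) * ennreal (E (c * u x))
        = (\<integral>\<^sup>+y. ennreal (k * E (c * u x)) * indicator (ball a R) y \<partial>lborel)" by (rule sym)
  qed
  also have "\<dots> \<le> (\<integral>\<^sup>+x. \<integral>\<^sup>+y. ennreal (1 / norm (x - y) ^ DIM('a)) * ennreal (E (D u (x, y))) \<partial>lborel \<partial>lborel)"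
  proof (rule nn_integral_mono, rule nn_integral_mono)
    fix x y :: 'a
    show "ennreal (k * E (c * u x)) * indicator (ball a R) y
        \<le> ennreal (1 / norm (x - y) ^ DIM('a)) * ennreal (E (D u (x, y)))"
      using pair[of y x] E_nonneg by (cases "y \<in> ball a R") (auto simp: ennreal_mult[symmetric] intro!: ennreal_leI)
  qed
  also have "\<dots> = M u"
    unfolding M_def by (rule nn_integral_sing(2)[symmetric]) measurable
  also have "\<dots> < \<infinity>" using u by (simp add: W_def)
  finally have fin: "(\<integral>\<^sup>+x. ennreal (E (c * u x)) \<partial>lborel) < \<infinity>"
    using k b by (auto simp: ennreal_mult_less_top)
  have "(\<integral>\<^sup>+x. ennreal (E (u x)) \<partial>lborel) \<le> (\<integral>\<^sup>+x. ennreal K * ennreal (E (c * u x)) \<partial>lborel)"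
    using E_le E_nonneg K(1) by (intro nn_integral_mono) (auto simp: ennreal_mult[symmetric] intro!: ennreal_leI)
  also have "\<dots> = ennreal K * (\<integral>\<^sup>+x. ennreal (E (c * u x)) \<partial>lborel)" by (rule nn_integral_cmult) measurable
  also have "\<dots> < \<infinity>" using fin by (simp add: ennreal_mult_less_top)
  finally show ?thesis .
qed

lemma orlicz_modular_le:
  assumes [measurable]: "u \<in> borel_measurable borel" and U: "U \<in> sets lebesgue"
  shows "orlicz_modular (primitive g) U u \<le> (\<integral>\<^sup>+x. ennreal (E (u x)) \<partial>lborel)"
proof -
  have "orlicz_modular (primitive g) U u = (\<integral>\<^sup>+x. ennreal (E (u x)) * indicator U x \<partial>lebesgue)"
    unfolding orlicz_modular_def using U by (subst nn_integral_restrict_space) (auto simp: E_def)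
  also have "\<dots> \<le> (\<integral>\<^sup>+x. ennreal (E (u x)) \<partial>lebesgue)"
    by (intro nn_integral_mono) (auto split: split_indicator)
  finally show ?thesis unfolding nn_integral_completion .
qed

lemma frac_modular_le:
  fixes u :: "'a \<Rightarrow> real"
  assumes [measurable]: "u \<in> borel_measurable borel" and U: "open U"
  shows "frac_modular s (primitive g) U u \<le> M u"
proof -
  have UU: "U \<times> U \<in> sets lebesgue" using borel_open[OF open_Times[OF U U]] by (intro sets_completionI_sets) simp
  have eq: "(case z of (x, y) \<Rightarrow> ennreal (primitive g (\<bar>u x - u y\<bar> / norm (x - y) powr s) / norm (x - y) ^ DIM('a)))
      = ennreal (1 / norm (fst z - snd z) ^ DIM('a)) * ennreal (E (D u z))" for z
  proof -
    have "primitive g (\<bar>u (fst z) - u (snd z)\<bar> / norm (fst z - snd z) powr s) = E (D u z)"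
      by (simp add: E_def diff_quot_def abs_divide)
    then show ?thesis using E_nonneg[of "D u z"] by (simp add: case_prod_beta ennreal_mult[symmetric])
  qed
  have "frac_modular s (primitive g) U u
      = (\<integral>\<^sup>+z. (ennreal (1 / norm (fst z - snd z) ^ DIM('a)) * ennreal (E (D u z))) * indicator (U \<times> U) z \<partial>lebesgue)"
    unfolding frac_modular_def eq using UU by (subst nn_integral_restrict_space) auto
  also have "\<dots> \<le> (\<integral>\<^sup>+z. ennreal (1 / norm (fst z - snd z) ^ DIM('a)) * ennreal (E (D u z)) \<partial>lebesgue)"
    by (intro nn_integral_mono) (auto split: split_indicator)
  also have "\<dots> = M u" unfolding M_def nn_integral_completion by (rule nn_integral_sing(1)[symmetric]) measurable
  finally show ?thesis .
qed

text \<open>With total mass r, dividing by c \<ge> \<surd>r suffices, since \<open>E_scale\<close>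
  gains 1 / c^2. This turns finite modulars into finite Luxemburg norms.\<close>

lemma luxemburg_scaling:
  assumes [measurable]: "F \<in> borel_measurable M'" and fin: "(\<integral>\<^sup>+z. ennreal (E (F z)) \<partial>M') < \<infinity>"
  obtains c where "1 \<le> c" "(\<integral>\<^sup>+z. ennreal (E (F z / c)) \<partial>M') \<le> 1"
proof -
  obtain r where r: "(\<integral>\<^sup>+z. ennreal (E (F z)) \<partial>M') = ennreal r" "0 \<le> r"
    using fin by (cases "\<integral>\<^sup>+z. ennreal (E (F z)) \<partial>M'") auto
  define c where "c = max 1 (sqrt r)"
  have c: "1 \<le> c" "r \<le> c\<^sup>2"
    using r(2) power_mono[of "sqrt r" c 2] by (auto simp: c_def)
  have "(\<integral>\<^sup>+z. ennreal (E (F z / c)) \<partial>M') \<le> (\<integral>\<^sup>+z. ennreal (1 / c\<^sup>2) * ennreal (E (F z)) \<partial>M')"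
    using E_scale[of "1 / c"] E_nonneg c(1)
    by (intro nn_integral_mono) (auto simp: ennreal_mult[symmetric] power_divide intro!: ennreal_leI)
  also have "\<dots> = ennreal (1 / c\<^sup>2) * (\<integral>\<^sup>+z. ennreal (E (F z)) \<partial>M')" by (rule nn_integral_cmult) measurable
  also have "\<dots> = ennreal (r / c\<^sup>2)" using r by (simp add: ennreal_mult[symmetric])
  also have "\<dots> \<le> 1" using c by (simp add: divide_le_eq)
  finally show thesis by (rule that[OF c(1)])
qed

lemma W_frac_space_zero:
  assumes u: "u \<in> W" shows "u \<in> frac_space_zero s (primitive g) \<Omega>"
proof -
  note [measurable] = W_measurable[OF u]
  have "orlicz_modular (primitive g) UNIV (\<lambda>x. u x / 1) < \<infinity>"
    using orlicz_modular_le[of u UNIV] W_modular_finite[OF u] by (simp add: order.strict_trans1)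
  then have "u \<in> orlicz_space (primitive g) UNIV"
    unfolding orlicz_space_def
    by (intro CollectI conjI exI[of _ "1::real"] borel_measurable_lebesgue_on W_measurable[OF u]) auto
  moreover have "frac_modular s (primitive g) UNIV (\<lambda>x. u x / 1) < \<infinity>"
    using frac_modular_le[of u UNIV] u by (auto simp: W_def intro: order.strict_trans1)
  ultimately show ?thesis
    unfolding frac_space_zero_def frac_space_def using W_outside[OF u]
    by (intro CollectI conjI exI[of _ "1::real"]) auto
qed

text \<open>Any ball with closure in \<Omega> serves as U. In the weighted tail integral only
  \<Omega> counts, where g(t) is bounded by a constant plus a multiple of E(t).\<close>

lemma W_frac_space_hat:
  assumes u: "u \<in> W" and ne: "\<Omega> \<noteq> {}"
  shows "u \<in> frac_space_hat s g \<Omega>"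
proof -
  note [measurable] = W_measurable[OF u]
  let ?m = "\<integral>\<^sup>+x. ennreal (E (u x)) \<partial>lborel"
  have m: "?m < \<infinity>" by (rule W_modular_finite[OF u])
  have loc: "u \<in> orlicz_space (primitive g) K" if "compact K" for K
  proof -
    have K: "K \<in> sets lebesgue" using that by (simp add: compact_imp_closed)
    have "orlicz_modular (primitive g) K (\<lambda>x. u x / 1) < \<infinity>"
      using orlicz_modular_le[OF _ K, of u] m by (simp add: order.strict_trans1)
    then show ?thesis
      unfolding orlicz_space_def
      by (intro CollectI conjI exI[of _ "1::real"] borel_measurable_lebesgue_on W_measurable[OF u]) auto
  qed
  obtain x0 where "x0 \<in> \<Omega>" using ne by blast
  then obtain r where r: "0 < r" "cball x0 r \<subseteq> \<Omega>" using open_dom open_contains_cball by blast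
  have U: "compactly_contained (ball x0 r) \<Omega>" using r by (simp add: compactly_contained_def)
  have "orlicz_norm (primitive g) (ball x0 r) u < \<infinity>"
  proof -
    obtain c where c: "1 \<le> c" "(\<integral>\<^sup>+x. ennreal (E (u x / c)) \<partial>lborel) \<le> 1"
      by (rule luxemburg_scaling[of u lborel]) (use m in auto)
    have "orlicz_modular (primitive g) (ball x0 r) (\<lambda>x. u x / c) \<le> 1"
      by (rule order_trans[OF orlicz_modular_le c(2)]) auto
    then have "orlicz_norm (primitive g) (ball x0 r) u \<le> ennreal c"
      unfolding orlicz_norm_def using c by (intro INF_lower) auto
    then show ?thesis by (simp add: order.strict_trans1)
  qed
  moreover have "frac_seminorm s (primitive g) (ball x0 r) u < \<infinity>"
  proof -
    have "M u < \<infinity>" using u by (simp add: W_def)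
    then have fin: "(\<integral>\<^sup>+z. ennreal (E (D u z)) \<partial>\<kappa>) < \<infinity>" by (simp only: M_def)
    have "D u \<in> borel_measurable \<kappa>" by measurable
    from luxemburg_scaling[OF this fin]
    obtain c where c: "1 \<le> c" "(\<integral>\<^sup>+z. ennreal (E (D u z / c)) \<partial>\<kappa>) \<le> 1" .
    have "frac_modular s (primitive g) (ball x0 r) (\<lambda>x. u x / c) \<le> M (\<lambda>x. u x / c)"
      by (rule frac_modular_le) auto
    also have "\<dots> = (\<integral>\<^sup>+z. ennreal (E (D u z / c)) \<partial>\<kappa>)"
      unfolding M_def using D_cmult[of "1 / c" u] by simp
    also have "\<dots> \<le> 1" by (rule c(2))
    finally have "frac_seminorm s (primitive g) (ball x0 r) u \<le> ennreal c"
      unfolding frac_seminorm_def using c by (intro INF_lower) auto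
    then show ?thesis by (simp add: order.strict_trans1)
  qed
  moreover have "(\<integral>\<^sup>+x. ennreal (g (\<bar>u x\<bar> / (1 + norm x powr s)) / (1 + norm x) powr (real DIM('a) + s)) \<partial>lebesgue) < \<infinity>"
  proof -
    have g_le: "g t \<le> g 1 + 2 * C * E t" if "0 \<le> t" for t
    proof (cases "t \<le> 1")
      case True
      moreover have "0 \<le> 2 * C * E t" using E_nonneg[of t] C_pos by simp
      ultimately show ?thesis using g_mono[of t 1] by linarith
    next
      case False
      then have "g t \<le> t * g t" using mult_right_mono[of 1 t "g t"] g_nonneg[OF that] by simp
      also have "\<dots> \<le> 2 * C * E t" by (rule g_mult_le)
      finally show ?thesis using g_nonneg[of 1] by simp
    qed
    have le: "g (\<bar>u x\<bar> / (1 + norm x powr s)) / (1 + norm x) powr (real DIM('a) + s)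
        \<le> g 1 * indicator \<Omega> x + 2 * C * E (u x)" for x
    proof (cases "x \<in> \<Omega>")
      case True
      let ?t = "\<bar>u x\<bar> / (1 + norm x powr s)"
      have t: "0 \<le> ?t" by simp
      have "?t \<le> \<bar>u x\<bar> / 1"
        by (rule divide_left_mono) (auto intro!: mult_pos_pos add_pos_nonneg)
      then have Et: "E ?t \<le> E (u x)" using t by (intro E_mono) simp
      have "1 \<le> (1 + norm x) powr (real DIM('a) + s)" using s by (intro ge_one_powr_ge_zero) auto
      then have "g ?t / (1 + norm x) powr (real DIM('a) + s) \<le> g ?t / 1"
        by (intro divide_left_mono g_nonneg t) auto
      also have "\<dots> \<le> g 1 + 2 * C * E (u x)"
      proof -
        have "2 * C * E ?t \<le> 2 * C * E (u x)" using C_pos by (intro mult_left_mono Et) simp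
        then show ?thesis using g_le[OF t] by simp
      qed
      finally show ?thesis using True by simp
    qed (simp add: W_outside[OF u])
    have "(\<integral>\<^sup>+x. ennreal (g (\<bar>u x\<bar> / (1 + norm x powr s)) / (1 + norm x) powr (real DIM('a) + s)) \<partial>lebesgue)
        \<le> (\<integral>\<^sup>+x. ennreal (g 1) * indicator \<Omega> x + ennreal (2 * C) * ennreal (E (u x)) \<partial>lborel)"
      unfolding nn_integral_completion
    proof (rule nn_integral_mono)
      fix x
      have "ennreal (g 1) * indicator \<Omega> x + ennreal (2 * C) * ennreal (E (u x)) = ennreal (g 1 * indicator \<Omega> x + 2 * C * E (u x))"
        using g_nonneg[of 1] C_pos E_nonneg[of "u x"]
        by (simp add: ennreal_plus ennreal_mult split: split_indicator)
      then show "ennreal (g (\<bar>u x\<bar> / (1 + norm x powr s)) / (1 + norm x) powr (real DIM('a) + s))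
          \<le> ennreal (g 1) * indicator \<Omega> x + ennreal (2 * C) * ennreal (E (u x))"
        using le[of x] by (simp add: ennreal_leI)
    qed
    also have "\<dots> = ennreal (g 1) * emeasure lborel \<Omega> + ennreal (2 * C) * ?m"
      by (simp add: nn_integral_add nn_integral_cmult)
    also have "\<dots> < \<infinity>" using m dom_emeasure_finite by (simp add: ennreal_mult_less_top)
    finally show ?thesis .
  qed
  ultimately show ?thesis
    unfolding frac_space_hat_def orlicz_space_loc_def using loc U r(1)
    by (auto intro!: exI[of _ "ball x0 r"])
qed

lemma weak_form_eq:
  fixes u \<phi> :: "'a \<Rightarrow> real"
  shows "weak_form_integrand s g u \<phi> = (\<lambda>z. 1 / norm (fst z - snd z) ^ DIM('a) * (g (D u z) * D \<phi> z))"
proof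
  fix z :: "'a \<times> 'a"
  show "weak_form_integrand s g u \<phi> z = 1 / norm (fst z - snd z) ^ DIM('a) * (g (D u z) * D \<phi> z)"
  proof (cases "fst z = snd z")
    case True
    then show ?thesis by (simp add: weak_form_integrand_def diff_quot_def case_prod_beta)
  next
    case False
    then have "norm (fst z - snd z) powr (real DIM('a) + s) = norm (fst z - snd z) ^ DIM('a) * norm (fst z - snd z) powr s"
      by (simp add: powr_add powr_realpow)
    then show ?thesis by (simp add: weak_form_integrand_def diff_quot_def case_prod_beta)
  qed
qed

lemma weak_form_integral:
  assumes u: "u \<in> W" and \<phi>: "\<phi> \<in> W"
  shows "integrable lebesgue (weak_form_integrand s g u \<phi>)"
    and "(LINT z|lebesgue. weak_form_integrand s g u \<phi> z) = (\<integral>z. g (D u z) * D \<phi> z \<partial>\<kappa>)"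
proof -
  note [measurable] = W_measurable[OF u] W_measurable[OF \<phi>]
  let ?k = "\<lambda>z::'a \<times> 'a. 1 / norm (fst z - snd z) ^ DIM('a)"
  have k: "?k \<in> borel_measurable lborel" "AE z in lborel. 0 \<le> ?k z" by auto
  have m: "(\<lambda>z. g (D u z) * D \<phi> z) \<in> borel_measurable lborel" by measurable
  have wm: "weak_form_integrand s g u \<phi> \<in> borel_measurable lborel" by (simp only: weak_form_eq) measurable
  have "integrable (density lborel ?k) (\<lambda>z. g (D u z) * D \<phi> z)"
    using gD_integrable[OF u \<phi>] by (simp add: sing_measure_def)
  then have "integrable lborel (weak_form_integrand s g u \<phi>)"
    unfolding weak_form_eq by (subst (asm) integrable_density[OF m k]) simp
  then show "integrable lebesgue (weak_form_integrand s g u \<phi>)" using wm by (simp add: integrable_completion)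
  have "(\<integral>z. g (D u z) * D \<phi> z \<partial>\<kappa>) = (\<integral>z. weak_form_integrand s g u \<phi> z \<partial>lborel)"
    unfolding sing_measure_def weak_form_eq by (subst integral_density[OF m k]) simp
  then show "(LINT z|lebesgue. weak_form_integrand s g u \<phi> z) = (\<integral>z. g (D u z) * D \<phi> z \<partial>\<kappa>)"
    using wm by (simp add: integral_completion)
qed

end

text \<open>The partial derivatives are continuous on the compact support and vanish off it, hence
  are bounded, and so are the operator norms of the derivatives.\<close>

lemma test_function_lipschitz:
  fixes \<phi> :: "'a::euclidean_space \<Rightarrow> real"
  assumes "\<phi> \<in> test_functions \<Omega>"
  obtains L where "\<And>x y. \<bar>\<phi> x - \<phi> y\<bar> \<le> L * norm (x - y)"
proof -
  let ?S = "closure {x. \<phi> x \<noteq> 0}" and ?d = "\<lambda>x. frechet_derivative \<phi> (at x)"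
  have S: "compact ?S" and smooth: "Ck_on (Suc 0) \<phi> UNIV"
    using assms by (auto simp: test_functions_def smooth_fun_def)
  have deriv: "(\<phi> has_derivative ?d x) (at x)" for x
    using smooth by (auto simp: frechet_derivative_works[symmetric])
  have "\<exists>B. \<forall>x. \<bar>?d x i\<bar> \<le> B" if i: "i \<in> Basis" for i
  proof -
    have "continuous_on ?S (\<lambda>x. ?d x i)"
      using smooth i by (auto intro: continuous_on_subset)
    then have "bounded ((\<lambda>x. ?d x i) ` ?S)" using S by (intro compact_imp_bounded compact_continuous_image)
    then obtain B where B: "0 < B" "\<And>x. x \<in> ?S \<Longrightarrow> \<bar>?d x i\<bar> \<le> B" unfolding bounded_pos by auto
    have "\<bar>?d x i\<bar> \<le> B" for x
    proof (cases "x \<in> ?S")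
      case False
      have "((\<lambda>y. 0::real) has_derivative (\<lambda>y. 0)) (at x)" by simp
      then have "(\<phi> has_derivative (\<lambda>y. 0)) (at x)"
      proof (rule has_derivative_transform_within_open[where s = "- closure {x. \<phi> x \<noteq> 0}"])
        show "open (- ?S)" "x \<in> - ?S" using False by auto
        show "0 = \<phi> y" if "y \<in> - ?S" for y using that closure_subset[of "{x. \<phi> x \<noteq> 0}"] by auto
      qed
      then have "?d x = (\<lambda>y. 0)" by (rule has_derivative_unique[OF deriv])
      then show ?thesis using B(1) by simp
    qed (rule B(2))
    then show ?thesis by blast
  qed
  then have "\<forall>i\<in>Basis. \<exists>B. \<forall>x. \<bar>?d x i\<bar> \<le> B" by (rule ballI)
  from bchoice[OF this] obtain B where B: "\<forall>i\<in>Basis. \<forall>x. \<bar>?d x i\<bar> \<le> B i" by blast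
  define L where "L = (\<Sum>i\<in>Basis. B i)"
  have "norm (?d x v) \<le> L * norm v" for x v
  proof -
    interpret bounded_linear "?d x" using deriv has_derivative_bounded_linear by blast
    have "?d x v = (\<Sum>i\<in>Basis. (v \<bullet> i) * ?d x i)"
      by (subst euclidean_representation[of v, symmetric]) (simp only: sum scaleR real_scaleR_def)
    also have "norm \<dots> \<le> (\<Sum>i\<in>Basis. norm v * B i)"
      unfolding real_norm_def using B
      by (intro order_trans[OF sum_abs] sum_mono) (auto simp: abs_mult intro!: mult_mono Basis_le_norm)
    also have "\<dots> = L * norm v" by (simp add: L_def sum_distrib_left mult.commute)
    finally show ?thesis by simp
  qed
  then have "onorm (?d x) \<le> L" for x by (rule onorm_le)
  then have "norm (\<phi> x - \<phi> y) \<le> L * norm (x - y)" for x y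
    using deriv by (intro differentiable_bound[of UNIV]) auto
  then show thesis by (intro that) simp
qed

text \<open>Convexity gives continuity on the open half-line, right continuity and oddness extend it
  through 0 to the line, and the upper bound on t g'(t) / g(t) gives doubling.\<close>

lemma standing_odd_convex_growth:
  assumes "standing_assumptions N s g"
  obtains C where "odd_convex_growth g C"
proof -
  have rc: "\<And>t. 0 \<le> t \<Longrightarrow> continuous (at_right t) g" and odd: "\<And>t. g (- t) = - g t" and g0: "g 0 = 0"
    and pos: "\<And>t. 0 < t \<Longrightarrow> 0 < g t" and cvx: "convex_on {0<..} g"
    using assms by (auto simp: standing_assumptions_def)
  obtain c where bnd: "\<And>t. 0 < t \<Longrightarrow> g differentiable (at t) \<Longrightarrow> t * deriv g t / g t \<le> c"
    using assms unfolding standing_assumptions_def by blast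
  have lim0: "(g \<longlongrightarrow> g 0) (at_right 0)" using rc[of 0] by (simp add: continuous_within)
  have cvx0: "convex_on {0..} g" by (rule convex_on_right_cont_0[OF cvx lim0])
  have mono: "mono_on {0..} g"
  proof (rule mono_onI)
    fix a b :: real assume ab: "a \<in> {0..}" "b \<in> {0..}" "a \<le> b"
    show "g a \<le> g b"
    proof (cases "b = 0")
      case False
      then have b: "0 < b" using ab by auto
      have "g ((1 - a / b) *\<^sub>R 0 + (a / b) *\<^sub>R b) \<le> (1 - a / b) * g 0 + (a / b) * g b"
        using ab b by (intro convex_onD[OF cvx0]) auto
      then have "g a \<le> (a / b) * g b" using b g0 by simp
      also have "\<dots> \<le> 1 * g b" using ab b pos[OF b] by (intro mult_right_mono) auto
      finally show ?thesis by simp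
    qed (use ab in auto)
  qed
  have "continuous_on {0<..} g" by (rule convex_on_continuous[OF _ cvx]) simp
  then have cont_pos: "isCont g t" if "0 < t" for t
    using that by (simp add: continuous_on_eq_continuous_at)
  have cont: "isCont g t" for t
  proof (cases t "0::real" rule: linorder_cases)
    case less
    then have "isCont g (- t)" using cont_pos[of "- t"] by simp
    then have "isCont (\<lambda>x. g (- x)) t" by (rule isCont_o2[where f = uminus and g = g, OF continuous_minus[OF continuous_ident]])
    then have "isCont (\<lambda>x. - g (- x)) t" by (rule continuous_minus)
    then show ?thesis by (simp only: odd minus_minus)
  next
    case equal
    have "((\<lambda>t. - g t) \<longlongrightarrow> - g 0) (at_right 0)" by (rule tendsto_minus[OF lim0])
    then have "(g \<longlongrightarrow> g 0) (at_left 0)" by (simp add: filterlim_at_left_to_right odd g0)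
    then have "(g \<longlongrightarrow> g 0) (at 0)" using lim0 by (simp add: filterlim_at_split)
    then show ?thesis by (simp add: isCont_def equal)
  qed (rule cont_pos)
  obtain C where C: "0 < C" "\<And>t. 0 < t \<Longrightarrow> g (2 * t) \<le> C * g t"
    by (rule convex_on_doubling[OF cvx _ mono]) (erule pos, erule (1) bnd, rule that)
  have "odd_convex_growth g C"
  proof
    show "g (2 * t) \<le> C * g t" if "0 \<le> t" for t using C(2)[of t] that g0 by (cases "t = 0") auto
  qed (use odd pos cont cvx0 in auto)
  then show thesis by (rule that)
qed

lemma ess_inf_on_pos:
  fixes u :: "'a::euclidean_space \<Rightarrow> real"
  assumes u: "u \<in> borel_measurable borel" and K: "K \<in> sets lebesgue" "K \<subseteq> K'"
    and c: "0 < c" and le: "AE x in lborel. x \<in> K' \<longrightarrow> c \<le> u x"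
  shows "0 < ess_inf_on K u"
proof -
  have [measurable]: "u \<in> borel_measurable (lebesgue_on K)" by (rule borel_measurable_lebesgue_on[OF u])
  have "AE x in lebesgue. x \<in> K \<longrightarrow> - ereal (u x) \<le> ereal (- c)"
    using le[THEN AE_completion] by eventually_elim (use K(2) in auto)
  then have "AE x in lebesgue_on K. - ereal (u x) \<le> ereal (- c)"
    using K(1) by (subst AE_restrict_space_iff) auto
  then have "esssup (lebesgue_on K) (\<lambda>x. - ereal (u x)) \<le> ereal (- c)"
    by (intro esssup_I) measurable
  then have "ereal c \<le> ess_inf_on K u"
    unfolding ess_inf_on_def using ereal_minus_le_minus[of "ereal (- c)" "esssup (lebesgue_on K) (\<lambda>x. - ereal (u x))"] by simp
  then show ?thesis using c by (auto intro: less_le_trans[of _ "ereal c"])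
qed

section \<open>Existence\<close>

text \<open>f is only Lebesgue measurable on \<Omega> and nonnegative almost everywhere. The
  variational part wants a Borel function that is nonnegative at every point.\<close>

lemma borel_representative:
  fixes f :: "'a::euclidean_space \<Rightarrow> real"
  assumes \<Omega>: "\<Omega> \<in> sets borel" and f: "f \<in> borel_measurable (lebesgue_on \<Omega>)" and nn: "AE x in lebesgue_on \<Omega>. 0 \<le> f x"
  obtains f' where "f' \<in> borel_measurable borel" "\<And>x. 0 \<le> f' x" "AE x in lborel. x \<in> \<Omega> \<longrightarrow> f' x = f x"
proof -
  have \<Omega>l: "\<Omega> \<in> sets lebesgue" using \<Omega> by (intro sets_completionI_sets) simp
  have "(\<lambda>x. if x \<in> \<Omega> then f x else 0) \<in> borel_measurable lebesgue"
    using f \<Omega>l by (simp add: borel_measurable_if)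
  from completion_ex_borel_measurable_real[OF this]
  obtain f' where f': "f' \<in> borel_measurable lborel" "AE x in lborel. (if x \<in> \<Omega> then f x else 0) = f' x" by blast
  have "AE x in lebesgue. x \<in> \<Omega> \<longrightarrow> 0 \<le> f x"
    using nn \<Omega>l by (subst (asm) AE_restrict_space_iff) auto
  then have "AE x in lborel. x \<in> \<Omega> \<longrightarrow> 0 \<le> f x" by (simp add: AE_completion_iff)
  with f'(2) have "AE x in lborel. x \<in> \<Omega> \<longrightarrow> max (f' x) 0 = f x" by eventually_elim auto
  then show thesis using f'(1) by (intro that[of "\<lambda>x. max (f' x) 0"]) auto
qed

section \<open>Return to the original data\<close>

context singular_problem
begin

lemma singular_term_integrable:
  assumes u: "u \<in> borel_measurable borel" and K: "K \<in> sets borel" "K \<subseteq> \<Omega>"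
    and c: "0 < c" "c \<le> 1" and le: "AE x in lborel. x \<in> K \<longrightarrow> c \<le> u x"
  shows "integrable lborel (\<lambda>x. indicator K x * (f x * u x powr (- q x)))"
proof (rule Bochner_Integration.integrable_bound)
  note [measurable] = u K(1)
  show "integrable lborel (\<lambda>x. c powr (- Q) * (f x * indicator \<Omega> x))" using f_integrable by simp
  show "(\<lambda>x. indicator K x * (f x * u x powr (- q x))) \<in> borel_measurable lborel" by measurable
  show "AE x in lborel. norm (indicator K x * (f x * u x powr (- q x))) \<le> norm (c powr (- Q) * (f x * indicator \<Omega> x))"
    using le
  proof eventually_elim
    case (elim x)
    show ?case
    proof (cases "x \<in> K")
      case True
      then have "u x powr (- q x) \<le> c powr (- q x)" using elim c q_nonneg[of x] by (intro powr_mono2') auto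
      also have "\<dots> \<le> c powr (- Q)" using c q_le[of x] by (intro powr_mono') auto
      finally have "u x powr (- q x) * f x \<le> c powr (- Q) * f x" using f_nonneg by (intro mult_right_mono)
      moreover have "x \<in> \<Omega>" using True K by blast
      ultimately show ?thesis using True f_nonneg[of x] by (simp add: abs_mult mult.commute)
    qed simp
  qed
qed

text \<open>The equation was derived for a Borel representative f and for Borel measure. Here f0 and
  q0 are the original data, and every integral is moved to the completion and changed on null
  sets.\<close>

lemma weak_solution_transfer:
  assumes ne: "\<Omega> \<noteq> {}" and f0: "f0 \<in> borel_measurable (lebesgue_on \<Omega>)" "AE x in lborel. x \<in> \<Omega> \<longrightarrow> f x = f0 x"
    and q0: "\<And>x. x \<in> \<Omega> \<Longrightarrow> q x = q0 x"
    and u: "u \<in> W" and pos: "\<And>x. x \<in> \<Omega> \<Longrightarrow> 0 < u x"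
    and lower: "\<And>K. compact K \<Longrightarrow> K \<subseteq> \<Omega> \<Longrightarrow> \<exists>c>0. c \<le> 1 \<and> (AE x in lborel. x \<in> K \<longrightarrow> c \<le> u x)"
    and eq: "\<And>\<phi> K. \<phi> \<in> W \<Longrightarrow> compact K \<Longrightarrow> K \<subseteq> \<Omega> \<Longrightarrow> (\<And>x. x \<notin> K \<Longrightarrow> \<phi> x = 0) \<Longrightarrow>
      (\<integral>z. g (D u z) * D \<phi> z \<partial>\<kappa>) = (\<integral>x. f x * u x powr (- q x) * \<phi> x \<partial>lborel)"
  shows "weak_solution s g \<Omega> f0 q0 u"
proof -
  note [measurable] = W_measurable[OF u]
  have \<Omega>l: "\<Omega> \<in> sets lebesgue" using dom_measurable by (intro sets_completionI_sets) simp
  \<comment> \<open>Extension by zero makes the original datum Lebesgue measurable on the whole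
    space, so integrals over \<Omega> and over K become integrals over the space.\<close>
  define f1 where "f1 x = (if x \<in> \<Omega> then f0 x else 0)" for x
  have f1: "f1 \<in> borel_measurable lebesgue" unfolding f1_def using f0(1) \<Omega>l by (simp add: borel_measurable_if)
  have mterm: "(\<lambda>x. f1 x * u x powr (- q x) * \<phi> x) \<in> borel_measurable lebesgue" if "\<phi> \<in> borel_measurable borel" for \<phi>
  proof -
    have "(\<lambda>x. u x powr (- q x) * \<phi> x) \<in> borel_measurable lebesgue"
      using that by (intro measurable_completion) measurable
    from borel_measurable_times[OF f1 this] show ?thesis by (simp add: mult.assoc)
  qed
  have ae: "AE x in lebesgue. x \<in> \<Omega> \<longrightarrow> f x = f1 x"
    using f0(2)[THEN AE_completion] by eventually_elim (simp add: f1_def)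
  have loc: "set_integrable lebesgue K (\<lambda>x. f0 x * u x powr (- q0 x))" if K: "compact K" "K \<subseteq> \<Omega>" for K
  proof -
    have Kb: "K \<in> sets borel" using K(1) by (simp add: borel_compact)
    obtain c where c: "0 < c" "c \<le> 1" "AE x in lborel. x \<in> K \<longrightarrow> c \<le> u x"
      using lower[OF K] by (elim exE conjE) (rule that)
    let ?F = "\<lambda>x. indicator K x * (f x * u x powr (- q x))"
    have "integrable lborel ?F" by (rule singular_term_integrable[OF W_measurable[OF u] Kb K(2) c])
    then have i: "integrable lebesgue ?F" using Kb by (subst integrable_completion) auto
    have eq1: "indicat_real K x *\<^sub>R (f0 x * u x powr (- q0 x)) = f1 x * u x powr (- q x) * indicator K x" for x
      using K(2) q0[of x] by (auto simp: f1_def split: split_indicator)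
    show ?thesis
      unfolding set_integrable_def eq1
    proof (rule integrable_cong_AE_imp[OF i])
      show "(\<lambda>x. f1 x * u x powr (- q x) * indicator K x) \<in> borel_measurable lebesgue"
        using Kb by (intro mterm) simp
      show "AE x in lebesgue. indicator K x * (f x * u x powr (- q x)) = f1 x * u x powr (- q x) * indicator K x"
        using ae by eventually_elim (use K(2) in \<open>auto split: split_indicator\<close>)
    qed
  qed
  have weak: "integrable lebesgue (weak_form_integrand s g u \<phi>) \<and>
        (LINT z|lebesgue. weak_form_integrand s g u \<phi> z) = (LINT x:\<Omega>|lebesgue. f0 x * u x powr (- q0 x) * \<phi> x)"
    if \<phi>: "\<phi> \<in> test_functions \<Omega>" for \<phi>
  proof -
    let ?S = "closure {x. \<phi> x \<noteq> 0}"
    have S: "compact ?S" "?S \<subseteq> \<Omega>" using \<phi> by (auto simp: test_functions_def)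
    have out: "\<phi> x = 0" if "x \<notin> ?S" for x using contra_subsetD[OF closure_subset that] by simp
    obtain L where L: "\<And>x y. \<bar>\<phi> x - \<phi> y\<bar> \<le> L * norm (x - y)" by (rule test_function_lipschitz[OF \<phi>]) (rule that)
    have \<phi>W: "\<phi> \<in> W"
    proof (rule W_lipschitz[OF L])
      show "\<phi> x = 0" if "x \<notin> \<Omega>" for x by (rule out) (use that S(2) in blast)
    qed
    note [measurable] = W_measurable[OF \<phi>W]
    have eq1: "indicat_real \<Omega> x *\<^sub>R (f0 x * u x powr (- q0 x) * \<phi> x) = f1 x * u x powr (- q x) * \<phi> x" for x
      using q0[of x] by (simp add: f1_def split: split_indicator)
    have "(LINT x:\<Omega>|lebesgue. f0 x * u x powr (- q0 x) * \<phi> x) = (\<integral>x. f1 x * u x powr (- q x) * \<phi> x \<partial>lebesgue)"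
      unfolding set_lebesgue_integral_def eq1 by (rule refl)
    also have "\<dots> = (\<integral>x. f x * u x powr (- q x) * \<phi> x \<partial>lebesgue)"
    proof (rule integral_cong_AE)
      show "(\<lambda>x. f1 x * u x powr (- q x) * \<phi> x) \<in> borel_measurable lebesgue" by (rule mterm) measurable
      show "(\<lambda>x. f x * u x powr (- q x) * \<phi> x) \<in> borel_measurable lebesgue"
        by (intro measurable_completion) measurable
      show "AE x in lebesgue. f1 x * u x powr (- q x) * \<phi> x = f x * u x powr (- q x) * \<phi> x"
        using ae by eventually_elim (use W_outside[OF \<phi>W] in auto)
    qed
    also have "\<dots> = (\<integral>x. f x * u x powr (- q x) * \<phi> x \<partial>lborel)"
      by (rule integral_completion) measurable
    also have "\<dots> = (LINT z|lebesgue. weak_form_integrand s g u \<phi> z)"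
      unfolding weak_form_integral(2)[OF u \<phi>W] by (rule eq[OF \<phi>W S out, symmetric])
    finally show ?thesis using weak_form_integral(1)[OF u \<phi>W] by simp
  qed
  show ?thesis
    unfolding weak_solution_def L1_loc_def
    using W_frac_space_hat[OF u ne] W_frac_space_zero[OF u] pos loc weak by blast
qed

end

theorem theorem3p2:
  fixes \<Omega> :: "'a::euclidean_space set" and s \<delta> :: real
    and g :: "real \<Rightarrow> real" and q f :: "'a \<Rightarrow> real"
  assumes "smooth_bounded_domain \<Omega>"
    and "0 < s" and "s < 1"
    and "standing_assumptions DIM('a) s g"
    and "C1_closure \<Omega> q" and "\<forall>x\<in>closure \<Omega>. 0 \<le> q x"
    and "0 < \<delta>" and "\<forall>x\<in>boundary_strip \<Omega> \<delta>. q x \<le> 1"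
    and "f \<in> orlicz_space (N_conjugate (sobolev_conjugate DIM('a) s (primitive g))) \<Omega>"
    and "AE x in lebesgue_on \<Omega>. 0 \<le> f x" and "\<not> (AE x in lebesgue_on \<Omega>. f x = 0)"
  shows "\<exists>u. weak_solution s g \<Omega> f q u \<and> u \<in> frac_space_zero s (primitive g) \<Omega> \<and>
           (\<forall>K. K \<in> sets lebesgue \<and> compactly_contained K \<Omega> \<longrightarrow> 0 < ess_inf_on K u)"
proof -
  have \<Omega>: "open \<Omega>" "\<Omega> \<noteq> {}" "bounded \<Omega>" using assms(1) by (auto simp: smooth_bounded_domain_def)
  have \<Omega>b: "\<Omega> \<in> sets borel" using \<Omega>(1) by simp
  have \<Omega>l: "\<Omega> \<in> sets lebesgue" using \<Omega>b by (intro sets_completionI_sets) simp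
  obtain C where "odd_convex_growth g C" by (rule standing_odd_convex_growth[OF assms(4)])
  then interpret odd_convex_growth g C .
  interpret nonlocal_domain g C s \<Omega>
    using assms(2-4) \<Omega> by unfold_locales (auto simp: standing_assumptions_def)
  have Gs: "sobolev_conjugate DIM('a) s (primitive g) = Gs" by (simp add: sobolev_conjugate_def)
  obtain \<tau> where fm: "f \<in> borel_measurable (lebesgue_on \<Omega>)" and \<tau>: "0 < \<tau>"
      and mod: "orlicz_modular (N_conjugate Gs) \<Omega> (\<lambda>x. f x / \<tau>) < \<infinity>"
    using assms(9) unfolding orlicz_space_def Gs by blast
  obtain f' where f': "f' \<in> borel_measurable borel" "\<And>x. 0 \<le> f' x" "AE x in lborel. x \<in> \<Omega> \<longrightarrow> f' x = f x"
    by (rule borel_representative[OF \<Omega>b fm assms(10)]) (rule that)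
  have "(\<integral>\<^sup>+x. ennreal (N_conjugate Gs (f' x / \<tau>)) * indicator \<Omega> x \<partial>lborel)
      = (\<integral>\<^sup>+x. ennreal (N_conjugate Gs \<bar>f x / \<tau>\<bar>) * indicator \<Omega> x \<partial>lborel)"
    using f'(3)
  proof (intro nn_integral_cong_AE, eventually_elim)
    case (elim x)
    then show ?case using f'(2)[of x] \<tau> by (auto split: split_indicator)
  qed
  also have "\<dots> = orlicz_modular (N_conjugate Gs) \<Omega> (\<lambda>x. f x / \<tau>)"
    unfolding orlicz_modular_def using \<Omega>l by (subst nn_integral_restrict_space) (auto simp: nn_integral_completion)
  finally have f_conj: "(\<integral>\<^sup>+x. ennreal (N_conjugate Gs (f' x / \<tau>)) * indicator \<Omega> x \<partial>lborel) < \<infinity>" using mod by simp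
  have qc: "continuous_on (closure \<Omega>) q" using assms(5) by (simp add: C1_closure_def)
  have "compact (closure \<Omega>)" using \<Omega>(3) by (simp add: compact_closure)
  then have "bounded (q ` closure \<Omega>)" using qc by (intro compact_imp_bounded compact_continuous_image)
  then obtain Q where Q: "0 < Q" "\<And>x. x \<in> closure \<Omega> \<Longrightarrow> \<bar>q x\<bar> \<le> Q" unfolding bounded_pos by auto
  \<comment> \<open>q is controlled only on the closure of \<Omega>. Extension by 0 gives a Borel
    exponent with 0 \<le> q' \<le> Q everywhere.\<close>
  define q' where "q' x = (if x \<in> \<Omega> then q x else 0)" for x
  have cl: "x \<in> closure \<Omega>" if "x \<in> \<Omega>" for x using that closure_subset by blast
  have "q' \<in> borel_measurable borel"
    unfolding q'_def using \<Omega>b continuous_on_subset[OF qc closure_subset]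
    by (intro borel_measurable_continuous_on_if) auto
  then interpret singular_problem g C s \<Omega> f' q' \<tau> Q
    using f' \<tau> f_conj Q assms(6) cl by unfold_locales (auto simp: q'_def abs_le_iff)
  \<comment> \<open>The part of \<Omega> left over by the boundary strip. Its distance \<delta> from
    the frontier makes it compact in \<Omega>, and outside it q \<le> 1.\<close>
  define K0 where "K0 = {x \<in> closure \<Omega>. \<delta> \<le> infdist x (frontier \<Omega>)}"
  have K0: "compact K0"
  proof -
    have "K0 = closure \<Omega> \<inter> {x. \<delta> \<le> infdist x (frontier \<Omega>)}" by (auto simp: K0_def)
    moreover have "closed {x. \<delta> \<le> infdist x (frontier \<Omega>)}"
      by (intro closed_Collect_le continuous_intros)
    ultimately show ?thesis using \<open>compact (closure \<Omega>)\<close> by (simp add: compact_Int_closed)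
  qed
  have K0_sub: "K0 \<subseteq> \<Omega>"
  proof
    fix x assume x: "x \<in> K0"
    then have "x \<notin> frontier \<Omega>" using assms(7) by (auto simp: K0_def)
    then show "x \<in> \<Omega>" using x \<Omega>(1) by (auto simp: K0_def frontier_def interior_open)
  qed
  have strip: "q' x \<le> 1" if "x \<in> \<Omega>" "x \<notin> K0" for x
    using that assms(8) cl[of x] by (auto simp: q'_def K0_def boundary_strip_def)
  have nz: "\<not> (AE x in lborel. x \<in> \<Omega> \<longrightarrow> f' x = 0)"
  proof
    assume "AE x in lborel. x \<in> \<Omega> \<longrightarrow> f' x = 0"
    then have "AE x in lborel. x \<in> \<Omega> \<longrightarrow> f x = 0" using f'(3) by eventually_elim auto
    then have "AE x in lebesgue_on \<Omega>. f x = 0"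
      using \<Omega>l by (subst AE_restrict_space_iff) (auto intro: AE_completion)
    with assms(11) show False by blast
  qed
  show ?thesis
  proof (rule limit_solution[OF K0 K0_sub strip nz])
    fix u assume u: "u \<in> W" and pos: "\<And>x. x \<in> \<Omega> \<Longrightarrow> 0 < u x"
      and lower: "\<And>K. compact K \<Longrightarrow> K \<subseteq> \<Omega> \<Longrightarrow> \<exists>c>0. c \<le> 1 \<and> (AE x in lborel. x \<in> K \<longrightarrow> c \<le> u x)"
      and eq: "\<And>\<phi> K. \<phi> \<in> W \<Longrightarrow> compact K \<Longrightarrow> K \<subseteq> \<Omega> \<Longrightarrow> (\<And>x. x \<notin> K \<Longrightarrow> \<phi> x = 0) \<Longrightarrow>
        (\<integral>z. g (D u z) * D \<phi> z \<partial>\<kappa>) = (\<integral>x. f' x * u x powr (- q' x) * \<phi> x \<partial>lborel)"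
    have "weak_solution s g \<Omega> f q u"
      by (rule weak_solution_transfer[OF \<Omega>(2) fm f'(3) _ u pos lower eq]) (simp add: q'_def)
    moreover have "0 < ess_inf_on K u" if K: "K \<in> sets lebesgue" "compactly_contained K \<Omega>" for K
    proof -
      have "compact (closure K)" "closure K \<subseteq> \<Omega>" using K(2) by (auto simp: compactly_contained_def)
      from lower[OF this] obtain c where c: "0 < c" "c \<le> 1" "AE x in lborel. x \<in> closure K \<longrightarrow> c \<le> u x"
        by (elim exE conjE) (rule that)
      show ?thesis by (rule ess_inf_on_pos[OF W_measurable[OF u] K(1) closure_subset c(1,3)])
    qed
    ultimately show ?thesis using W_frac_space_zero[OF u] by blast
  qed
qed

end
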